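(* Let $(X_j)_{j\ge1}$ be a sequence of centered real-valued random variables such that, for some $M>0$, $\sup_{i\ge1}\|X_i\|_\infty\le M$, and such that, for some $c>0$, its strong mixing coefficients satisfy $\alpha(n)\le\exp(-2cn)$ for all $n\ge1$. Let $S_n=\sum_{i=1}^nX_i$, $\sigma_n^2=\mathrm{Var}(S_n)$, and assume that $\liminf_{n\to\infty}\sigma_n^2/n>0$. Then for every sequence of positive reals $(a_n)$ with $$a_n\to0\quad\text{and}\quad\frac{na_n}{(\log n)^2(\log\log n)^2}\to\infty,$$ the sequence $(\sigma_n^{-1}S_n)_{n\ge1}$ satisfies the moderate deviations principle with speed $a_n$ and good rate function $I(t)=t^2/2$.
   Context: For $\sigma$-algebras $\mathcal{A},\mathcal{B}$, $\alpha(\mathcal{A},\mathcal{B})=\sup_{A\in\mathcal{A},B\in\mathcal{B}}|\mathbb{P}(A\cap B)-\mathbb{P}(A)\mathbb{P}(B)|$. The strong mixing coefficients of $(X_k)_{k\ge1}$ are $\alpha(n)=\sup_{k\ge1}\alpha(\sigma(X_i,i\le k),\sigma(X_i,i\ge k+n))$. $\|Y\|_\infty$ denotes the essential supremum norm of $Y$. A sequence $(T_n)$ of real random variables satisfies the moderate deviations principle with speed $a_n\to0$ and rate function $I$ if for each Borel set $A\subset\mathbb{R}$, $$-\inf_{t\in A^o}I(t)\le\liminf_n a_n\log\mathbb{P}(\sqrt{a_n}\,T_n\in A)\le\limsup_n a_n\log\mathbb{P}(\sqrt{a_n}\,T_n\in A)\le-\inf_{t\in\bar A}I(t),$$ where $\bar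 A$ and $A^o$ denote the closure and interior of $A$. (Here $\sigma_n>0$ for all large $n$, so $\sigma_n^{-1}S_n$ is defined for large $n$.) *)

theory Defs
  imports "HOL-Probability.Probability"
begin

definition gen_sigma :: "'a measure \<Rightarrow> (nat \<Rightarrow> 'a \<Rightarrow> real) \<Rightarrow> nat set \<Rightarrow> 'a set set" where
  "gen_sigma P X J =
     sigma_sets (space P) (\<Union>i\<in>J. {X i -` B \<inter> space P | B. B \<in> sets borel})"

text \<open>For a probability measure \<open>P\<close> and nonempty sets of events, the real-valued suprema below
  range over nonempty sets of reals bounded by \<open>1\<close>, so they are genuine suprema.\<close>

definition alpha_coeff :: "'a measure \<Rightarrow> 'a set set \<Rightarrow> 'a set set \<Rightarrow> real" where
  "alpha_coeff P \<A> \<B> =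
     (SUP (A, B) \<in> \<A> \<times> \<B>. \<bar>measure P (A \<inter> B) - measure P A * measure P B\<bar>)"

text \<open>Sequences \<open>X\<close> are indexed from \<open>1\<close>; the value \<open>X 0\<close> is never used.\<close>

definition strong_mixing :: "'a measure \<Rightarrow> (nat \<Rightarrow> 'a \<Rightarrow> real) \<Rightarrow> nat \<Rightarrow> real" where
  "strong_mixing P X n =
     (SUP k\<in>{1..}. alpha_coeff P (gen_sigma P X {1..k}) (gen_sigma P X {k + n..}))"

definition Linf_norm :: "'a measure \<Rightarrow> ('a \<Rightarrow> real) \<Rightarrow> ereal" where
  "Linf_norm P Y = esssup P (\<lambda>\<omega>. ereal \<bar>Y \<omega>\<bar>)"

definition partial_sum :: "(nat \<Rightarrow> 'a \<Rightarrow> real) \<Rightarrow> nat \<Rightarrow> 'a \<Rightarrow> real" where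
  "partial_sum X n \<omega> = (\<Sum>i=1..n. X i \<omega>)"

text \<open>The logarithm of a probability, with \<open>log 0 = -\<infinity>\<close> (whereas \<open>ln 0 = 0\<close> on the reals).\<close>

definition log_prob :: "real \<Rightarrow> ereal" where
  "log_prob p = (if p = 0 then -\<infinity> else ereal (ln p))"

text \<open>Compactness of the sublevel sets subsumes lower semicontinuity, which amounts to
  their closedness.\<close>

definition good_rate_function :: "(real \<Rightarrow> ereal) \<Rightarrow> bool" where
  "good_rate_function I \<longleftrightarrow> (\<forall>t. 0 \<le> I t) \<and> (\<forall>r::real. compact {t. I t \<le> ereal r})"

text \<open>The infima are taken in the extended reals, so the infimum over the empty set is
  \<open>\<infinity>\<close>.\<close>

definition moderate_deviations_principle ::
  "'a measure \<Rightarrow> (nat \<Rightarrow> 'a \<Rightarrow> real) \<Rightarrow> (nat \<Rightarrow> real) \<Rightarrow> (real \<Rightarrow> ereal) \<Rightarrow> bool" where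
  "moderate_deviations_principle P T a I \<longleftrightarrow>
     a \<longlonglongrightarrow> 0 \<and>
     (\<forall>A\<in>sets borel.
        (let L = (\<lambda>n. ereal (a n) *
                   log_prob (measure P {\<omega> \<in> space P. sqrt (a n) * T n \<omega> \<in> A}))
         in - (INF t\<in>interior A. I t) \<le> liminf L \<and>
            liminf L \<le> limsup L \<and>
            limsup L \<le> - (INF t\<in>closure A. I t)))"

end

theory Submission
  imports Defs "HOL-Real_Asymp.Real_Asymp"
begin

text \<open>
  By an elementary form of the Gaertner-Ellis theorem it is enough to show, for the centred sums
  \<open>S\<^sub>n\<close> and \<open>s = O(1 / l)\<close> with \<open>l = sqrt (n * a n)\<close>, that
  \<open>ln E exp (s * S\<^sub>n) = s\<^sup>2 * Var S\<^sub>n / 2 + o(n / l\<^sup>2)\<close>. Strong mixing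
  decouples exponentials of two block sums of total length \<open>m\<close> as soon as the blocks are separated
  by a gap of order \<open>\<bar>s\<bar> * m + ln n\<close>. Halving the index set repeatedly, with a gap removed
  from the middle each time, leaves a Cantor-like set \<open>K\<close> of nearly independent blocks, on each of
  which the third-order expansion of the Laplace transform is accurate. The removed set has a proportion
  \<open>o(1 / ln l)\<close> of the indices. On it the construction is repeated about \<open>log 2 l\<close> times, until what
  remains is so small that the trivial bound suffices; Hoelder's inequality with equal weights for
  these pieces loses only a factor of order \<open>ln l\<close>, which is the source of the factor
  \<open>(ln (ln n))\<^sup>2\<close> in the assumption on the speed.
\<close>

text \<open>Strong mixing compares probabilities of events, so decoupling two bounded functions
  costs \<open>exp (- 2 * c * g)\<close> times the product of their sup norms. For exponentials of
  block sums of total length \<open>m\<close> these can be as large as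
  \<open>exp (|s| * M * m)\<close>, so a gap has to be proportional to what it separates. Detaching
  blocks one after another would make each gap proportional to the whole remaining length; by
  halving, each level loses about the same proportion \<open>kap\<close>, a bound for
  \<open>|s| * M / (2 * c)\<close>, and there are only \<open>O(ln n)\<close> levels. The removed
  indices are interlaced with the kept ones, so the two sums cannot be decoupled, which leaves
  Hoelder's inequality. With \<open>k\<close> equal weights it multiplies the Laplace parameter by
  \<open>k\<close> and the total quadratic term by about \<open>k\<close>, so a removed proportion
  of order \<open>r / k\<close> costs \<open>r * n / l\<^sup>2\<close>. The balance
  \<open>r\<^sup>2 * l = k * ln n\<close> meets all demands at once: blocks of length
  \<open>r * l\<close> have a small third-order error and lose only the proportion
  \<open>ln n / (r * l) = r / k\<close> to the gaps.\<close>

section \<open>Generated sigma-algebras, and covariances of bounded functions from covariances of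
  events\<close>

definition partial_sigma :: "'a measure \<Rightarrow> (nat \<Rightarrow> 'a \<Rightarrow> real) \<Rightarrow> nat set \<Rightarrow> 'a measure" where
  "partial_sigma P Y J = sigma (space P) (\<Union>i\<in>J. {Y i -` B \<inter> space P | B. B \<in> sets borel})"

lemma space_partial_sigma [simp]: "space (partial_sigma P Y J) = space P"
  unfolding partial_sigma_def by (rule space_measure_of) auto

lemma sets_partial_sigma: "sets (partial_sigma P Y J) = gen_sigma P Y J"
  unfolding partial_sigma_def gen_sigma_def by (rule sets_measure_of) auto

lemma measurable_partial_sigma:
  assumes "i \<in> J"
  shows "Y i \<in> borel_measurable (partial_sigma P Y J)"
proof (rule measurableI)
  fix B :: "real set" assume "B \<in> sets borel"
  then have "Y i -` B \<inter> space P \<in> gen_sigma P Y J"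
    unfolding gen_sigma_def using assms by (intro sigma_sets.Basic) auto
  then show "Y i -` B \<inter> space (partial_sigma P Y J) \<in> sets (partial_sigma P Y J)"
    by (simp add: sets_partial_sigma)
qed simp

text \<open>The sum counts the thresholds \<open>i / n\<close> below \<open>u\<close>, of which
  there are \<open>ceiling (n * u)\<close>. This is how a bounded function is replaced by an average
  of indicators of its level sets.\<close>

lemma ceiling_fraction_bounds:
  fixes u :: real
  assumes "0 \<le> u" "u \<le> 1" "0 < n"
  shows "\<bar>u - (\<Sum>i<n. of_bool (real i / real n < u)) / real n\<bar> \<le> 1 / real n"
proof -
  have sub: "{i. i < n \<and> real i / real n < u} = {..<nat \<lceil>real n * u\<rceil>}"
  proof (intro set_eqI iffI)
    fix i assume "i \<in> {i. i < n \<and> real i / real n < u}"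
    then have "real i < real n * u" using assms by (simp add: field_simps)
    then show "i \<in> {..<nat \<lceil>real n * u\<rceil>}" by (simp; linarith)
  next
    fix i assume "i \<in> {..<nat \<lceil>real n * u\<rceil>}"
    then have "int i < \<lceil>real n * u\<rceil>" by (simp; linarith)
    then have "real i < real n * u" by linarith
    moreover have "real n * u \<le> real n" using assms by (simp add: mult_left_le)
    ultimately have "i < n" by linarith
    then show "i \<in> {i. i < n \<and> real i / real n < u}"
      using \<open>real i < real n * u\<close> assms by (auto simp: field_simps)
  qed
  have "(\<Sum>i<n. of_bool (real i / real n < u)) = real (card {i. i < n \<and> real i / real n < u})"
    by (simp add: of_bool_def sum.If_cases Int_def)
  also have "\<dots> = real (nat \<lceil>real n * u\<rceil>)" by (simp add: sub)
  finally have eq: "(\<Sum>i<n. of_bool (real i / real n < u)) = real (nat \<lceil>real n * u\<rceil>)" .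
  have "0 \<le> real n * u" using assms by simp
  then have "\<bar>real n * u - real (nat \<lceil>real n * u\<rceil>)\<bar> \<le> 1" by linarith
  moreover have "u - real (nat \<lceil>real n * u\<rceil>) / real n = (real n * u - real (nat \<lceil>real n * u\<rceil>)) / real n"
    using assms by (simp add: field_simps)
  ultimately show ?thesis using assms unfolding eq by (simp add: divide_right_mono)
qed

context prob_space begin

text \<open>A function with values in [0,1] is the average over all thresholds of the indicators of
  its level sets, so the covariance of two such functions is a double average of covariances of
  level events and inherits the bound \<open>e\<close> without a constant. A Riemann sum with
  \<open>n\<close> thresholds stands in for the integral, and \<open>n\<close> tends to infinity at
  the end.\<close>

lemma covariance_le_of_level_sets:
  fixes U V :: "'a \<Rightarrow> real"
  assumes [measurable]: "U \<in> borel_measurable M" "V \<in> borel_measurable M"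
    and U: "\<And>x. 0 \<le> U x" "\<And>x. U x \<le> 1" and V: "\<And>x. 0 \<le> V x" "\<And>x. V x \<le> 1"
    and level: "\<And>s t. \<bar>prob ({x \<in> space M. s < U x} \<inter> {x \<in> space M. t < V x})
        - prob {x \<in> space M. s < U x} * prob {x \<in> space M. t < V x}\<bar> \<le> e"
  shows "\<bar>expectation (\<lambda>x. U x * V x) - expectation U * expectation V\<bar> \<le> e"
proof -
  have approx: "\<bar>expectation (\<lambda>x. U x * V x) - expectation U * expectation V\<bar> \<le> e + 4 / real n"
    if n: "0 < n" for n
  proof -
    define A where "A i = {x \<in> space M. real i / real n < U x}" for i
    define B where "B i = {x \<in> space M. real i / real n < V x}" for i
    have [measurable]: "A i \<in> sets M" "B i \<in> sets M" for i unfolding A_def B_def by measurable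
    define U' where "U' x = (\<Sum>i<n. indicator (A i) x) / real n" for x
    define V' where "V' x = (\<Sum>i<n. indicator (B i) x) / real n" for x
    have U'b: "\<bar>U x - U' x\<bar> \<le> 1 / n" if "x \<in> space M" for x
      using ceiling_fraction_bounds[of "U x" n] U n that
      by (simp add: U'_def A_def indicator_def of_bool_def)
    have V'b: "\<bar>V x - V' x\<bar> \<le> 1 / n" if "x \<in> space M" for x
      using ceiling_fraction_bounds[of "V x" n] V n that
      by (simp add: V'_def B_def indicator_def of_bool_def)
    have 01: "0 \<le> U' x" "U' x \<le> 1" "0 \<le> V' x" "V' x \<le> 1" for x
    proof -
      have s: "(\<Sum>i<n. indicator (A i) x) \<le> (\<Sum>i<n. 1::real)" "(\<Sum>i<n. indicator (B i) x) \<le> (\<Sum>i<n. 1::real)"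
        by (intro sum_mono; simp)+
      show "0 \<le> U' x" "U' x \<le> 1" "0 \<le> V' x" "V' x \<le> 1"
        using s n by (auto simp: U'_def V'_def divide_le_eq intro!: divide_nonneg_nonneg sum_nonneg)
    qed
    have [measurable]: "U' \<in> borel_measurable M" "V' \<in> borel_measurable M"
      unfolding U'_def V'_def by measurable
    have int: "integrable M U" "integrable M V" "integrable M U'" "integrable M V'"
      "integrable M (\<lambda>x. U x * V x)" "integrable M (\<lambda>x. U' x * V' x)"
      by (rule integrable_const_bound[where B=1]; use U V 01 in \<open>auto intro!: mult_le_one simp: abs_mult\<close>)+
    have [simp]: "integrable M (indicator (A i) :: 'a \<Rightarrow> real)" "integrable M (indicator (B i) :: 'a \<Rightarrow> real)"
      "integrable M (indicator (A i \<inter> B j) :: 'a \<Rightarrow> real)" for i j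
      by (rule integrable_const_bound[where B=1]; simp)+
    have EU': "expectation U' = (\<Sum>i<n. prob (A i)) / n" unfolding U'_def by simp
    have EV': "expectation V' = (\<Sum>i<n. prob (B i)) / n" unfolding V'_def by simp
    have "expectation (\<lambda>x. U' x * V' x) = expectation (\<lambda>x. (\<Sum>i<n. \<Sum>j<n. indicator (A i \<inter> B j) x) / (n*n))"
      unfolding U'_def V'_def by (simp add: sum_product indicator_inter_arith)
    also have "\<dots> = (\<Sum>i<n. \<Sum>j<n. prob (A i \<inter> B j)) / (n*n)" by simp
    finally have "expectation (\<lambda>x. U' x * V' x) - expectation U' * expectation V'
        = (\<Sum>i<n. \<Sum>j<n. prob (A i \<inter> B j) - prob (A i) * prob (B j)) / (n*n)"
      by (simp add: EU' EV' sum_product sum_subtractf diff_divide_distrib)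
    also have "\<bar>\<dots>\<bar> = \<bar>\<Sum>i<n. \<Sum>j<n. prob (A i \<inter> B j) - prob (A i) * prob (B j)\<bar> / (n*n)"
      by (simp add: abs_divide)
    also have "\<dots> \<le> (\<Sum>i<n. \<Sum>j<n. e) / (n*n)"
    proof (rule divide_right_mono)
      show "\<bar>\<Sum>i<n. \<Sum>j<n. prob (A i \<inter> B j) - prob (A i) * prob (B j)\<bar> \<le> (\<Sum>i<n. \<Sum>j<n. e)"
        by (rule order.trans[OF sum_abs], rule sum_mono, rule order.trans[OF sum_abs], rule sum_mono)
          (use level in \<open>auto simp: A_def B_def\<close>)
    qed simp
    also have "\<dots> = e" using n by simp
    finally have e: "\<bar>expectation (\<lambda>x. U' x * V' x) - expectation U' * expectation V'\<bar> \<le> e" .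
    have EUb: "\<bar>expectation U - expectation U'\<bar> \<le> 1/n"
    proof -
      have "\<bar>expectation (\<lambda>x. U x - U' x)\<bar> \<le> expectation (\<lambda>x. 1/n)"
        by (rule order.trans[OF integral_abs_bound], rule integral_mono) (use int U'b in auto)
      then show ?thesis using int prob_space by simp
    qed
    have EVb: "\<bar>expectation V - expectation V'\<bar> \<le> 1/n"
    proof -
      have "\<bar>expectation (\<lambda>x. V x - V' x)\<bar> \<le> expectation (\<lambda>x. 1/n)"
        by (rule order.trans[OF integral_abs_bound], rule integral_mono) (use int V'b in auto)
      then show ?thesis using int prob_space by simp
    qed
    \<comment> \<open>Applied pointwise to \<open>U * V\<close> and once more to the product of the
      expectations; together this gives the error \<open>4 / n\<close>.\<close>
    have prod: "\<bar>u * v - u' * v'\<bar> \<le> 2 / n"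
      if "0 \<le> u" "u \<le> 1" "0 \<le> v'" "v' \<le> 1" "\<bar>u - u'\<bar> \<le> 1/n" "\<bar>v - v'\<bar> \<le> 1/n" for u v u' v' :: real
    proof -
      have "u * v - u' * v' = u * (v - v') + (u - u') * v'" by (simp add: algebra_simps)
      also have "\<bar>\<dots>\<bar> \<le> \<bar>u\<bar> * \<bar>v - v'\<bar> + \<bar>u - u'\<bar> * \<bar>v'\<bar>"
        by (metis abs_mult abs_triangle_ineq)
      also have "\<dots> \<le> 1 * (1/n) + (1/n) * 1"
        by (intro add_mono mult_mono) (use that in auto)
      finally show ?thesis by simp
    qed
    have E01: "0 \<le> expectation U" "expectation U \<le> 1" "0 \<le> expectation V'" "expectation V' \<le> 1"
      using U 01 int integral_ge_const[of U 0] integral_le_const[of U 1] integral_ge_const[of V' 0] integral_le_const[of V' 1]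
      by auto
    have "\<bar>expectation (\<lambda>x. U x * V x) - expectation (\<lambda>x. U' x * V' x)\<bar> \<le> 2/n"
    proof -
      have "\<bar>expectation (\<lambda>x. U x * V x - U' x * V' x)\<bar> \<le> expectation (\<lambda>x. 2/n)"
        by (rule order.trans[OF integral_abs_bound], rule integral_mono)
          (use int U V 01 U'b V'b prod in auto)
      then show ?thesis using int prob_space by simp
    qed
    moreover have "\<bar>expectation U * expectation V - expectation U' * expectation V'\<bar> \<le> 2/n"
      by (rule prod) (use E01 EUb EVb in auto)
    ultimately show ?thesis using e by (simp add: abs_if split: if_splits)
  qed
  have "(\<lambda>n. e + 4 / real n) \<longlonglongrightarrow> e + 0"
    by (intro tendsto_intros lim_const_over_n)
  then show ?thesis
    using approx by (intro LIMSEQ_le_const[of "\<lambda>n. e + 4 / real n" e]) (auto intro!: exI[of _ 1])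
qed

end

section \<open>Bounded mixing sequences, log-Laplace transforms and Hoelder's inequality\<close>

text \<open>Bounds hold everywhere rather than almost everywhere, and indices start at 0; truncation
  and an index shift reduce the general case to this one.\<close>

locale bounded_mixing = prob_space P for P :: "'a measure" +
  fixes Y :: "nat \<Rightarrow> 'a \<Rightarrow> real" and M c :: real
  assumes measurable_Y [measurable]: "\<And>i. Y i \<in> borel_measurable P"
    and Y_bound: "\<And>i x. \<bar>Y i x\<bar> \<le> M"
    and Y_centered: "\<And>i. expectation (Y i) = 0"
    and M_pos: "0 < M" and c_pos: "0 < c"
    and mixing: "\<And>k g A B. 1 \<le> g \<Longrightarrow> A \<in> gen_sigma P Y {..k} \<Longrightarrow> B \<in> gen_sigma P Y {k + g..} \<Longrightarrow>
      \<bar>prob (A \<inter> B) - prob A * prob B\<bar> \<le> exp (- 2 * c * real g)"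
begin

definition blocksum :: "nat set \<Rightarrow> 'a \<Rightarrow> real" where
  "blocksum J x = (\<Sum>i\<in>J. Y i x)"

definition psi :: "real \<Rightarrow> nat set \<Rightarrow> real" where
  "psi s J = ln (expectation (\<lambda>x. exp (s * blocksum J x)))"

definition V :: "nat set \<Rightarrow> real" where
  "V J = expectation (\<lambda>x. (blocksum J x)\<^sup>2)"

lemma blocksum_measurable [measurable]: "blocksum J \<in> borel_measurable P"
  unfolding blocksum_def[abs_def] by measurable

lemma blocksum_empty [simp]: "blocksum {} x = 0"
  by (simp add: blocksum_def)

lemma blocksum_Un:
  assumes "finite A" "finite B" "A \<inter> B = {}"
  shows "blocksum (A \<union> B) x = blocksum A x + blocksum B x"
  unfolding blocksum_def using assms by (rule sum.union_disjoint)

lemma blocksum_bound: "\<bar>blocksum J x\<bar> \<le> M * card J"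
proof -
  have "\<bar>blocksum J x\<bar> \<le> (\<Sum>i\<in>J. \<bar>Y i x\<bar>)" unfolding blocksum_def by (rule sum_abs)
  also have "\<dots> \<le> (\<Sum>i\<in>J. M)" by (intro sum_mono Y_bound)
  finally show ?thesis by (simp add: mult.commute)
qed

lemma scaled_blocksum_bound: "\<bar>s * blocksum J x\<bar> \<le> \<bar>s\<bar> * M * card J"
  using mult_left_mono[OF blocksum_bound[of J x], of "\<bar>s\<bar>"] by (simp add: abs_mult mult.assoc)

lemma integrable_bounded:
  assumes "f \<in> borel_measurable P" "\<And>x. \<bar>f x\<bar> \<le> (B::real)"
  shows "integrable P f"
  by (rule integrable_const_bound[where B=B]) (use assms in auto)

lemma exp_blocksum_le: "exp (s * blocksum J x) \<le> exp (\<bar>s\<bar> * M * card J)"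
  using scaled_blocksum_bound[of s J x] by (simp add: abs_le_iff)

lemma integrable_exp_blocksum [simp]: "integrable P (\<lambda>x. exp (s * blocksum J x))"
  by (rule integrable_bounded[where B="exp (\<bar>s\<bar> * M * card J)"]) (use exp_blocksum_le in auto)

lemma integrable_Y [simp]: "integrable P (Y i)"
  by (rule integrable_bounded[OF _ Y_bound]) simp

lemma integrable_blocksum [simp]: "integrable P (blocksum J)"
  by (rule integrable_bounded[OF _ blocksum_bound]) simp

lemma integrable_Y_mult [simp]: "integrable P (\<lambda>x. Y i x * Y j x)"
  by (rule integrable_bounded[where B="M * M"])
    (auto simp: abs_mult intro!: mult_mono Y_bound order.trans[OF abs_ge_zero Y_bound])

lemma integrable_blocksum_mult [simp]: "integrable P (\<lambda>x. blocksum I x * blocksum J x)"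
  by (rule integrable_bounded[where B="(M * card I) * (M * card J)"])
    (auto simp: abs_mult intro!: mult_mono blocksum_bound order.trans[OF abs_ge_zero blocksum_bound])

lemma integrable_blocksum_power2 [simp]: "integrable P (\<lambda>x. (blocksum J x)\<^sup>2)"
  by (simp add: power2_eq_square)

lemma expectation_blocksum: "expectation (blocksum J) = 0"
  unfolding blocksum_def[abs_def] by (simp add: Y_centered)

text \<open>Centring enters through \<open>1 + y <= exp y\<close>. The lower bound 1 is what later
  turns additive errors of Laplace transforms into errors of \<open>psi\<close>.\<close>

lemma expectation_exp_ge_1: "1 \<le> expectation (\<lambda>x. exp (s * blocksum J x))"
proof -
  have "expectation (\<lambda>x. 1 + s * blocksum J x) \<le> expectation (\<lambda>x. exp (s * blocksum J x))"
    by (rule integral_mono) (auto intro: exp_ge_add_one_self)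
  then show ?thesis by (simp add: expectation_blocksum prob_space)
qed

lemma exp_psi: "exp (psi s J) = expectation (\<lambda>x. exp (s * blocksum J x))"
  unfolding psi_def using expectation_exp_ge_1[of s J] by (intro exp_ln) linarith

lemma psi_nonneg: "0 \<le> psi s J"
  unfolding psi_def using expectation_exp_ge_1 by simp

lemma psi_empty [simp]: "psi s {} = 0"
  unfolding psi_def by (simp add: prob_space)

lemma V_empty [simp]: "V {} = 0"
  unfolding V_def by simp

lemma V_nonneg: "0 \<le> V J"
  unfolding V_def by simp

lemma psi_trivial_bound: "psi s J \<le> \<bar>s\<bar> * M * card J"
proof -
  have "expectation (\<lambda>x. exp (s * blocksum J x)) \<le> expectation (\<lambda>x. exp (\<bar>s\<bar> * M * card J))"
    by (rule integral_mono) (auto simp del: exp_le_cancel_iff intro!: exp_blocksum_le)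
  then have "exp (psi s J) \<le> exp (\<bar>s\<bar> * M * card J)"
    unfolding exp_psi by (simp add: prob_space)
  then show ?thesis by simp
qed

text \<open>Hoelder's inequality with exponents \<open>1 / w\<close> and \<open>1 / (1 - w)\<close>,
  in logarithmic form. Subtracting the values of \<open>psi\<close> inside the exponents gives both
  exponentials mean 1, so convexity of \<open>exp\<close> suffices. The coefficients
  \<open>u\<close> and \<open>v\<close> may have either sign, which the lower bound for
  \<open>psi\<close> will use.\<close>

lemma psi_holder:
  assumes w: "0 < w" "w < 1" and eq: "\<And>x. s * blocksum J x = u * blocksum A x + v * blocksum B x"
  shows "psi s J \<le> w * psi (u / w) A + (1 - w) * psi (v / (1 - w)) B"
proof -
  define q where "q = w * psi (u / w) A + (1 - w) * psi (v / (1 - w)) B"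
  have "exp (s * blocksum J x - q)
      \<le> w * (exp ((u / w) * blocksum A x) * exp (- psi (u / w) A))
        + (1 - w) * (exp ((v / (1 - w)) * blocksum B x) * exp (- psi (v / (1 - w)) B))" for x
  proof -
    have "s * blocksum J x - q = w * ((u / w) * blocksum A x - psi (u / w) A)
        + (1 - w) * ((v / (1 - w)) * blocksum B x - psi (v / (1 - w)) B)"
    proof -
      have "w * ((u / w) * blocksum A x - psi (u / w) A) = u * blocksum A x - w * psi (u / w) A"
        using assms by (simp add: right_diff_distrib)
      moreover have "(1 - w) * ((v / (1 - w)) * blocksum B x - psi (v / (1 - w)) B)
          = v * blocksum B x - (1 - w) * psi (v / (1 - w)) B"
        using assms by (simp add: right_diff_distrib[of "1 - w"])
      ultimately show ?thesis using assms by (simp add: q_def eq)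
    qed
    also have "exp \<dots> \<le> w * exp ((u / w) * blocksum A x - psi (u / w) A)
        + (1 - w) * exp ((v / (1 - w)) * blocksum B x - psi (v / (1 - w)) B)"
      using convex_onD[OF exp_convex, of "1 - w" "(u / w) * blocksum A x - psi (u / w) A" "(v / (1 - w)) * blocksum B x - psi (v / (1 - w)) B"] assms
      by simp
    finally show ?thesis by (simp add: exp_diff exp_minus divide_inverse)
  qed
  then have "expectation (\<lambda>x. exp (s * blocksum J x - q))
     \<le> expectation (\<lambda>x. w * (exp ((u / w) * blocksum A x) * exp (- psi (u / w) A))
        + (1 - w) * (exp ((v / (1 - w)) * blocksum B x) * exp (- psi (v / (1 - w)) B)))"
    using integrable_exp_blocksum[of "u / w" A] integrable_exp_blocksum[of "v / (1 - w)" B]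
    by (intro integral_mono) (auto simp: exp_diff simp del: times_divide_eq_left)
  also have "\<dots> = w * (exp (psi (u / w) A) * exp (- psi (u / w) A))
        + (1 - w) * (exp (psi (v / (1 - w)) B) * exp (- psi (v / (1 - w)) B))"
    using integrable_exp_blocksum[of "u / w" A] integrable_exp_blocksum[of "v / (1 - w)" B]
    by (simp add: exp_psi del: times_divide_eq_left)
  also have "\<dots> = 1" by (simp add: exp_minus)
  finally have "exp (psi s J) / exp q \<le> 1" by (simp add: exp_diff exp_psi)
  then show ?thesis by (simp add: q_def)
qed

lemma blocksum_partial_measurable: "I \<subseteq> J \<Longrightarrow> blocksum I \<in> borel_measurable (partial_sigma P Y J)"
  unfolding blocksum_def[abs_def]
  by (intro borel_measurable_sum measurable_partial_sigma) auto

lemma level_set_gen_sigma: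
  fixes f :: "real \<Rightarrow> real"
  assumes "I \<subseteq> J" "f \<in> borel_measurable borel"
  shows "{x \<in> space P. t < f (blocksum I x)} \<in> gen_sigma P Y J"
proof -
  have "(\<lambda>x. f (blocksum I x)) \<in> borel_measurable (partial_sigma P Y J)"
    by (rule measurable_compose[OF blocksum_partial_measurable[OF assms(1)] assms(2)])
  then have "{x \<in> space (partial_sigma P Y J). t < f (blocksum I x)} \<in> sets (partial_sigma P Y J)"
    unfolding borel_measurable_iff_greater by blast
  then show ?thesis by (simp add: sets_partial_sigma)
qed

text \<open>Division by the sup bounds reduces to functions with values in [0,1]. For exponentials
  the factor \<open>a * b\<close> is exponential in the block lengths; it is the reason for gaps
  proportional to these lengths.\<close>

lemma separated_covariance:
  assumes sep: "L \<subseteq> {..k}" "R \<subseteq> {k + g..}" "1 \<le> g"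
    and [measurable]: "f \<in> borel_measurable borel" "h \<in> borel_measurable borel"
    and f: "\<And>x. 0 \<le> f (blocksum L x)" "\<And>x. f (blocksum L x) \<le> a"
    and h: "\<And>x. 0 \<le> h (blocksum R x)" "\<And>x. h (blocksum R x) \<le> b"
    and ab: "0 < a" "0 < b"
  shows "\<bar>expectation (\<lambda>x. f (blocksum L x) * h (blocksum R x))
     - expectation (\<lambda>x. f (blocksum L x)) * expectation (\<lambda>x. h (blocksum R x))\<bar> \<le> a * b * exp (- 2 * c * g)"
proof -
  have "\<bar>expectation (\<lambda>x. (f (blocksum L x) / a) * (h (blocksum R x) / b))
     - expectation (\<lambda>x. f (blocksum L x) / a) * expectation (\<lambda>x. h (blocksum R x) / b)\<bar> \<le> exp (- 2 * c * g)"
  proof (rule covariance_le_of_level_sets)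
    fix s t
    have "{x \<in> space P. s < f (blocksum L x) / a} \<in> gen_sigma P Y {..k}"
      by (rule level_set_gen_sigma[where f="\<lambda>y. f y / a"]) (use sep in auto)
    moreover have "{x \<in> space P. t < h (blocksum R x) / b} \<in> gen_sigma P Y {k + g..}"
      by (rule level_set_gen_sigma[where f="\<lambda>y. h y / b"]) (use sep in auto)
    ultimately show "\<bar>prob ({x \<in> space P. s < f (blocksum L x) / a} \<inter> {x \<in> space P. t < h (blocksum R x) / b})
        - prob {x \<in> space P. s < f (blocksum L x) / a} * prob {x \<in> space P. t < h (blocksum R x) / b}\<bar>
        \<le> exp (- 2 * c * g)"
      using sep by (intro mixing) auto
  qed (use f h ab in auto)
  moreover have "expectation (\<lambda>x. (f (blocksum L x) / a) * (h (blocksum R x) / b))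
     - expectation (\<lambda>x. f (blocksum L x) / a) * expectation (\<lambda>x. h (blocksum R x) / b)
     = (expectation (\<lambda>x. f (blocksum L x) * h (blocksum R x))
     - expectation (\<lambda>x. f (blocksum L x)) * expectation (\<lambda>x. h (blocksum R x))) / (a * b)"
    by (simp add: diff_divide_distrib)
  ultimately show ?thesis using ab by (simp add: abs_divide abs_mult divide_le_eq mult_ac)
qed

end

section \<open>Splitting finite index sets, and elementary inequalities\<close>

lemma split_initial_segment:
  assumes "finite J" "n \<le> card J"
  obtains L R :: "nat set" where "J = L \<union> R" "L \<inter> R = {}" "card L = n" "\<And>x y. x \<in> L \<Longrightarrow> y \<in> R \<Longrightarrow> x < y"
proof -
  have "\<exists>L R. J = L \<union> R \<and> L \<inter> R = {} \<and> card L = n \<and> (\<forall>x\<in>L. \<forall>y\<in>R. x < y)"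
    using assms(2)
  proof (induction n)
    case 0
    show ?case by (rule exI[of _ "{}"], rule exI[of _ J]) auto
  next
    case (Suc n)
    then obtain L R where LR: "J = L \<union> R" "L \<inter> R = {}" "card L = n" "\<forall>x\<in>L. \<forall>y\<in>R. x < y"
      by auto
    have fin: "finite L" "finite R" using assms(1) LR(1) by auto
    have "R \<noteq> {}" using LR Suc.prems by auto
    then have m: "Min R \<in> R" "\<And>y. y \<in> R \<Longrightarrow> Min R \<le> y" using fin by auto
    show ?case
    proof (intro exI conjI)
      show "J = insert (Min R) L \<union> (R - {Min R})" using LR m by auto
      show "insert (Min R) L \<inter> (R - {Min R}) = {}" using LR by auto
      show "card (insert (Min R) L) = Suc n" using LR m fin by (subst card_insert_disjoint) auto
      show "\<forall>x\<in>insert (Min R) L. \<forall>y\<in>R - {Min R}. x < y"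
        using LR(4) m by (auto simp: less_le)
    qed
  qed
  then show ?thesis using that by blast
qed

text \<open>The gap consists of the \<open>g\<close> elements of \<open>J\<close> that follow
  \<open>L\<close>. If \<open>R\<close> is nonempty they all lie strictly between \<open>L\<close>
  and \<open>R\<close>, so their number bounds the distance from below. Hence \<open>J\<close> may
  have holes, as do the removed sets on which the construction is repeated.\<close>

lemma split_with_gap:
  fixes J :: "nat set"
  assumes J: "finite J" "card J \<le> 2 * m"
  obtains L D R where "J = L \<union> D \<union> R" "L \<inter> D = {}" "L \<inter> R = {}" "D \<inter> R = {}"
    "card L \<le> m" "card R \<le> m" "card D \<le> g" "\<forall>x\<in>L. \<forall>y\<in>R. x + g \<le> y"
proof -
  obtain L R' where 1: "J = L \<union> R'" "L \<inter> R' = {}" "card L = min m (card J)" "\<And>x y. x \<in> L \<Longrightarrow> y \<in> R' \<Longrightarrow> x < y"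
    using split_initial_segment[OF J(1), of "min m (card J)"] by auto
  have fin: "finite L" "finite R'" using J 1 by auto
  have "card J = card L + card R'" unfolding 1(1) by (rule card_Un_disjoint) (use fin 1 in auto)
  then have R'm: "card R' \<le> m" using 1(3) J(2) by linarith
  obtain D R where 2: "R' = D \<union> R" "D \<inter> R = {}" "card D = min g (card R')" "\<And>x y. x \<in> D \<Longrightarrow> y \<in> R \<Longrightarrow> x < y"
    using split_initial_segment[OF fin(2), of "min g (card R')"] by auto
  have fin2: "finite D" "finite R" using fin 2 by auto
  show ?thesis
  proof (rule that[of L D R])
    show "card R \<le> m" using R'm card_mono[OF fin(2), of R] 2 by auto
    have "x + g \<le> y" if "x \<in> L" "y \<in> R" for x y
    proof -
      have "card R' = card D + card R" unfolding 2(1) by (rule card_Un_disjoint) (use fin2 2 in auto)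
      moreover have "card R > 0" using that fin2 by (auto simp: card_gt_0_iff)
      ultimately have "card D = g" using 2(3) by linarith
      moreover have "D \<subseteq> {x<..<y}" using 1 2 that by auto
      then have "card D \<le> y - x - 1" using card_mono[of "{x<..<y}" D] by simp
      moreover have "x < y" using 1 2 that by auto
      ultimately show ?thesis by linarith
    qed
    then show "\<forall>x\<in>L. \<forall>y\<in>R. x + g \<le> y" by blast
  qed (use 1 2 in auto)
qed

lemma abs_ln_le_of_near_1:
  fixes y e :: real
  assumes "\<bar>y - 1\<bar> \<le> e" "e \<le> 1 / 2"
  shows "\<bar>ln y\<bar> \<le> 2 * e"
proof -
  have y: "0 < y" using assms by (auto simp: abs_le_iff)
  have up: "ln y \<le> y - 1" using ln_le_minus_one[OF y] .
  have "ln (1 / y) \<le> 1 / y - 1" by (rule ln_le_minus_one) (use y in auto)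
  then have lo: "- ln y \<le> (1 - y) / y" using y by (simp add: ln_div diff_divide_distrib)
  have "(1 - y) / y \<le> 2 * e"
  proof -
    have "1 - y \<le> e" "1/2 \<le> y" "0 \<le> e" using assms by (auto simp: abs_le_iff)
    then have "e * 1 \<le> e * (2 * y)" by (intro mult_left_mono) auto
    with \<open>1 - y \<le> e\<close> show ?thesis using y by (simp add: divide_le_eq)
  qed
  then show ?thesis using up lo assms by (auto simp: abs_le_iff)
qed

lemma exp_third_order:
  fixes x :: real
  assumes "\<bar>x\<bar> \<le> 1"
  shows "\<bar>exp x - (1 + x + x\<^sup>2 / 2)\<bar> \<le> \<bar>x\<bar> ^ 3 / 2"
proof -
  obtain t where t: "\<bar>t\<bar> \<le> \<bar>x\<bar>" "exp x = (\<Sum>m<3. x ^ m / fact m) + exp t / fact 3 * x ^ 3"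
    using Maclaurin_exp_le[of x 3] by blast
  have "exp t \<le> exp 1" using t assms by simp
  also have "\<dots> \<le> 3" by (rule exp_le)
  finally have e: "exp t \<le> 3" .
  have "exp x - (1 + x + x\<^sup>2 / 2) = exp t / 6 * x ^ 3"
    unfolding t(2) by (simp add: eval_nat_numeral fact_reduce)
  also have "\<bar>\<dots>\<bar> = exp t / 6 * \<bar>x\<bar> ^ 3" by (simp add: abs_mult power_abs)
  also have "\<dots> \<le> 1 / 2 * \<bar>x\<bar> ^ 3" by (intro mult_right_mono) (use e in auto)
  finally show ?thesis by simp
qed

section \<open>Decoupling of exponentials, summable covariances, and the Laplace transform of a
  short block\<close>

context bounded_mixing begin

text \<open>The gap \<open>g\<close> exceeds by \<open>g0\<close> what is needed to cancel the sup
  norms of the exponentials, so the covariance is at most \<open>exp (- 2 * c * g0)\<close>. As both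
  expectations are at least 1, this is also a relative error, and it passes to the
  logarithm.\<close>

lemma psi_separated:
  assumes fin: "finite L" "finite R" and sep: "\<And>x y. x \<in> L \<Longrightarrow> y \<in> R \<Longrightarrow> x + g \<le> y" and g: "1 \<le> g"
    and eta: "\<bar>s\<bar> * M * (card L + card R) \<le> 2 * c * (real g - g0)" "exp (- 2 * c * g0) \<le> 1 / 2"
  shows "\<bar>psi s (L \<union> R) - psi s L - psi s R\<bar> \<le> 2 * exp (- 2 * c * g0)"
proof (cases "L = {} \<or> R = {}")
  case True
  then show ?thesis by auto
next
  case False
  define k where "k = Max L"
  have "k \<in> L" unfolding k_def using fin False by simp
  then have "R \<subseteq> {k + g..}" using sep by auto
  moreover have "L \<subseteq> {..k}" using fin by (auto simp: k_def)
  ultimately have k: "L \<subseteq> {..k}" "R \<subseteq> {k + g..}" by auto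
  have disj: "L \<inter> R = {}" using sep g by fastforce
  let ?a = "exp (\<bar>s\<bar> * M * card L)" and ?b = "exp (\<bar>s\<bar> * M * card R)"
  let ?EL = "expectation (\<lambda>x. exp (s * blocksum L x))" and ?ER = "expectation (\<lambda>x. exp (s * blocksum R x))"
  let ?E = "expectation (\<lambda>x. exp (s * blocksum (L \<union> R) x))"
  have "\<bar>expectation (\<lambda>x. exp (s * blocksum L x) * exp (s * blocksum R x)) - ?EL * ?ER\<bar> \<le> ?a * ?b * exp (- 2 * c * g)"
    by (rule separated_covariance[OF k g, where f="\<lambda>y. exp (s * y)" and h="\<lambda>y. exp (s * y)"])
      (use exp_blocksum_le in auto)
  also have "(\<lambda>x. exp (s * blocksum L x) * exp (s * blocksum R x)) = (\<lambda>x. exp (s * blocksum (L \<union> R) x))"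
    using fin disj by (simp add: blocksum_Un distrib_left exp_add)
  also have "?a * ?b * exp (- 2 * c * g) = exp (\<bar>s\<bar> * M * (card L + card R) - 2 * c * g)"
    by (simp add: exp_add[symmetric] algebra_simps)
  also have "\<dots> \<le> exp (- 2 * c * g0)"
    using eta(1) by (simp add: algebra_simps)
  finally have d: "\<bar>?E - ?EL * ?ER\<bar> \<le> exp (- 2 * c * g0)" .
  have ge: "1 \<le> ?EL * ?ER" using mult_mono[OF expectation_exp_ge_1[of s L] expectation_exp_ge_1[of s R]] by simp
  have "\<bar>?E / (?EL * ?ER) - 1\<bar> = \<bar>?E - ?EL * ?ER\<bar> / (?EL * ?ER)"
  proof -
    have "\<bar>y / q - 1\<bar> = \<bar>y - q\<bar> / q" if "1 \<le> q" for y q :: real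
    proof -
      have "y / q - 1 = (y - q) / q" using that by (simp add: diff_divide_distrib)
      then show ?thesis using that by (simp add: abs_divide)
    qed
    then show ?thesis using ge .
  qed
  also have "\<dots> \<le> exp (- 2 * c * g0) / 1"
    using d ge by (intro frac_le) auto
  finally have "\<bar>ln (?E / (?EL * ?ER))\<bar> \<le> 2 * exp (- 2 * c * g0)"
    by (intro abs_ln_le_of_near_1) (use eta(2) in auto)
  moreover have "ln (?E / (?EL * ?ER)) = psi s (L \<union> R) - psi s L - psi s R"
    unfolding psi_def using expectation_exp_ge_1[of s L] expectation_exp_ge_1[of s R] expectation_exp_ge_1[of s "L \<union> R"]
    by (subst ln_div) (auto simp: ln_mult)
  ultimately show ?thesis by simp
qed

text \<open>Adding the sup bounds makes both sums nonnegative without changing their covariance, and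
  at most doubles the sup norms; hence the factor 4.\<close>

lemma cov_separated:
  assumes sep: "L \<subseteq> {..k}" "R \<subseteq> {k + g..}" "1 \<le> g"
  shows "\<bar>expectation (\<lambda>x. blocksum L x * blocksum R x)\<bar> \<le> 4 * M\<^sup>2 * card L * card R * exp (- 2 * c * g)"
proof (cases "card L = 0 \<or> card R = 0")
  case True
  then have "blocksum L = (\<lambda>x. 0) \<or> blocksum R = (\<lambda>x. 0)"
    using blocksum_bound[of L] blocksum_bound[of R] by (auto simp: fun_eq_iff)
  then show ?thesis by (auto simp: True)
next
  case False
  let ?a = "M * card L" and ?b = "M * card R"
  have "\<bar>expectation (\<lambda>x. (blocksum L x + ?a) * (blocksum R x + ?b))
     - expectation (\<lambda>x. blocksum L x + ?a) * expectation (\<lambda>x. blocksum R x + ?b)\<bar>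
     \<le> (2 * ?a) * (2 * ?b) * exp (- 2 * c * g)"
  proof (rule separated_covariance[OF sep, where f="\<lambda>y. y + ?a" and h="\<lambda>y. y + ?b"])
    show "0 \<le> blocksum L x + ?a" "blocksum L x + ?a \<le> 2 * ?a"
      "0 \<le> blocksum R x + ?b" "blocksum R x + ?b \<le> 2 * ?b" for x
      using blocksum_bound[of L x] blocksum_bound[of R x] by (auto simp: abs_le_iff)
    show "0 < 2 * ?a" "0 < 2 * ?b" using False M_pos by auto
  qed auto
  also have "(\<lambda>x. (blocksum L x + ?a) * (blocksum R x + ?b)) =
     (\<lambda>x. blocksum L x * blocksum R x + ?a * blocksum R x + ?b * blocksum L x + ?a * ?b)"
    by (auto simp: algebra_simps)
  finally show ?thesis
    by (simp add: expectation_blocksum prob_space power2_eq_square algebra_simps)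
qed

lemma cov_Y: "\<bar>expectation (\<lambda>x. Y i x * Y j x)\<bar> \<le> 4 * M\<^sup>2 * exp (- 2 * c) ^ nat \<bar>int i - int j\<bar>"
proof -
  have *: "\<bar>expectation (\<lambda>x. Y i x * Y j x)\<bar> \<le> 4 * M\<^sup>2 * exp (- 2 * c) ^ (j - i)" if "i < j" for i j
    using cov_separated[of "{i}" i "{j}" "j - i"] that
    by (simp add: blocksum_def exp_of_nat_mult[symmetric] mult_ac)
  consider "i < j" | "i = j" | "j < i" by linarith
  then show ?thesis
  proof cases
    case 1
    then have "nat \<bar>int i - int j\<bar> = j - i" by auto
    then show ?thesis using *[OF 1] by (simp only:)
  next
    case 2
    have "expectation (\<lambda>x. Y i x * Y i x) \<le> expectation (\<lambda>x. M * M)"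
    proof (rule integral_mono)
      show "Y i x * Y i x \<le> M * M" for x
        using mult_mono[OF Y_bound[of i x] Y_bound[of i x]] M_pos by simp
    qed simp_all
    then have "\<bar>expectation (\<lambda>x. Y i x * Y i x)\<bar> \<le> M\<^sup>2" by (simp add: prob_space power2_eq_square)
    also have "M\<^sup>2 \<le> 4 * M\<^sup>2" by simp
    finally show ?thesis using 2 by simp
  next
    case 3
    then have "nat \<bar>int i - int j\<bar> = i - j" by auto
    moreover have "(\<lambda>x. Y i x * Y j x) = (\<lambda>x. Y j x * Y i x)" by (simp add: fun_eq_iff)
    ultimately show ?thesis using *[OF 3] by (simp only:)
  qed
qed

text \<open>\<open>4 * M\<^sup>2\<close> times two geometric series of ratio
  \<open>exp (- 2 * c)\<close>, one for each side of a fixed index: a bound for the sum of all its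
  absolute covariances.\<close>

definition Cv :: real where "Cv = 8 * M\<^sup>2 / (1 - exp (- 2 * c))"

lemma exp_c: "0 < exp (- 2 * c)" "exp (- 2 * c) < 1"
  using c_pos by auto

lemma Cv_pos: "0 < Cv"
  unfolding Cv_def using M_pos exp_c by (intro divide_pos_pos) auto

lemma cov_sum_single:
  assumes "finite A"
  shows "(\<Sum>i\<in>A. \<bar>expectation (\<lambda>x. Y i x * Y j x)\<bar>) \<le> Cv"
proof -
  let ?q = "exp (- 2 * c)"
  have geom: "(\<Sum>i\<in>B. ?q ^ i) \<le> 1 / (1 - ?q)" if "finite B" for B
    using sum_le_suminf[of "\<lambda>i. ?q ^ i" B] that exp_c suminf_geometric[of ?q] summable_geometric[of ?q] by simp
  have 1: "(\<Sum>i\<in>A \<inter> {..<j}. ?q ^ (j - i)) \<le> 1 / (1 - ?q)"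
  proof -
    have "(\<Sum>i\<in>A \<inter> {..<j}. ?q ^ (j - i)) = (\<Sum>i\<in>(\<lambda>i. j - i) ` (A \<inter> {..<j}). ?q ^ i)"
      by (subst sum.reindex) (auto intro!: inj_onI)
    then show ?thesis using geom assms by simp
  qed
  have 2: "(\<Sum>i\<in>A - {..<j}. ?q ^ (i - j)) \<le> 1 / (1 - ?q)"
  proof -
    have "(\<Sum>i\<in>A - {..<j}. ?q ^ (i - j)) = (\<Sum>i\<in>(\<lambda>i. i - j) ` (A - {..<j}). ?q ^ i)"
      by (subst sum.reindex) (auto intro!: inj_onI)
    then show ?thesis using geom assms by simp
  qed
  have "(\<Sum>i\<in>A. \<bar>expectation (\<lambda>x. Y i x * Y j x)\<bar>) \<le> (\<Sum>i\<in>A. 4 * M\<^sup>2 * ?q ^ nat \<bar>int i - int j\<bar>)"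
    by (intro sum_mono cov_Y)
  also have "\<dots> = 4 * M\<^sup>2 * (\<Sum>i\<in>A. ?q ^ nat \<bar>int i - int j\<bar>)" by (simp add: sum_distrib_left)
  also have "(\<Sum>i\<in>A. ?q ^ nat \<bar>int i - int j\<bar>) =
      (\<Sum>i\<in>A \<inter> {..<j}. ?q ^ nat \<bar>int i - int j\<bar>) + (\<Sum>i\<in>A - {..<j}. ?q ^ nat \<bar>int i - int j\<bar>)"
    using assms by (rule sum.Int_Diff)
  also have "(\<Sum>i\<in>A \<inter> {..<j}. ?q ^ nat \<bar>int i - int j\<bar>) = (\<Sum>i\<in>A \<inter> {..<j}. ?q ^ (j - i))"
    by (intro sum.cong arg_cong[where f="\<lambda>n. ?q ^ n"]) auto
  also have "(\<Sum>i\<in>A - {..<j}. ?q ^ nat \<bar>int i - int j\<bar>) = (\<Sum>i\<in>A - {..<j}. ?q ^ (i - j))"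
    by (intro sum.cong arg_cong[where f="\<lambda>n. ?q ^ n"]) auto
  also have "4 * M\<^sup>2 * ((\<Sum>i\<in>A \<inter> {..<j}. ?q ^ (j - i)) + (\<Sum>i\<in>A - {..<j}. ?q ^ (i - j)))
      \<le> 4 * M\<^sup>2 * (1 / (1 - ?q) + 1 / (1 - ?q))"
    by (intro mult_left_mono add_mono 1 2) auto
  also have "\<dots> = Cv" unfolding Cv_def by (simp add: field_simps)
  finally show ?thesis .
qed

text \<open>Summability of the covariances makes the bound depend on \<open>D\<close> alone, however
  large \<open>A\<close> is. Deleting a few indices therefore changes the variance by little, even
  if they are scattered all over the set.\<close>

lemma cov_sum:
  assumes "finite A" "finite D"
  shows "\<bar>expectation (\<lambda>x. blocksum A x * blocksum D x)\<bar> \<le> Cv * card D"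
proof -
  have "expectation (\<lambda>x. blocksum A x * blocksum D x) = (\<Sum>j\<in>D. \<Sum>i\<in>A. expectation (\<lambda>x. Y i x * Y j x))"
    unfolding blocksum_def by (simp add: sum_product, rule sum.swap)
  also have "\<bar>\<dots>\<bar> \<le> (\<Sum>j\<in>D. \<Sum>i\<in>A. \<bar>expectation (\<lambda>x. Y i x * Y j x)\<bar>)"
    by (rule order.trans[OF sum_abs], rule sum_mono, rule sum_abs)
  also have "\<dots> \<le> (\<Sum>j\<in>D. Cv)" by (intro sum_mono cov_sum_single assms)
  finally show ?thesis by (simp add: mult.commute)
qed

lemma V_le: "finite J \<Longrightarrow> V J \<le> Cv * card J"
  using cov_sum[of J J] unfolding V_def by (simp add: power2_eq_square abs_le_iff)

lemma V_Un:
  assumes "finite A" "finite B" "A \<inter> B = {}"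
  shows "V (A \<union> B) = V A + V B + 2 * expectation (\<lambda>x. blocksum A x * blocksum B x)"
proof -
  have "(blocksum (A \<union> B) x)\<^sup>2 = (blocksum A x)\<^sup>2 + (blocksum B x)\<^sup>2 + 2 * (blocksum A x * blocksum B x)" for x
    using assms by (simp add: blocksum_Un power2_sum)
  then show ?thesis unfolding V_def by simp
qed

lemma V_Un_diff:
  assumes "finite A" "finite B" "A \<inter> B = {}"
  shows "\<bar>V (A \<union> B) - V A\<bar> \<le> 3 * Cv * card B"
  using V_Un[OF assms] V_le[OF assms(2)] V_nonneg[of B] cov_sum[OF assms(1,2)] by (simp add: abs_le_iff)

text \<open>Of the three powers of the block sum in the Taylor remainder only one is bounded by its
  sup norm; the other two form the variance, which is linear in \<open>card J\<close>. So the error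
  is quadratic in the length of a block, and summed over blocks of length at most \<open>p\<close>
  it is \<open>p\<close> times the total length.\<close>

lemma psi_small_block:
  assumes J: "finite J" and s: "\<bar>s\<bar> * M * card J \<le> 1"
  shows "\<bar>psi s J - s\<^sup>2 / 2 * V J\<bar> \<le> 2 * M * Cv * \<bar>s\<bar> ^ 3 * (real (card J))\<^sup>2"
proof -
  define u where "u = expectation (\<lambda>x. exp (s * blocksum J x)) - 1"
  define m where "m = real (card J)"
  have sb: "\<bar>s * blocksum J x\<bar> \<le> 1" for x using scaled_blocksum_bound[of s J x] s by linarith
  have Sb: "\<bar>blocksum J x\<bar> \<le> M * m" for x using blocksum_bound unfolding m_def .
  have V: "V J \<le> Cv * m" using V_le[OF J] unfolding m_def .
  have m0: "0 \<le> m" unfolding m_def by simp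
  have s1: "\<bar>s\<bar> * M * m \<le> 1" using s unfolding m_def .
  have quad: "exp (s * blocksum J x) \<le> 1 + s * blocksum J x + s\<^sup>2 * (blocksum J x)\<^sup>2" for x
  proof -
    have "\<bar>s * blocksum J x\<bar> ^ 3 \<le> \<bar>s * blocksum J x\<bar> ^ 2" by (rule power_decreasing) (use sb in auto)
    then have "\<bar>exp (s * blocksum J x) - (1 + s * blocksum J x + (s * blocksum J x)\<^sup>2 / 2)\<bar> \<le> (s * blocksum J x)\<^sup>2 / 2"
      using exp_third_order[OF sb, of x] by simp
    then show ?thesis by (simp only: abs_le_iff power_mult_distrib) linarith
  qed
  have third: "\<bar>exp (s * blocksum J x) - (1 + s * blocksum J x + (s\<^sup>2 / 2) * (blocksum J x)\<^sup>2)\<bar>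
      \<le> (\<bar>s\<bar> ^ 3 * M * m / 2) * (blocksum J x)\<^sup>2" for x
  proof -
    have "\<bar>exp (s * blocksum J x) - (1 + s * blocksum J x + (s\<^sup>2 / 2) * (blocksum J x)\<^sup>2)\<bar> \<le> \<bar>s * blocksum J x\<bar> ^ 3 / 2"
      using exp_third_order[OF sb, of x] by (simp add: power_mult_distrib)
    also have "\<bar>s * blocksum J x\<bar> ^ 3 = \<bar>s\<bar> ^ 3 * (\<bar>blocksum J x\<bar> * (blocksum J x)\<^sup>2)"
    proof -
      have "(t * y) ^ 3 = t ^ 3 * (y * y\<^sup>2)" for t y :: real by algebra
      from this[of "\<bar>s\<bar>" "\<bar>blocksum J x\<bar>"] show ?thesis by (simp add: abs_mult)
    qed
    also have "\<dots> \<le> \<bar>s\<bar> ^ 3 * (M * m * (blocksum J x)\<^sup>2)"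
      by (intro mult_left_mono mult_right_mono Sb) auto
    finally show ?thesis by (simp add: mult_ac)
  qed
  have "u \<le> expectation (\<lambda>x. 1 + s * blocksum J x + s\<^sup>2 * (blocksum J x)\<^sup>2) - 1"
    unfolding u_def by (intro diff_right_mono integral_mono quad) auto
  then have u_le: "u \<le> s\<^sup>2 * V J" by (simp add: V_def expectation_blocksum prob_space)
  have "\<bar>expectation (\<lambda>x. exp (s * blocksum J x) - (1 + s * blocksum J x + (s\<^sup>2 / 2) * (blocksum J x)\<^sup>2))\<bar>
     \<le> expectation (\<lambda>x. (\<bar>s\<bar> ^ 3 * M * m / 2) * (blocksum J x)\<^sup>2)"
    by (rule order.trans[OF integral_abs_bound], rule integral_mono) (use third in auto)
  then have u_approx: "\<bar>u - s\<^sup>2 / 2 * V J\<bar> \<le> \<bar>s\<bar> ^ 3 * M * m / 2 * V J"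
    by (simp add: V_def expectation_blocksum prob_space u_def diff_diff_eq)
  have VM: "V J \<le> (M * m)\<^sup>2"
  proof -
    have "V J \<le> expectation (\<lambda>x. (M * m)\<^sup>2)"
      unfolding V_def
    proof (rule integral_mono)
      show "(blocksum J x)\<^sup>2 \<le> (M * m)\<^sup>2" for x
        using Sb[of x] by (metis abs_le_square_iff abs_of_nonneg order.trans abs_ge_zero)
    qed simp_all
    then show ?thesis by (simp add: prob_space)
  qed
  have u0: "0 \<le> u" unfolding u_def using expectation_exp_ge_1[of s J] by simp
  \<comment> \<open>The second-order term of the logarithm must also be of third order in
    \<open>s\<close>: one factor \<open>V J\<close> is estimated crudely by
    \<open>(M * m)\<^sup>2\<close> and one power of \<open>|s| * M * m <= 1\<close> is used up,
    while the other factor is kept for the linear bound \<open>Cv * m\<close>.\<close>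
  have "u\<^sup>2 \<le> (s\<^sup>2 * V J) * (s\<^sup>2 * V J)" unfolding power2_eq_square[of u] by (intro mult_mono u_le) (use u0 V_nonneg in auto)
  also have "\<dots> = (\<bar>s\<bar> ^ 3 * V J) * (\<bar>s\<bar> * V J)"
  proof -
    have "(t\<^sup>2 * v) * (t\<^sup>2 * v) = (t ^ 3 * v) * (t * v)" for t v :: real by algebra
    from this[of "\<bar>s\<bar>" "V J"] show ?thesis by simp
  qed
  also have "\<bar>s\<bar> * V J \<le> M * m"
  proof -
    have "\<bar>s\<bar> * V J \<le> \<bar>s\<bar> * (M * m)\<^sup>2" by (intro mult_left_mono VM) auto
    also have "\<dots> = (\<bar>s\<bar> * M * m) * (M * m)" by (simp add: power2_eq_square)
    also have "\<dots> \<le> 1 * (M * m)" by (intro mult_right_mono s1) (use M_pos m0 in auto)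
    finally show ?thesis by simp
  qed
  finally have u2: "u\<^sup>2 \<le> \<bar>s\<bar> ^ 3 * V J * (M * m)" by (simp add: mult_left_mono V_nonneg)
  have psi: "psi s J = ln (1 + u)" unfolding psi_def u_def by simp
  have "s\<^sup>2 * V J \<le> s\<^sup>2 * (M * m)\<^sup>2" by (intro mult_left_mono VM) auto
  also have "\<dots> = (\<bar>s\<bar> * M * m)\<^sup>2" by (simp add: power_mult_distrib)
  also have "\<dots> \<le> 1" by (rule power_le_one) (use s1 M_pos m0 in auto)
  finally have u1: "u \<le> 1" using u_le by linarith
  have "ln (1 + u) \<le> u" using ln_add_one_self_le_self[OF u0] .
  moreover have "u - u\<^sup>2 \<le> ln (1 + u)"
    by (rule ln_one_plus_pos_lower_bound[OF u0 u1])
  ultimately have "\<bar>psi s J - u\<bar> \<le> u\<^sup>2" unfolding psi by (simp add: abs_le_iff)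
  then have "\<bar>psi s J - s\<^sup>2 / 2 * V J\<bar> \<le> u\<^sup>2 + \<bar>s\<bar> ^ 3 * M * m / 2 * V J"
    using u_approx by linarith
  also have "\<dots> \<le> 2 * \<bar>s\<bar> ^ 3 * M * m * V J"
  proof -
    have "0 \<le> \<bar>s\<bar> ^ 3 * M * m * V J" using M_pos m0 V_nonneg by simp
    then show ?thesis using u2 by (simp add: mult_ac)
  qed
  also have "\<dots> \<le> 2 * \<bar>s\<bar> ^ 3 * M * m * (Cv * m)" by (intro mult_left_mono V) (use M_pos m0 in auto)
  finally show ?thesis unfolding m_def by (simp add: power2_eq_square mult_ac)
qed


lemma cov_gap:
  assumes fin: "finite L" "finite R" and sep: "\<And>x y. x \<in> L \<Longrightarrow> y \<in> R \<Longrightarrow> x + g \<le> y" and g: "1 \<le> g0" "g0 \<le> g"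
  shows "\<bar>expectation (\<lambda>x. blocksum L x * blocksum R x)\<bar> \<le> 4 * M\<^sup>2 * card L * card R * exp (- 2 * c * g0)"
proof (cases "L = {}")
  case False
  then have "Max L \<in> L" using fin by simp
  then have "R \<subseteq> {Max L + g0..}" using sep g by fastforce
  moreover have "L \<subseteq> {..Max L}" using fin by auto
  ultimately show ?thesis using g by (intro cov_separated[of _ "Max L"])
qed simp

section \<open>The Cantor-like set of blocks and its repetition on the removed set\<close>

text \<open>\<open>kap\<close> bounds \<open>|s| * M / (2 * c)\<close> and \<open>p\<close> is the
  final block length. The set \<open>K\<close> is chosen before \<open>s\<close>, because the
  sandwich argument needs the same set at several parameters. Splitting a set of nominal size
  \<open>2 * N\<close> removes at most \<open>g0 + 1 + kap * (2 * N)\<close> elements, so each of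
  the \<open>d\<close> levels loses about the proportion \<open>kap\<close>.\<close>

lemma cantor_blocks:
  fixes kap :: real and p g0 :: nat
  defines "eta \<equiv> exp (- 2 * c * real g0)"
  assumes kap: "0 \<le> kap" and g0: "1 \<le> g0" and eta: "eta \<le> 1 / 2"
  shows "finite J \<Longrightarrow> card J \<le> 2 ^ d * p \<Longrightarrow> \<exists>K\<subseteq>J.
    real (card (J - K)) + (real g0 + 1) \<le> 2 ^ d * (real d * kap * real p + real g0 + 1) \<and>
    (\<forall>s. \<bar>s\<bar> * M \<le> 2 * c * kap \<longrightarrow> \<bar>s\<bar> * M * real p \<le> 1 \<longrightarrow>
      \<bar>psi s K - s\<^sup>2 / 2 * V K\<bar> \<le> (2 ^ d - 1) * (2 * eta) + 2 * M * Cv * \<bar>s\<bar> ^ 3 * real p * real (card K)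
        + 2 * M\<^sup>2 * eta * s\<^sup>2 * (real (card K))\<^sup>2)"
proof (induction d arbitrary: J)
  case 0
  show ?case
  proof (intro exI[of _ J] conjI allI impI)
    fix s assume s: "\<bar>s\<bar> * M \<le> 2 * c * kap" "\<bar>s\<bar> * M * real p \<le> 1"
    have cp: "real (card J) \<le> real p" using 0 by simp
    have "\<bar>s\<bar> * M * card J \<le> \<bar>s\<bar> * M * p" by (intro mult_left_mono cp) (use M_pos in auto)
    then have "\<bar>psi s J - s\<^sup>2 / 2 * V J\<bar> \<le> 2 * M * Cv * \<bar>s\<bar> ^ 3 * (real (card J))\<^sup>2"
      using s by (intro psi_small_block 0) simp
    also have "2 * M * Cv * \<bar>s\<bar> ^ 3 * (real (card J))\<^sup>2 \<le> 2 * M * Cv * \<bar>s\<bar> ^ 3 * (real p * real (card J))"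
      unfolding power2_eq_square by (intro mult_left_mono mult_right_mono cp) (use M_pos Cv_pos in auto)
    also have "\<dots> = 2 * M * Cv * \<bar>s\<bar> ^ 3 * real p * real (card J)" by simp
    finally have "\<bar>psi s J - s\<^sup>2 / 2 * V J\<bar> \<le> 2 * M * Cv * \<bar>s\<bar> ^ 3 * real p * real (card J)" .
    moreover have "0 \<le> 2 * M\<^sup>2 * eta * s\<^sup>2 * (real (card J))\<^sup>2" unfolding eta_def by simp
    ultimately show "\<bar>psi s J - s\<^sup>2 / 2 * V J\<bar> \<le> (2 ^ 0 - 1) * (2 * eta) + 2 * M * Cv * \<bar>s\<bar> ^ 3 * real p * real (card J)
        + 2 * M\<^sup>2 * eta * s\<^sup>2 * (real (card J))\<^sup>2"
      by (simp only: power_0 diff_self mult_zero_left add_0_left)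
  qed (use 0 in auto)
next
  case (Suc d)
  define N where "N = 2 ^ d * p"
  \<comment> \<open>The part \<open>kap * (2 * N)\<close> of the gap cancels the sup norms of the
    exponentials over both halves; \<open>g0\<close> is the surplus that leaves the error
    \<open>eta\<close>.\<close>
  define G where "G = g0 + nat \<lceil>kap * real (2 * N)\<rceil>"
  have NN: "real N = 2 ^ d * real p" unfolding N_def by simp
  have G: "kap * real (2 * N) \<le> real G - real g0" "real G \<le> real g0 + kap * real (2 * N) + 1" "g0 \<le> G"
  proof -
    have "0 \<le> kap * real (2 * N)" using kap by simp
    then show "kap * real (2 * N) \<le> real G - real g0" "real G \<le> real g0 + kap * real (2 * N) + 1" "g0 \<le> G"
      unfolding G_def by linarith+
  qed
  have cJ: "card J \<le> 2 * N" using Suc.prems(2) unfolding N_def by simp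
  obtain L D R where LDR: "J = L \<union> D \<union> R" "L \<inter> D = {}" "L \<inter> R = {}" "D \<inter> R = {}"
    "card L \<le> N" "card R \<le> N" "card D \<le> G" "\<forall>x\<in>L. \<forall>y\<in>R. x + G \<le> y"
    by (rule split_with_gap[OF Suc.prems(1) cJ, of G])
  have fin: "finite L" "finite D" "finite R" using Suc.prems(1) LDR(1) by auto
  define W where "W = 2 ^ d * (real d * kap * real p + real g0 + 1)"
  define E where "E s m = (2 ^ d - 1) * (2 * eta) + 2 * M * Cv * \<bar>s\<bar> ^ 3 * real p * real m
        + 2 * M\<^sup>2 * eta * s\<^sup>2 * (real m)\<^sup>2" for s m
  obtain A where A: "A \<subseteq> L" "real (card (L - A)) + (real g0 + 1) \<le> W"
    "\<And>s. \<bar>s\<bar> * M \<le> 2 * c * kap \<Longrightarrow> \<bar>s\<bar> * M * real p \<le> 1 \<Longrightarrow> \<bar>psi s A - s\<^sup>2 / 2 * V A\<bar> \<le> E s (card A)"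
    using Suc.IH[OF fin(1)] LDR(5) unfolding W_def N_def E_def by blast
  obtain B where B: "B \<subseteq> R" "real (card (R - B)) + (real g0 + 1) \<le> W"
    "\<And>s. \<bar>s\<bar> * M \<le> 2 * c * kap \<Longrightarrow> \<bar>s\<bar> * M * real p \<le> 1 \<Longrightarrow> \<bar>psi s B - s\<^sup>2 / 2 * V B\<bar> \<le> E s (card B)"
    using Suc.IH[OF fin(3)] LDR(6) unfolding W_def N_def E_def by blast
  have finAB: "finite A" "finite B" using A B fin finite_subset by auto
  have disj: "A \<inter> B = {}" using A B LDR by auto
  have cAB: "real (card A) \<le> N" "real (card B) \<le> N"
    using card_mono[OF fin(1) A(1)] card_mono[OF fin(3) B(1)] LDR by auto
  have cardAB: "card (A \<union> B) = card A + card B" using finAB disj by (rule card_Un_disjoint)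
  have sepAB: "x + G \<le> y" if "x \<in> A" "y \<in> B" for x y using that A(1) B(1) LDR(8) by blast
  show ?case
  proof (intro exI[of _ "A \<union> B"] conjI allI impI)
    show "A \<union> B \<subseteq> J" using A B LDR by auto
    have "J - (A \<union> B) \<subseteq> (L - A) \<union> D \<union> (R - B)" using LDR by auto
    then have "card (J - (A \<union> B)) \<le> card ((L - A) \<union> D \<union> (R - B))"
      by (intro card_mono) (use fin in auto)
    also have "\<dots> \<le> card (L - A) + card D + card (R - B)"
      using card_Un_le[of "(L - A) \<union> D" "R - B"] card_Un_le[of "L - A" D] by linarith
    finally have "real (card (J - (A \<union> B))) \<le> card (L - A) + real G + card (R - B)" using LDR(7) by linarith
    \<comment> \<open>Two summands \<open>g0 + 1\<close> come with the induction hypotheses and only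
      one is wanted in the conclusion; the other pays for the constant part of \<open>G\<close>.
      This is why \<open>g0 + 1\<close> is carried on the left.\<close>
    then have "real (card (J - (A \<union> B))) + (real g0 + 1) \<le> 2 * W + kap * real (2 * N)"
      using A(2) B(2) G(2) by linarith
    also have "\<dots> = 2 ^ Suc d * (real (Suc d) * kap * real p + real g0 + 1)"
      unfolding W_def by (simp add: NN algebra_simps)
    finally show "real (card (J - (A \<union> B))) + (real g0 + 1) \<le> 2 ^ Suc d * (real (Suc d) * kap * real p + real g0 + 1)" .
  next
    fix s assume s: "\<bar>s\<bar> * M \<le> 2 * c * kap" "\<bar>s\<bar> * M * real p \<le> 1"
    have "\<bar>s\<bar> * M * (card A + card B) \<le> (2 * c * kap) * real (2 * N)"
      by (intro mult_mono s) (use cAB M_pos c_pos kap in auto)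
    also have "\<dots> = 2 * c * (kap * real (2 * N))" by simp
    also have "\<dots> \<le> 2 * c * (real G - real g0)" by (intro mult_left_mono G) (use c_pos in auto)
    finally have split: "\<bar>psi s (A \<union> B) - psi s A - psi s B\<bar> \<le> 2 * eta"
      unfolding eta_def by (intro psi_separated[OF finAB sepAB]) (use g0 G eta in \<open>auto simp: eta_def\<close>)
    define e where "e = expectation (\<lambda>x. blocksum A x * blocksum B x)"
    have e: "\<bar>e\<bar> \<le> 4 * M\<^sup>2 * card A * card B * eta"
      unfolding e_def eta_def by (rule cov_gap[OF finAB sepAB g0 G(3)])
    have "s\<^sup>2 * \<bar>e\<bar> \<le> s\<^sup>2 * (4 * M\<^sup>2 * card A * card B * eta)" by (intro mult_left_mono e) auto
    then have e2: "\<bar>s\<^sup>2 * e\<bar> \<le> s\<^sup>2 * (4 * M\<^sup>2 * card A * card B * eta)" by (simp add: abs_mult)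
    have "psi s (A \<union> B) - s\<^sup>2 / 2 * V (A \<union> B) = (psi s (A \<union> B) - psi s A - psi s B)
        + (psi s A - s\<^sup>2 / 2 * V A) + (psi s B - s\<^sup>2 / 2 * V B) - s\<^sup>2 * e"
      unfolding V_Un[OF finAB disj] e_def by (simp add: algebra_simps)
    then have "\<bar>psi s (A \<union> B) - s\<^sup>2 / 2 * V (A \<union> B)\<bar>
       \<le> 2 * eta + E s (card A) + E s (card B) + s\<^sup>2 * (4 * M\<^sup>2 * card A * card B * eta)"
      using split A(3)[OF s] B(3)[OF s] e2 by linarith
    \<comment> \<open>The splits add up to \<open>2 * (2 ^ d - 1) + 1\<close>, and the covariance of
      the two halves supplies exactly the mixed term of
      \<open>(card A + card B)\<^sup>2\<close>.\<close>
    also have "\<dots> = (2 ^ Suc d - 1) * (2 * eta) + 2 * M * Cv * \<bar>s\<bar> ^ 3 * real p * real (card (A \<union> B))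
        + 2 * M\<^sup>2 * eta * s\<^sup>2 * (real (card (A \<union> B)))\<^sup>2"
      unfolding E_def cardAB by (simp add: algebra_simps power2_eq_square)
    finally show "\<bar>psi s (A \<union> B) - s\<^sup>2 / 2 * V (A \<union> B)\<bar> \<le> (2 ^ Suc d - 1) * (2 * eta)
        + 2 * M * Cv * \<bar>s\<bar> ^ 3 * real p * real (card (A \<union> B)) + 2 * M\<^sup>2 * eta * s\<^sup>2 * (real (card (A \<union> B)))\<^sup>2" .
  qed
qed

definition Gam :: real where "Gam = 3 * Cv + 2 * M\<^sup>2"

lemma Gam_pos: "0 < Gam"
  unfolding Gam_def using Cv_pos by (simp add: add_pos_nonneg)

text \<open>Sizes are measured by the nominal value \<open>2 ^ d * p\<close>. The gaps take at most
  half of it, so for positive \<open>d\<close> the remainder fits the nominal size with exponent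
  \<open>d - 1\<close> and the construction can be repeated. The two error terms depending on
  \<open>card K\<close> are absorbed into the quadratic term by means of
  \<open>|s| * M * p <= 1\<close> and \<open>eta * (2 ^ d * p) <= 1\<close>; \<open>Gam\<close>
  collects the constants.\<close>

lemma cantor_quadratic_bound:
  fixes kap :: real and p g0 :: nat
  defines "eta \<equiv> exp (- 2 * c * real g0)"
  assumes kap: "0 \<le> kap" and g0: "1 \<le> g0" and eta: "eta \<le> 1 / 2"
    and frac: "real d * kap * real p + real g0 + 1 \<le> real p / 2" and etap: "eta * (2 ^ d * real p) \<le> 1"
    and J: "finite J" "card J \<le> 2 ^ d * p"
  obtains K where "K \<subseteq> J" "2 * card (J - K) \<le> 2 ^ d * p" "d = 0 \<Longrightarrow> K = J"
    "\<And>s. \<bar>s\<bar> * M \<le> 2 * c * kap \<Longrightarrow> \<bar>s\<bar> * M * real p \<le> 1 \<Longrightarrow> psi s K \<le> Gam * s\<^sup>2 * (2 ^ d * p) + 2 * eta * 2 ^ d"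
proof -
  obtain K where K: "K \<subseteq> J"
    "real (card (J - K)) + (real g0 + 1) \<le> 2 ^ d * (real d * kap * real p + real g0 + 1)"
    "\<And>s. \<bar>s\<bar> * M \<le> 2 * c * kap \<Longrightarrow> \<bar>s\<bar> * M * real p \<le> 1 \<Longrightarrow>
      \<bar>psi s K - s\<^sup>2 / 2 * V K\<bar> \<le> (2 ^ d - 1) * (2 * eta) + 2 * M * Cv * \<bar>s\<bar> ^ 3 * real p * real (card K)
        + 2 * M\<^sup>2 * eta * s\<^sup>2 * (real (card K))\<^sup>2"
    using cantor_blocks[OF kap g0 _ J] eta unfolding eta_def by blast
  have finK: "finite K" using K J finite_subset by auto
  have "card K \<le> 2 ^ d * p" using card_mono[OF J(1) K(1)] J by linarith
  then have "real (card K) \<le> real (2 ^ d * p)" by (rule of_nat_mono)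
  then have cK: "real (card K) \<le> 2 ^ d * real p" by simp
  have eta0: "0 < eta" unfolding eta_def by simp
  show ?thesis
  proof (rule that[OF K(1)])
    have "2 ^ d * (real d * kap * real p + real g0 + 1) \<le> 2 ^ d * (real p / 2)" by (intro mult_left_mono frac) auto
    also have "\<dots> = real (2 ^ d * p) / 2" by simp
    finally have "real (2 * card (J - K)) \<le> real (2 ^ d * p)" using K(2) by linarith
    then show "2 * card (J - K) \<le> 2 ^ d * p" by linarith
  next
    assume "d = 0"
    then have "card (J - K) = 0" using K(2) by simp
    then show "K = J" using K(1) J by auto
  next
    fix s assume s: "\<bar>s\<bar> * M \<le> 2 * c * kap" "\<bar>s\<bar> * M * real p \<le> 1"
    let ?m = "real (card K)"
    have 1: "s\<^sup>2 / 2 * V K \<le> s\<^sup>2 / 2 * (Cv * ?m)" by (intro mult_left_mono V_le finK) auto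
    have "2 * M * Cv * \<bar>s\<bar> ^ 3 * real p * ?m = (2 * Cv * \<bar>s\<bar>\<^sup>2 * ?m) * (\<bar>s\<bar> * M * real p)"
      by (simp add: power3_eq_cube power2_eq_square)
    also have "\<dots> \<le> (2 * Cv * \<bar>s\<bar>\<^sup>2 * ?m) * 1" by (intro mult_left_mono s) (use Cv_pos in auto)
    finally have 2: "2 * M * Cv * \<bar>s\<bar> ^ 3 * real p * ?m \<le> 2 * Cv * s\<^sup>2 * ?m" by simp
    have "eta * ?m \<le> eta * (2 ^ d * real p)" by (intro mult_left_mono cK) (use eta0 in auto)
    then have "eta * ?m \<le> 1" using etap by linarith
    then have "(2 * M\<^sup>2 * s\<^sup>2 * ?m) * (eta * ?m) \<le> (2 * M\<^sup>2 * s\<^sup>2 * ?m) * 1" by (intro mult_left_mono) auto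
    then have 3: "2 * M\<^sup>2 * eta * s\<^sup>2 * ?m\<^sup>2 \<le> 2 * M\<^sup>2 * s\<^sup>2 * ?m" by (simp add: power2_eq_square mult_ac)
    have 4: "(2 ^ d - 1) * (2 * eta) \<le> 2 * eta * 2 ^ d" using eta0 by (simp add: algebra_simps)
    have "psi s K \<le> (Cv / 2 + 2 * Cv + 2 * M\<^sup>2) * s\<^sup>2 * ?m + 2 * eta * 2 ^ d"
      using K(3)[OF s] 1 2 3 4 by (simp add: algebra_simps abs_le_iff)
    also have "(Cv / 2 + 2 * Cv + 2 * M\<^sup>2) * s\<^sup>2 * ?m \<le> Gam * s\<^sup>2 * (2 ^ d * p)"
      unfolding Gam_def by (intro mult_mono) (use Cv_pos cK in auto)
    finally show "psi s K \<le> Gam * s\<^sup>2 * (2 ^ d * p) + 2 * eta * 2 ^ d" by simp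
  qed
qed

text \<open>After \<open>k\<close> rounds there are \<open>k + 1\<close> pieces; with equal weights
  each is evaluated at \<open>s * (k + 1)\<close>, which is why the smallness conditions concern
  this product. What is left at the end is bounded trivially and carries the factor
  \<open>1 / 2 ^ k\<close>, since each round halves the nominal size. The conditions at the top
  exponent \<open>D\<close> are inherited by every smaller \<open>d\<close>.\<close>

lemma psi_iterated_bound:
  fixes kap :: real and p g0 D :: nat
  defines "eta \<equiv> exp (- 2 * c * real g0)"
  assumes kap: "0 \<le> kap" and g0: "1 \<le> g0" and eta: "eta \<le> 1 / 2"
    and frac: "real D * kap * real p + real g0 + 1 \<le> real p / 2" and etap: "eta * (2 ^ D * real p) \<le> 1"
  shows "finite J \<Longrightarrow> d \<le> D \<Longrightarrow> card J \<le> 2 ^ d * p \<Longrightarrow> \<bar>s\<bar> * real (Suc k) * M \<le> 2 * c * kap \<Longrightarrow>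
    \<bar>s\<bar> * real (Suc k) * M * p \<le> 1 \<Longrightarrow>
    psi s J \<le> 2 * real (Suc k) * Gam * s\<^sup>2 * (2 ^ d * p) + \<bar>s\<bar> * M * (2 ^ d * p) / 2 ^ k + 4 * eta * 2 ^ d"
proof (induction k arbitrary: J d s)
  case 0
  have eta0: "0 < eta" unfolding eta_def by simp
  have "real (card J) \<le> real (2 ^ d * p)" using 0 by (intro of_nat_mono) simp
  then have "\<bar>s\<bar> * M * card J \<le> \<bar>s\<bar> * M * (2 ^ d * p)" by (intro mult_left_mono) (use M_pos in auto)
  moreover have "0 \<le> 2 * real (Suc 0) * Gam * s\<^sup>2 * (2 ^ d * p)" "0 \<le> 4 * eta * 2 ^ d" using Gam_pos eta0 by auto
  moreover have "\<bar>s\<bar> * M * (2 ^ d * p) / 2 ^ 0 = \<bar>s\<bar> * M * (2 ^ d * p)" by simp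
  ultimately show ?case using psi_trivial_bound[of s J] by linarith
next
  case (Suc k)
  have eta0: "0 < eta" unfolding eta_def by simp
  define m where "m = real (Suc k)"
  have m: "1 \<le> m" unfolding m_def by simp
  have m1: "real (Suc (Suc k)) = m + 1" unfolding m_def by simp
  have s: "\<bar>s\<bar> * (m + 1) * M \<le> 2 * c * kap" "\<bar>s\<bar> * (m + 1) * M * p \<le> 1" using Suc.prems m1 by auto
  have fracd: "real d * kap * real p + real g0 + 1 \<le> real p / 2"
  proof -
    have "real d * (kap * real p) \<le> real D * (kap * real p)" using Suc.prems kap by (intro mult_right_mono) auto
    then show ?thesis using frac by (simp add: mult_ac)
  qed
  have etapd: "eta * (2 ^ d * real p) \<le> 1"
  proof -
    have "eta * (2 ^ d * real p) \<le> eta * (2 ^ D * real p)"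
      using Suc.prems eta0 by (intro mult_left_mono mult_right_mono power_increasing) auto
    then show ?thesis using etap by linarith
  qed
  obtain K where K: "K \<subseteq> J" "2 * card (J - K) \<le> 2 ^ d * p" "d = 0 \<Longrightarrow> K = J"
    "\<And>s. \<bar>s\<bar> * M \<le> 2 * c * kap \<Longrightarrow> \<bar>s\<bar> * M * real p \<le> 1 \<Longrightarrow> psi s K \<le> Gam * s\<^sup>2 * (2 ^ d * p) + 2 * eta * 2 ^ d"
    by (rule cantor_quadratic_bound[OF kap g0 _ fracd _ Suc.prems(1,3)]) (use eta etapd in \<open>auto simp: eta_def\<close>)
  let ?N = "2 ^ d * real p"
  show ?case
  proof (cases d)
    \<comment> \<open>A single short block remains: nothing is removed from it, and the recursion
      stops early.\<close>
    case 0
    have mono: "\<bar>s\<bar> * M \<le> \<bar>s\<bar> * (m + 1) * M"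
      using mult_right_mono[of 1 "m + 1" "\<bar>s\<bar> * M"] m M_pos by (simp add: mult_ac)
    have mono2: "\<bar>s\<bar> * M * p \<le> \<bar>s\<bar> * (m + 1) * M * p" using mult_right_mono[OF mono, of "real p"] by simp
    have "psi s J \<le> Gam * s\<^sup>2 * ?N + 2 * eta * 2 ^ d" using K(3)[OF 0] K(4)[of s] mono mono2 s by simp
    moreover have "Gam * s\<^sup>2 * ?N \<le> (2 * (m + 1)) * (Gam * s\<^sup>2 * ?N)"
      using mult_right_mono[of 1 "2 * (m + 1)" "Gam * s\<^sup>2 * ?N"] m Gam_pos by simp
    moreover have "0 \<le> \<bar>s\<bar> * M * ?N / 2 ^ Suc k" "2 * eta * 2 ^ d \<le> 4 * eta * 2 ^ d" using M_pos eta0 by auto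
    ultimately show ?thesis unfolding m1 by (simp add: mult_ac)
  next
    case (Suc d')
    have fin: "finite K" "finite (J - K)" using K Suc.prems finite_subset by auto
    have "K \<union> (J - K) = J" using K by auto
    then have J: "blocksum J x = blocksum K x + blocksum (J - K) x" for x
      using blocksum_Un[OF fin, of x] by (metis Diff_disjoint)
    \<comment> \<open>With \<open>m\<close> pieces still to come, \<open>K\<close> receives the
      parameter \<open>s * (m + 1)\<close>. The remainder receives \<open>s * (m + 1) / m\<close>,
      and multiplied by its own factor \<open>m\<close> this is again \<open>s * (m + 1)\<close>, so
      the smallness conditions persist.\<close>
    define w where "w = 1 / (m + 1)"
    have w: "0 < w" "w < 1" "s / w = s * (m + 1)" "1 - w = m / (m + 1)" "s / (1 - w) = s * ((m + 1) / m)"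
      unfolding w_def using m by (auto simp: field_simps)
    have split: "psi s J \<le> w * psi (s * (m + 1)) K + (1 - w) * psi (s * ((m + 1) / m)) (J - K)"
      using psi_holder[OF w(1,2), of s J s K s "J - K"] unfolding J w(3,5) by (simp only: distrib_left)
    have k1: "psi (s * (m + 1)) K \<le> Gam * (s * (m + 1))\<^sup>2 * ?N + 2 * eta * 2 ^ d"
      using K(4)[of "s * (m + 1)"] s m by (simp add: abs_mult)
    have k2: "psi (s * ((m + 1) / m)) (J - K) \<le> 2 * m * Gam * (s * ((m + 1) / m))\<^sup>2 * (2 ^ d' * p)
       + \<bar>s * ((m + 1) / m)\<bar> * M * (2 ^ d' * p) / 2 ^ k + 4 * eta * 2 ^ d'"
      unfolding m_def
    proof (rule Suc.IH)
      show "card (J - K) \<le> 2 ^ d' * p" using K(2) Suc by simp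
      have "\<bar>s * ((m + 1) / m)\<bar> * m = \<bar>s\<bar> * (m + 1)" using m by (simp add: abs_mult)
      then show "\<bar>s * ((real (Suc k) + 1) / real (Suc k))\<bar> * real (Suc k) * M \<le> 2 * c * kap"
        "\<bar>s * ((real (Suc k) + 1) / real (Suc k))\<bar> * real (Suc k) * M * p \<le> 1" using s unfolding m_def by auto
    qed (use fin Suc.prems Suc in auto)
    have "w * psi (s * (m + 1)) K + (1 - w) * psi (s * ((m + 1) / m)) (J - K) \<le> w * (Gam * (s * (m + 1))\<^sup>2 * ?N + 2 * eta * 2 ^ d) + (1 - w) * (2 * m * Gam * (s * ((m + 1) / m))\<^sup>2 * (2 ^ d' * p)
       + \<bar>s * ((m + 1) / m)\<bar> * M * (2 ^ d' * p) / 2 ^ k + 4 * eta * 2 ^ d')"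
      by (intro add_mono mult_left_mono k1 k2) (use w in auto)
    also have "\<dots> = w * (Gam * (s * (m + 1))\<^sup>2 * ?N) + w * (2 * eta * 2 ^ d)
       + (1 - w) * (2 * m * Gam * (s * ((m + 1) / m))\<^sup>2 * (2 ^ d' * p))
       + (1 - w) * (\<bar>s * ((m + 1) / m)\<bar> * M * (2 ^ d' * p) / 2 ^ k) + (1 - w) * (4 * eta * 2 ^ d')"
      by (simp only: distrib_left add.assoc)
    also have "w * (Gam * (s * (m + 1))\<^sup>2 * ?N) = (m + 1) * Gam * s\<^sup>2 * ?N"
      unfolding w_def using m by (simp add: power2_eq_square)
    \<comment> \<open>The halved size of the remainder compensates the 2 in the induction
      hypothesis: both pieces contribute the same quadratic term, and their sum reproduces the
      2.\<close>
    also have "(1 - w) * (2 * m * Gam * (s * ((m + 1) / m))\<^sup>2 * (2 ^ d' * p)) = (m + 1) * Gam * s\<^sup>2 * ?N"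
      unfolding w(4) Suc using m by (simp add: power2_eq_square divide_simps)
    also have "(1 - w) * (\<bar>s * ((m + 1) / m)\<bar> * M * (2 ^ d' * p) / 2 ^ k) = \<bar>s\<bar> * M * ?N / 2 ^ Suc k"
      unfolding w(4) Suc using m by (simp add: abs_mult)
    also have "(1 - w) * (4 * eta * 2 ^ d') = (1 - w) * (2 * eta * 2 ^ d)" unfolding Suc by simp
    also have "(m + 1) * Gam * s\<^sup>2 * ?N + w * (2 * eta * 2 ^ d) + (m + 1) * Gam * s\<^sup>2 * ?N + \<bar>s\<bar> * M * ?N / 2 ^ Suc k
       + (1 - w) * (2 * eta * 2 ^ d) = 2 * (m + 1) * Gam * s\<^sup>2 * ?N + \<bar>s\<bar> * M * ?N / 2 ^ Suc k + 2 * eta * 2 ^ d"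
      by (simp add: algebra_simps)
    also have "2 * eta * 2 ^ d \<le> 4 * eta * 2 ^ d" using eta0 by simp
    finally have "w * psi (s * (m + 1)) K + (1 - w) * psi (s * ((m + 1) / m)) (J - K)
      \<le> 2 * (m + 1) * Gam * s\<^sup>2 * ?N + \<bar>s\<bar> * M * ?N / 2 ^ Suc k + 4 * eta * 2 ^ d" by simp
    with split show ?thesis unfolding m1 of_nat_mult of_nat_power of_nat_numeral by (rule order.trans)
  qed
qed

text \<open>Hoelder's inequality is used for \<open>S\<^sub>J = S\<^sub>K + S\<^bsub>J - K\<^esub>\<close> and, for the lower
  bound, for \<open>S\<^sub>K = S\<^sub>J + (- S\<^bsub>J - K\<^esub>)\<close>.\<close>

lemma psi_sandwich:
  fixes \<delta> S E1 E2 :: real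
  assumes J: "finite J" "K \<subseteq> J" and \<delta>: "0 < \<delta>" "\<delta> \<le> 1 / 2" and s: "\<bar>s\<bar> \<le> S"
    and K: "\<And>u. \<bar>u\<bar> \<le> 2 * S \<Longrightarrow> \<bar>psi u K - u\<^sup>2 / 2 * V K\<bar> \<le> E1"
    and B: "\<And>u. \<bar>u\<bar> \<le> S / \<delta> \<Longrightarrow> psi u (J - K) \<le> E2"
  shows "\<bar>psi s J - s\<^sup>2 / 2 * V J\<bar> \<le> 2 * E1 + 2 * E2 + S\<^sup>2 * (\<delta> * Cv * card J + 3 * Cv * card (J - K))"
proof -
  have fin: "finite K" "finite (J - K)" using J finite_subset by auto
  have JK: "K \<union> (J - K) = J" using J by auto
  have bs: "blocksum J x = blocksum K x + blocksum (J - K) x" for x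
    using blocksum_Un[OF fin, of x] JK by (metis Diff_disjoint)
  \<comment> \<open>\<open>K\<close> receives almost all the weight, so its parameter
    \<open>s / w\<close> stays close to \<open>s\<close>; the parameter of \<open>J - K\<close>
    grows to \<open>s / \<delta>\<close>, which is affordable because that set is small.\<close>
  define w where "w = 1 - \<delta>"
  have w: "0 < w" "w < 1" "1/2 \<le> w" "1 - w = \<delta>" using \<delta> by (auto simp: w_def)
  have S0: "0 \<le> S" using s by simp
  have E10: "0 \<le> E1" using K[of 0] S0 by (auto intro: order.trans[OF abs_ge_zero])
  have E20: "0 \<le> E2" using B[of 0] S0 \<delta> by (auto intro: order.trans[OF psi_nonneg])
  have V1: "\<bar>V J - V K\<bar> \<le> 3 * Cv * card (J - K)"
    using V_Un_diff[OF fin] unfolding JK by blast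
  have s2: "s\<^sup>2 \<le> S\<^sup>2" using s S0 by (metis abs_le_square_iff abs_of_nonneg)
  have VJ: "V J \<le> Cv * card J" using V_le[OF J(1)] .
  have "psi s J \<le> w * psi (s / w) K + \<delta> * psi (s / \<delta>) (J - K)"
    using psi_holder[OF w(1,2), of s J s K s "J - K"] unfolding bs w(4) by (simp only: distrib_left)
  moreover have "psi (s / w) K \<le> E1 + (s / w)\<^sup>2 / 2 * V K"
  proof -
    have "\<bar>s\<bar> \<le> 2 * S * w" using mult_left_mono[OF w(3), of "2 * S"] S0 s by simp
    then have "\<bar>s / w\<bar> \<le> 2 * S" using w by (simp add: abs_divide pos_divide_le_eq)
    then show ?thesis using K[of "s / w"] by (simp add: abs_le_iff)
  qed
  then have "w * psi (s / w) K \<le> w * (E1 + (s / w)\<^sup>2 / 2 * V K)" using w by (intro mult_left_mono) auto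
  moreover have "psi (s / \<delta>) (J - K) \<le> E2"
    using \<delta> s by (intro B) (simp add: abs_divide divide_right_mono)
  then have "\<delta> * psi (s / \<delta>) (J - K) \<le> 1 * E2" using \<delta> E20 by (intro mult_mono psi_nonneg) auto
  moreover have "w * (E1 + (s / w)\<^sup>2 / 2 * V K) \<le> E1 + s\<^sup>2 / 2 * (V K / w)"
    using w E10 mult_right_mono[of w 1 E1] by (simp add: distrib_left power2_eq_square)
  ultimately have up: "psi s J \<le> E1 + E2 + s\<^sup>2 / 2 * (V K / w)" by linarith
  have Vw: "V K / w \<le> V J + 2 * \<delta> * Cv * card J + 6 * Cv * card (J - K)"
  proof -
    have "V K / w \<le> (V J + 3 * Cv * card (J - K)) / w" using V1 w by (intro divide_right_mono) auto
    also have "1 / w \<le> 1 + 2 * \<delta>"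
    proof -
      have "0 \<le> \<delta> * (1 - 2 * \<delta>)" using \<delta> by simp
      then have "1 \<le> (1 + 2 * \<delta>) * (1 - \<delta>)" by (simp add: algebra_simps)
      then show ?thesis using w unfolding w_def by (simp add: divide_le_eq)
    qed
    then have "V J / w \<le> V J * (1 + 2 * \<delta>)" using mult_left_mono[of "1 / w" "1 + 2 * \<delta>" "V J"] V_nonneg by simp
    moreover have "V J * (2 * \<delta>) \<le> Cv * card J * (2 * \<delta>)" using VJ \<delta> by (intro mult_right_mono) auto
    moreover have "3 * Cv * card (J - K) / w \<le> 3 * Cv * card (J - K) * 2"
    proof -
      have "1 / w \<le> 2" using w by (simp add: divide_le_eq)
      then show ?thesis using mult_left_mono[of "1 / w" 2 "3 * Cv * card (J - K)"] Cv_pos by simp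
    qed
    ultimately show ?thesis by (simp add: add_divide_distrib algebra_simps)
  qed
  have "s\<^sup>2 / 2 * (V K / w) \<le> s\<^sup>2 / 2 * (V J + 2 * \<delta> * Cv * card J + 6 * Cv * card (J - K))"
    by (intro mult_left_mono Vw) auto
  then have "psi s J - s\<^sup>2 / 2 * V J \<le> E1 + E2 + s\<^sup>2 * (\<delta> * Cv * card J + 3 * Cv * card (J - K))"
    using up by (simp add: algebra_simps)
  moreover have "s\<^sup>2 * (\<delta> * Cv * card J + 3 * Cv * card (J - K)) \<le> S\<^sup>2 * (\<delta> * Cv * card J + 3 * Cv * card (J - K))"
    using \<delta> Cv_pos by (intro mult_right_mono s2) auto
  ultimately have upper: "psi s J - s\<^sup>2 / 2 * V J \<le> 2 * E1 + 2 * E2 + S\<^sup>2 * (\<delta> * Cv * card J + 3 * Cv * card (J - K))"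
    using E10 E20 by linarith

  \<comment> \<open>Hoelder's inequality now bounds \<open>psi\<close> on \<open>K\<close> from
    above by \<open>psi\<close> on \<open>J\<close>; \<open>t\<close> is chosen so that the
    parameter \<open>t / w\<close> on \<open>J\<close> is the given \<open>s\<close>.\<close>
  define t where "t = s * w"
  have neg: "psi t K \<le> w * psi s J + \<delta> * psi (- t / \<delta>) (J - K)"
  proof -
    have "t * blocksum K x = t * blocksum J x + (- t) * blocksum (J - K) x" for x
      unfolding bs by (simp add: algebra_simps)
    from psi_holder[OF w(1,2) this] show ?thesis using w by (simp add: t_def)
  qed
  have tS: "\<bar>t\<bar> \<le> S" using s w mult_mono[of "\<bar>s\<bar>" S w 1] unfolding t_def by (simp add: abs_mult)
  have "t\<^sup>2 / 2 * V K - E1 \<le> psi t K" using K[of t] tS S0 by (simp add: abs_le_iff)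
  moreover have "psi (- t / \<delta>) (J - K) \<le> E2"
    using \<delta> tS by (intro B) (simp add: abs_divide divide_right_mono)
  then have "\<delta> * psi (- t / \<delta>) (J - K) \<le> (1/2) * E2" using \<delta> E20 by (intro mult_mono psi_nonneg) auto
  ultimately have "t\<^sup>2 / 2 * V K - E1 - E2 / 2 \<le> w * psi s J" using neg by linarith
  then have "(t\<^sup>2 / 2 * V K - E1 - E2 / 2) / w \<le> psi s J" using w by (simp add: divide_le_eq mult.commute)
  moreover have "(t\<^sup>2 / 2 * V K - E1 - E2 / 2) / w = s\<^sup>2 / 2 * (w * V K) - (E1 + E2 / 2) / w"
    unfolding t_def using w by (simp add: diff_divide_distrib add_divide_distrib power2_eq_square)
  moreover have "(E1 + E2 / 2) / w \<le> 2 * E1 + 2 * E2"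
  proof -
    have "(E1 + E2 / 2) / w \<le> (E1 + E2 / 2) / (1 / 2)" using w E10 E20 by (intro divide_left_mono) auto
    then show ?thesis using E20 by simp
  qed
  ultimately have lo: "s\<^sup>2 / 2 * (w * V K) - 2 * E1 - 2 * E2 \<le> psi s J" by linarith
  have "V J - 2 * (\<delta> * Cv * card J + 3 * Cv * card (J - K)) \<le> w * V K"
  proof -
    have "w * (V J - 3 * Cv * card (J - K)) \<le> w * V K" using V1 w by (intro mult_left_mono) auto
    moreover have "w * (3 * Cv * card (J - K)) \<le> 1 * (3 * Cv * card (J - K))" using w Cv_pos by (intro mult_right_mono) auto
    moreover have "\<delta> * V J \<le> \<delta> * (Cv * card J)" using VJ \<delta> by (intro mult_left_mono) auto
    moreover have "0 \<le> Cv * card (J - K)" "0 \<le> \<delta> * (Cv * card J)" using Cv_pos \<delta> by auto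
    ultimately show ?thesis unfolding w_def by (simp add: algebra_simps)
  qed
  then have "s\<^sup>2 / 2 * (V J - 2 * (\<delta> * Cv * card J + 3 * Cv * card (J - K))) \<le> s\<^sup>2 / 2 * (w * V K)"
    by (intro mult_left_mono) auto
  then have "s\<^sup>2 / 2 * V J - s\<^sup>2 * (\<delta> * Cv * card J + 3 * Cv * card (J - K)) \<le> s\<^sup>2 / 2 * (w * V K)"
    by (simp add: algebra_simps)
  moreover have "s\<^sup>2 * (\<delta> * Cv * card J + 3 * Cv * card (J - K)) \<le> S\<^sup>2 * (\<delta> * Cv * card J + 3 * Cv * card (J - K))"
    using \<delta> Cv_pos by (intro mult_right_mono s2) auto
  ultimately have "s\<^sup>2 / 2 * V J - psi s J \<le> 2 * E1 + 2 * E2 + S\<^sup>2 * (\<delta> * Cv * card J + 3 * Cv * card (J - K))"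
    using lo by linarith
  then show ?thesis using upper by (simp add: abs_le_iff)
qed

end

section \<open>Choice of block lengths and the resulting error bounds\<close>

text \<open>The least admissible \<open>d\<close> overshoots \<open>m\<close> by at most a factor 2,
  unless a single block is enough. The bound by \<open>n\<close>, independent of \<open>m\<close>,
  keeps the number of levels logarithmic in \<open>n\<close>.\<close>

lemma exists_dyadic_scale:
  fixes m n p :: nat
  assumes "1 \<le> p" "m \<le> n" "1 \<le> n"
  obtains d where "m \<le> 2 ^ d * p" "2 ^ d * p \<le> 2 * m + p" "2 ^ d \<le> 2 * n"
proof -
  define d where "d = (LEAST d. m \<le> 2 ^ d * p)"
  have "m \<le> 2 ^ m" by (rule less_imp_le[OF less_exp])
  also have "\<dots> \<le> 2 ^ m * p" using assms by simp
  finally have ex: "m \<le> 2 ^ m * p" .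
  then have d: "m \<le> 2 ^ d * p" unfolding d_def by (rule LeastI)
  show ?thesis
  proof (cases d)
    case 0
    then show ?thesis using that[of d] d assms by simp
  next
    case (Suc e)
    have "\<not> m \<le> 2 ^ e * p" using not_less_Least[of e "\<lambda>d. m \<le> 2 ^ d * p"] Suc unfolding d_def by simp
    then have le: "2 ^ d * p \<le> 2 * m" unfolding Suc by simp
    have "2 ^ d * 1 \<le> 2 ^ d * p" using assms by (intro mult_left_mono) auto
    then have "2 ^ d \<le> 2 * n" using le assms by linarith
    then show ?thesis using that[of d] d le by simp
  qed
qed

lemma half_le_ln_2: "(1::real) / 2 \<le> ln 2"
  using ln_le_minus_one[of "1 / 2 :: real"] by (simp add: ln_div)

lemma dyadic_exponent_le:
  assumes "2 ^ d \<le> 2 * n" "1 \<le> ln (real n)"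
  shows "real d \<le> 3 * ln (real n)"
proof -
  have n: "0 < real n" using assms(2) by (cases n) auto
  have "real (2 ^ d) \<le> real (2 * n)" using assms(1) by (rule of_nat_mono)
  then have "ln ((2::real) ^ d) \<le> ln (2 * real n)" by (intro ln_mono) (use n in auto)
  then have "real d * ln 2 \<le> ln 2 + ln n" using n by (simp add: ln_mult ln_realpow)
  moreover have "(1::real) / 2 \<le> ln 2"
    by (rule half_le_ln_2)
  then have "real d * (1 / 2) \<le> real d * ln 2" by (intro mult_left_mono) auto
  moreover have "ln (2::real) \<le> 2 - 1" by (rule ln_le_minus_one) simp
  moreover have "ln 2 * (real d - 1) \<le> ln n" using calculation(1) by (simp add: algebra_simps)
  moreover have "real d \<le> 3 * ln (real n)" if "1 \<le> real d"
  proof -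
    have "(1/2) * (real d - 1) \<le> ln 2 * (real d - 1)" by (intro mult_right_mono) (use that \<open>1/2 \<le> ln 2\<close> in auto)
    then have "(1/2) * (real d - 1) \<le> ln n" using calculation(4) by (rule order.trans)
    then have "real d \<le> 2 * ln n + 1" by simp
    also have "\<dots> \<le> 3 * ln n" using assms(2) by simp
    finally show ?thesis .
  qed
  ultimately show ?thesis using assms(2) by (cases "1 \<le> real d") auto
qed

text \<open>In the application \<open>l = sqrt (n * a n)\<close>, so that the relevant Laplace parameters are of
  order \<open>1 / l\<close> and errors are negligible if they are \<open>o(n / l\<^sup>2)\<close>; \<open>k\<close> is about \<open>log 2 l\<close> and
  the small parameter \<open>r\<close> measures how far \<open>l\<close> is above \<open>k * ln n\<close>.\<close>

definition scales :: "nat \<Rightarrow> real \<Rightarrow> real \<Rightarrow> nat \<Rightarrow> bool" where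
  "scales n l r k \<longleftrightarrow> 1 \<le> ln (real n) \<and> 1 \<le> l \<and> l\<^sup>2 \<le> real n \<and> 1 \<le> k \<and> l \<le> 2 ^ k \<and>
     0 < r \<and> r \<le> 1 / 2 \<and> r\<^sup>2 * l = real k * ln (real n)"

lemma scalesD:
  assumes "scales n l r k"
  shows "1 \<le> ln (real n)" "1 \<le> l" "l\<^sup>2 \<le> real n" "1 \<le> k" "l \<le> 2 ^ k" "0 < r" "r \<le> 1 / 2"
    "r\<^sup>2 * l = real k * ln (real n)"
  using assms unfolding scales_def by auto

lemma scales_facts:
  assumes "scales n l r k"
  shows "2 \<le> real n" "1 \<le> r * l" "ln (real n) / (r * l) = r / real k" "1 / real n \<le> r" "l \<le> real n"
    "1 \<le> ln (real n) / r" "real k * ln (real n) / l = r\<^sup>2" "ln (real n) / r = r * l / real k"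
proof -
  note s = scalesD[OF assms]
  have r1: "r \<le> 1" using s by simp
  have k1: "1 \<le> real k" using s by simp
  have n0: "0 < real n" using s(1) by (cases n) auto
  have "1 + ln n \<le> n" using ln_le_minus_one[OF n0] by simp
  then show n2: "2 \<le> real n" using s(1) by linarith
  have "1 * 1 \<le> real k * ln n" using s k1 by (intro mult_mono) auto
  then have rl: "1 \<le> r\<^sup>2 * l" using s by simp
  have "r\<^sup>2 * l = r * (r * l)" by (simp add: power2_eq_square)
  also have "\<dots> \<le> 1 * (r * l)" using s r1 by (intro mult_right_mono) auto
  finally show "1 \<le> r * l" using rl by simp
  have "l * 1 \<le> l * l" using s by (intro mult_left_mono) auto
  then show ln: "l \<le> real n" using s(3) by (simp add: power2_eq_square)
  have "r * (r * l) \<le> 1 * (r * n)" using s r1 ln by (intro mult_mono) auto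
  then have "1 \<le> r * n" using rl by (simp add: power2_eq_square)
  then show "1 / real n \<le> r" using n0 by (simp add: divide_le_eq)
  show "1 \<le> ln (real n) / r" using s r1 by (simp add: le_divide_eq)
  show "real k * ln (real n) / l = r\<^sup>2" using s by (simp add: divide_eq_eq)
  have e: "ln n * real k = r * (r * l)" using s(8) by (simp add: power2_eq_square mult_ac)
  show "ln (real n) / (r * l) = r / real k" "ln (real n) / r = r * l / real k"
    using e s k1 by (simp_all add: frac_eq_eq)
qed

context bounded_mixing begin

text \<open>The surplus gap for which \<open>exp (- 2 * c * g0)\<close> is at most
  \<open>1 / n ^ 3\<close>: one power of \<open>n\<close> pays for the number of splits or for a set
  size, the rest makes the error smaller than \<open>r\<close>.\<close>

definition gap0 :: "nat \<Rightarrow> nat" where "gap0 n = nat \<lceil>3 * ln (real n) / (2 * c)\<rceil>"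

text \<open>The 2 accounts for rounding up in \<open>gap0\<close> and for the summand 1 in
  \<open>gap0 n + 1\<close>, as \<open>ln n >= 1\<close>.\<close>

definition Gap :: real where "Gap = 3 / (2 * c) + 2"

lemma Gap_pos: "0 < Gap"
  unfolding Gap_def using c_pos by (simp add: add_pos_pos)

lemma gap0_facts:
  assumes n: "1 \<le> ln (real n)"
  defines "eta \<equiv> exp (- 2 * c * real (gap0 n))"
  shows "1 \<le> gap0 n" "eta \<le> 1 / 2" "eta * real n ^ 3 \<le> 1" "real (gap0 n) + 1 \<le> Gap * ln (real n)"
proof -
  define L where "L = ln (real n)"
  have n0: "0 < real n" using n by (cases n) auto
  have "1 + ln n \<le> n" using ln_le_minus_one[OF n0] by simp
  then have n2: "2 \<le> real n" using n by linarith
  have pos: "0 < 3 * L / (2 * c)" using n c_pos by (simp add: L_def)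
  have g: "3 * L / (2 * c) \<le> real (gap0 n)" "real (gap0 n) \<le> 3 * L / (2 * c) + 1"
    using pos unfolding gap0_def L_def by linarith+
  show "1 \<le> gap0 n" using pos unfolding gap0_def L_def by linarith
  have "3 * L \<le> 2 * c * real (gap0 n)" using g(1) c_pos by (simp add: divide_le_eq mult_ac)
  then have "eta \<le> exp (- (3 * L))" unfolding eta_def by simp
  also have "\<dots> = 1 / real n ^ 3"
    using n0 exp_of_nat_mult[of 3 L] by (simp add: exp_minus L_def divide_inverse)
  finally have e: "eta \<le> 1 / real n ^ 3" .
  then show 3: "eta * real n ^ 3 \<le> 1" using n0 by (simp add: le_divide_eq)
  have "(2::real) ^ 1 \<le> 2 ^ 3" by simp
  also have "(2::real) ^ 3 \<le> real n ^ 3" by (intro power_mono) (use n2 in auto)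
  finally have "1 / real n ^ 3 \<le> 1 / 2" using n0 by (intro divide_left_mono) auto
  then show "eta \<le> 1 / 2" using e by linarith
  have "real (gap0 n) + 1 \<le> 3 / (2 * c) * L + 2 * 1" using g(2) by simp
  also have "\<dots> \<le> 3 / (2 * c) * L + 2 * L" using n by (simp add: L_def)
  finally show "real (gap0 n) + 1 \<le> Gap * ln (real n)" unfolding Gap_def L_def by (simp add: algebra_simps)
qed

text \<open>The 9 comes from \<open>2 ^ d * p <= 3 * n\<close> and \<open>d <= 3 * ln n\<close>; the
  constant parts of the gaps contribute \<open>3 * Gap\<close>.\<close>

definition C1 :: real where "C1 = 9 + 3 * Gap"

text \<open>Blocks of length about \<open>r * l\<close> are a compromise. They are short enough for
  a third-order error \<open>|u| ^ 3 * p * n\<close> of order \<open>r * n / l\<^sup>2\<close>, and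
  long enough that both the \<open>ln n\<close> levels with \<open>kap = 1 / (r * l)\<close> and the
  gaps of order \<open>ln n\<close> remove only a proportion of order
  \<open>ln n / (r * l) = r / k\<close>.\<close>

lemma outer_blocks:
  assumes U: "0 < U" and sc: "scales n l r k" and r: "r \<le> c / (U * M)" "r \<le> 1 / (4 * U * M)"
  obtains K where "K \<subseteq> {..<n}" "real (card ({..<n} - K)) \<le> C1 * real n * r / real k"
    "\<And>u. \<bar>u\<bar> \<le> 2 * (U / l) \<Longrightarrow> \<bar>psi u K - u\<^sup>2 / 2 * V K\<bar> \<le>
       real n / l\<^sup>2 * (r * (4 + 32 * M * Cv * U ^ 3 + 8 * M\<^sup>2 * U\<^sup>2))"
proof -
  note s = scalesD[OF sc] and f = scales_facts[OF sc]
  define L where "L = ln (real n)"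
  define p where "p = nat \<lceil>r * l\<rceil>"
  define kap where "kap = 1 / (r * l)"
  define g0 where "g0 = gap0 n"
  define eta where "eta = exp (- 2 * c * real g0)"
  note g = gap0_facts[OF s(1), folded g0_def, folded eta_def]
  have rl: "1 \<le> r * l" by (rule f)
  have p: "r * l \<le> real p" "real p \<le> 2 * (r * l)" "1 \<le> p" using rl unfolding p_def by linarith+
  have "r * l \<le> (1/2) * n" using s f by (intro mult_mono) auto
  then have pn: "real p \<le> real n" using p by linarith
  have "1 \<le> n" using f(1) by linarith
  then obtain d where d: "n \<le> 2 ^ d * p" "2 ^ d * p \<le> 2 * n + p" "2 ^ d \<le> 2 * n"
    using exists_dyadic_scale[of p n n] p by auto
  have dL: "real d \<le> 3 * L" unfolding L_def by (rule dyadic_exponent_le[OF d(3) s(1)])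
  have "real (2 ^ d * p) \<le> real (2 * n + p)" by (rule of_nat_mono[OF d(2)])
  then have N: "2 ^ d * real p \<le> 3 * real n" using pn by simp
  have d2: "2 ^ d \<le> 2 * real n" using of_nat_mono[OF d(3), where 'a=real] by simp
  have kap0: "0 \<le> kap" unfolding kap_def using rl by simp
  have eta0: "0 < eta" unfolding eta_def by simp
  obtain K where K: "K \<subseteq> {..<n}"
    "real (card ({..<n} - K)) + (real g0 + 1) \<le> 2 ^ d * (real d * kap * real p + real g0 + 1)"
    "\<And>s. \<bar>s\<bar> * M \<le> 2 * c * kap \<Longrightarrow> \<bar>s\<bar> * M * real p \<le> 1 \<Longrightarrow>
      \<bar>psi s K - s\<^sup>2 / 2 * V K\<bar> \<le> (2 ^ d - 1) * (2 * eta) + 2 * M * Cv * \<bar>s\<bar> ^ 3 * real p * real (card K)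
        + 2 * M\<^sup>2 * eta * s\<^sup>2 * (real (card K))\<^sup>2"
    using cantor_blocks[OF kap0 g(1), of "{..<n}" d p] g(2) d(1) unfolding eta_def by auto
  have cK: "real (card K) \<le> real n" using card_mono[OF _ K(1)] by simp
  show ?thesis
  proof (rule that[OF K(1)])
    have "real (card ({..<n} - K)) \<le> (2 ^ d * real p) * (real d * kap) + 2 ^ d * (real g0 + 1)"
      using K(2) by (simp add: algebra_simps)
    also have "\<dots> \<le> (3 * real n) * (3 * L * kap) + (3 * real n * kap) * (Gap * L)"
    proof (rule add_mono)
      have "real d * kap \<le> 3 * L * kap" by (intro mult_right_mono dL kap0)
      then show "(2 ^ d * real p) * (real d * kap) \<le> (3 * real n) * (3 * L * kap)"
        by (intro mult_mono[OF N]) (use kap0 in auto)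
      have "2 ^ d \<le> 3 * real n / real p" using N p by (simp add: le_divide_eq)
      also have "\<dots> \<le> 3 * real n / (r * l)" using p rl by (intro divide_left_mono) auto
      finally have "2 ^ d \<le> 3 * real n * kap" unfolding kap_def by simp
      then show "2 ^ d * (real g0 + 1) \<le> (3 * real n * kap) * (Gap * L)"
        by (rule mult_mono) (use g(4) kap0 in \<open>auto simp: L_def\<close>)
    qed
    also have "\<dots> = C1 * real n * (L * kap)" unfolding C1_def by (simp add: algebra_simps)
    also have "L * kap = r / real k" unfolding kap_def L_def using f(3) by simp
    finally show "real (card ({..<n} - K)) \<le> C1 * real n * r / real k" by simp
  next
    fix u assume u: "\<bar>u\<bar> \<le> 2 * (U / l)"
    have l0: "0 < l" using s by simp
    have ul: "\<bar>u\<bar> \<le> 2 * U / l" using u by simp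
    have c1: "\<bar>u\<bar> * M \<le> 2 * c * kap"
    proof -
      have "r * (U * M) \<le> c" using r(1) U M_pos by (simp add: le_divide_eq)
      then have "U * M \<le> c / r" using s by (simp add: le_divide_eq mult.commute)
      then have "2 * (U * M) / l \<le> 2 * (c / r) / l" using l0 by (intro divide_right_mono) auto
      moreover have "\<bar>u\<bar> * M \<le> 2 * U / l * M" using M_pos by (intro mult_right_mono ul) auto
      ultimately show ?thesis unfolding kap_def by simp
    qed
    have c2: "\<bar>u\<bar> * M * real p \<le> 1"
    proof -
      have "\<bar>u\<bar> * M * real p \<le> 2 * U / l * M * (2 * (r * l))"
        by (intro mult_mono ul p) (use U M_pos l0 in auto)
      also have "\<dots> = r * (4 * U * M)" using l0 by simp
      also have "\<dots> \<le> 1" using r(2) U M_pos by (simp add: le_divide_eq)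
      finally show ?thesis .
    qed
    \<comment> \<open>One power of \<open>n\<close> in \<open>eta * n ^ 3 <= 1\<close> is spent on
      the left; the other two give the bound \<open>r\<close>, as \<open>1 / n <= r\<close>, and
      \<open>n / l\<^sup>2 >= 1\<close>.\<close>
    have en: "eta * real n \<le> r * (real n / l\<^sup>2)"
    proof -
      have "eta * real n * (real n * real n) \<le> 1" using g(3) by (simp add: power3_eq_cube mult_ac)
      then have "eta * real n \<le> 1 / real n * (1 / real n)" using f(1) by (simp add: le_divide_eq mult_ac)
      also have "\<dots> \<le> r * 1" using f s(6) by (intro mult_mono) auto
      also have "\<dots> \<le> r * (real n / l\<^sup>2)" using s l0 by (intro mult_left_mono) (auto simp: le_divide_eq)
      finally show ?thesis .
    qed
    have t1: "(2 ^ d - 1) * (2 * eta) \<le> 4 * (r * (real n / l\<^sup>2))"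
    proof -
      have "(2 ^ d - 1) * (2 * eta) \<le> (2 * real n) * (2 * eta)" by (intro mult_right_mono) (use d2 eta0 in auto)
      also have "\<dots> = 4 * (eta * real n)" by simp
      also have "\<dots> \<le> 4 * (r * (real n / l\<^sup>2))" by (intro mult_left_mono en) auto
      finally show ?thesis .
    qed
    have u3: "\<bar>u\<bar> ^ 3 \<le> (2 * U / l) ^ 3" by (intro power_mono ul) auto
    have u2: "u\<^sup>2 \<le> (2 * U / l)\<^sup>2" using power_mono[OF ul, of 2] by simp
    have t2: "2 * M * Cv * \<bar>u\<bar> ^ 3 * real p * real (card K) \<le> 32 * M * Cv * U ^ 3 * (r * (real n / l\<^sup>2))"
    proof -
      have "2 * M * Cv * \<bar>u\<bar> ^ 3 * real p * real (card K) \<le> 2 * M * Cv * (2 * U / l) ^ 3 * (2 * (r * l)) * real n"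
        by (intro mult_mono mult_left_mono u3 cK p) (use M_pos Cv_pos U l0 rl in auto)
      also have "\<dots> = 32 * M * Cv * U ^ 3 * (r * (real n / l\<^sup>2))"
        using l0 by (simp add: power3_eq_cube power2_eq_square divide_simps)
      finally show ?thesis .
    qed
    have t3: "2 * M\<^sup>2 * eta * u\<^sup>2 * (real (card K))\<^sup>2 \<le> 8 * M\<^sup>2 * U\<^sup>2 * (r * (real n / l\<^sup>2))"
    proof -
      have "2 * M\<^sup>2 * eta * u\<^sup>2 * (real (card K))\<^sup>2 \<le> 2 * M\<^sup>2 * eta * (2 * U / l)\<^sup>2 * (real n)\<^sup>2"
        by (intro mult_mono mult_left_mono u2 power_mono cK) (use eta0 in auto)
      also have "\<dots> = 8 * M\<^sup>2 * U\<^sup>2 * (eta * real n * (real n / l\<^sup>2))"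
        by (simp add: power2_eq_square)
      also have "\<dots> \<le> 8 * M\<^sup>2 * U\<^sup>2 * (r * (real n / l\<^sup>2))"
      proof (intro mult_left_mono mult_right_mono)
        have "eta * real n * (real n * real n) \<le> 1" using g(3) by (simp add: power3_eq_cube mult_ac)
        then have "eta * real n \<le> 1 / real n * (1 / real n)" using f(1) by (simp add: le_divide_eq mult_ac)
        also have "\<dots> \<le> r * 1" using f s(6) by (intro mult_mono) auto
        finally show "eta * real n \<le> r" by simp
      qed auto
      finally show ?thesis .
    qed
    have "\<bar>psi u K - u\<^sup>2 / 2 * V K\<bar> \<le> 4 * (r * (real n / l\<^sup>2)) + 32 * M * Cv * U ^ 3 * (r * (real n / l\<^sup>2))
       + 8 * M\<^sup>2 * U\<^sup>2 * (r * (real n / l\<^sup>2))"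
      using K(3)[OF c1 c2] t1 t2 t3 by linarith
    also have "\<dots> = real n / l\<^sup>2 * (r * (4 + 32 * M * Cv * U ^ 3 + 8 * M\<^sup>2 * U\<^sup>2))"
      by (simp add: algebra_simps add_divide_distrib)
    finally show "\<bar>psi u K - u\<^sup>2 / 2 * V K\<bar> \<le> real n / l\<^sup>2 * (r * (4 + 32 * M * Cv * U ^ 3 + 8 * M\<^sup>2 * U\<^sup>2))" .
  qed
qed

text \<open>Comes from the nominal size \<open>2 ^ d * p <= 2 * card B + p\<close>, where
  \<open>p\<close> itself is of order \<open>n * r / k\<close>.\<close>

definition C2 :: real where "C2 = 2 * C1 + 2"

lemma C1_pos: "0 < C1" and C2_pos: "0 < C2"
  unfolding C1_def C2_def using Gap_pos by auto

text \<open>The \<open>k\<close> Hoelder weights raise the parameter to order \<open>k / l\<close>,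
  so the blocks must be shorter by a factor \<open>k\<close> than in \<open>outer_blocks\<close>:
  \<open>p\<close> is about \<open>ln n / r\<close>, which makes \<open>|u| * k * M * p\<close> of
  order \<open>r\<close>. Gaps of order \<open>ln n\<close> still take only a proportion of order
  \<open>r\<close> of a block, and losing at most one half is allowed. The factor \<open>k\<close>
  in the quadratic term is cancelled by the size of \<open>B\<close>.\<close>

lemma inner_bound:
  assumes W: "0 < W" and sc: "scales n l r k"
    and r: "r \<le> 1 / (2 * W * M)" "r \<le> c / (6 * W * M)" "r \<le> 1 / (4 * Gap)" "r \<le> 1 / C2"
    and B: "B \<subseteq> {..<n}" "real (card B) \<le> C1 * real n * r / real k"
    and u: "\<bar>u\<bar> \<le> W / l"
  shows "psi u B \<le> real n / l\<^sup>2 * (r * (2 * Gam * W\<^sup>2 * C2 + 2 * W * M * C2 + 8))"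
proof -
  note s = scalesD[OF sc] and f = scales_facts[OF sc]
  define L where "L = ln (real n)"
  define p where "p = nat \<lceil>L / r\<rceil>"
  define kap where "kap = W * real k * M / (2 * c * l)"
  define g0 where "g0 = gap0 n"
  define eta where "eta = exp (- 2 * c * real g0)"
  note g = gap0_facts[OF s(1), folded g0_def, folded eta_def]
  have l0: "0 < l" and k0: "1 \<le> real k" using s by auto
  have eta0: "0 < eta" unfolding eta_def by simp
  have Lr: "1 \<le> L / r" unfolding L_def by (rule f)
  have p: "L / r \<le> real p" "real p \<le> 2 * (L / r)" "1 \<le> p" using Lr unfolding p_def by linarith+
  have fin: "finite B" using B finite_subset by auto
  have "card B \<le> n" using card_mono[OF _ B(1)] by simp
  moreover have "1 \<le> n" using f(1) by linarith
  ultimately obtain d where d: "card B \<le> 2 ^ d * p" "2 ^ d * p \<le> 2 * card B + p" "2 ^ d \<le> 2 * n"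
    using exists_dyadic_scale[of p "card B" n] p by auto
  have dL: "real d \<le> 3 * L" unfolding L_def by (rule dyadic_exponent_le[OF d(3) s(1)])
  have d2: "2 ^ d \<le> 2 * real n" using of_nat_mono[OF d(3), where 'a=real] by simp
  have N: "2 ^ d * real p \<le> C2 * (real n * r / real k)"
  proof -
    have "real (2 ^ d * p) \<le> real (2 * card B + p)" by (rule of_nat_mono[OF d(2)])
    then have "2 ^ d * real p \<le> 2 * real (card B) + real p" by simp
    also have "\<dots> \<le> 2 * (C1 * real n * r / real k) + 2 * (r * l / real k)"
      using B(2) p(2) f(8) unfolding L_def by (intro add_mono) auto
    also have "r * l / real k \<le> r * real n / real k"
      using s f k0 by (intro divide_right_mono mult_left_mono) auto
    finally show ?thesis unfolding C2_def by (simp add: algebra_simps add_divide_distrib)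
  qed
  have kap0: "0 \<le> kap" unfolding kap_def using W M_pos c_pos l0 by simp
  \<comment> \<open>In \<open>psi_iterated_bound\<close> the index \<open>k'\<close> stands for
    \<open>Suc k'\<close> pieces. The trivial term then carries \<open>1 / 2 ^ k'\<close>, which
    costs a factor 2 in \<open>1 / 2 ^ k' <= 2 / l\<close>.\<close>
  obtain k' where k': "k = Suc k'" using s(4) by (cases k) auto
  have frac: "real d * kap * real p + real g0 + 1 \<le> real p / 2"
  proof -
    have "real d * kap \<le> 3 * L * kap" by (intro mult_right_mono dL kap0)
    also have "\<dots> = 3 * W * M / (2 * c) * (real k * L / l)" unfolding kap_def by simp
    also have "\<dots> = 3 * W * M / (2 * c) * r\<^sup>2" unfolding L_def f(7) ..
    also have "r\<^sup>2 \<le> r * 1" unfolding power2_eq_square using s by (intro mult_left_mono) auto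
    then have "3 * W * M / (2 * c) * r\<^sup>2 \<le> 3 * W * M / (2 * c) * r"
      using W M_pos c_pos by (intro mult_left_mono) auto
    also have "\<dots> \<le> 3 * W * M / (2 * c) * (c / (6 * W * M))" using W M_pos c_pos by (intro mult_left_mono r) auto
    also have "\<dots> = 1 / 4" using W M_pos c_pos by simp
    finally have "real d * kap * real p \<le> 1 / 4 * real p" by (intro mult_right_mono) auto
    moreover have "real g0 + 1 \<le> real p / 4"
    proof -
      have "r * (4 * Gap) \<le> 1" using r(3) Gap_pos by (simp add: le_divide_eq)
      then have "4 * Gap \<le> 1 / r" using s by (simp add: le_divide_eq mult.commute)
      then have "L * (4 * Gap) \<le> L * (1 / r)" using s(1) unfolding L_def by (intro mult_left_mono) auto
      then show ?thesis using g(4) p(1) unfolding L_def by (simp add: mult_ac)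
    qed
    ultimately show ?thesis by linarith
  qed
  have en: "eta * real n \<le> r" "eta * real n \<le> 1"
  proof -
    have "eta * real n * (real n * real n) \<le> 1" using g(3) by (simp add: power3_eq_cube mult_ac)
    then have "eta * real n \<le> 1 / real n * (1 / real n)" using f(1) by (simp add: le_divide_eq mult_ac)
    also have "\<dots> \<le> r * 1" using f s(6) by (intro mult_mono) auto
    finally show "eta * real n \<le> r" by simp
    then show "eta * real n \<le> 1" using s by simp
  qed
  have etap: "eta * (2 ^ d * real p) \<le> 1"
  proof -
    have "eta * (2 ^ d * real p) \<le> eta * (C2 * (real n * r / real k))" using eta0 by (intro mult_left_mono N) auto
    also have "\<dots> = (eta * real n) * (r * C2) * (1 / real k)" by simp
    also have "\<dots> \<le> 1 * 1 * 1"
      using r(4) C2_pos s k0 eta0 by (intro mult_mono en) (auto simp: le_divide_eq)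
    finally show ?thesis by simp
  qed
  have c1: "\<bar>u\<bar> * real (Suc k') * M \<le> 2 * c * kap"
  proof -
    have "\<bar>u\<bar> * real k * M \<le> W / l * real k * M" using M_pos by (intro mult_right_mono u) auto
    then show ?thesis unfolding kap_def k' using c_pos by simp
  qed
  have c2: "\<bar>u\<bar> * real (Suc k') * M * p \<le> 1"
  proof -
    have "\<bar>u\<bar> * real k * M * p \<le> W / l * real k * M * (2 * (L / r))"
      using W M_pos l0 by (intro mult_mono mult_right_mono u p) auto
    also have "\<dots> = 2 * W * M * (real k * L / l) / r" by simp
    also have "\<dots> = r * (2 * W * M)" unfolding L_def f(7) using s by (simp add: power2_eq_square)
    also have "\<dots> \<le> 1" using r(1) W M_pos by (simp add: le_divide_eq)
    finally show ?thesis unfolding k' .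
  qed
  have "psi u B \<le> 2 * real (Suc k') * Gam * u\<^sup>2 * (2 ^ d * p) + \<bar>u\<bar> * M * (2 ^ d * p) / 2 ^ k' + 4 * eta * 2 ^ d"
    using psi_iterated_bound[OF kap0 g(1) _ frac _ fin order.refl d(1) c1 c2] g(2) etap unfolding eta_def by simp
  then have main: "psi u B \<le> 2 * real k * Gam * u\<^sup>2 * (2 ^ d * real p) + \<bar>u\<bar> * M * (2 ^ d * real p) / 2 ^ k' + 4 * eta * 2 ^ d"
    unfolding k' by simp
  have u2: "u\<^sup>2 \<le> (W / l)\<^sup>2" using power_mono[OF u, of 2] by simp
  have t1: "2 * real k * Gam * u\<^sup>2 * (2 ^ d * real p) \<le> 2 * Gam * W\<^sup>2 * C2 * (r * (real n / l\<^sup>2))"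
  proof -
    have "2 * real k * Gam * u\<^sup>2 * (2 ^ d * real p) \<le> 2 * real k * Gam * (W / l)\<^sup>2 * (C2 * (real n * r / real k))"
      by (intro mult_mono mult_left_mono u2 N) (use Gam_pos in auto)
    also have "\<dots> = 2 * Gam * W\<^sup>2 * C2 * (r * (real n / l\<^sup>2))" using k0 by (simp add: power2_eq_square)
    finally show ?thesis .
  qed
  have t2: "\<bar>u\<bar> * M * (2 ^ d * real p) / 2 ^ k' \<le> 2 * W * M * C2 * (r * (real n / l\<^sup>2))"
  proof -
    have "C2 * (real n * r / real k) \<le> C2 * (real n * r / 1)"
      using k0 C2_pos s by (intro mult_left_mono divide_left_mono) auto
    then have N': "2 ^ d * real p \<le> C2 * (real n * r)" using N by simp
    have "\<bar>u\<bar> * M \<le> W / l * M" using M_pos by (intro mult_right_mono u) auto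
    then have "\<bar>u\<bar> * M * (2 ^ d * real p) \<le> W / l * M * (C2 * (real n * r))"
      by (rule mult_mono[OF _ N']) (use W M_pos l0 in auto)
    moreover have k2: "1 / 2 ^ k' \<le> 2 / l"
    proof -
      have "l \<le> 2 * 2 ^ k'" using s(5) unfolding k' by simp
      then show ?thesis using l0 by (simp add: divide_le_eq le_divide_eq)
    qed
    ultimately have "\<bar>u\<bar> * M * (2 ^ d * real p) * (1 / 2 ^ k') \<le> W / l * M * (C2 * (real n * r)) * (2 / l)"
      by (rule mult_mono) (use k2 W M_pos l0 C2_pos s in auto)
    also have "\<dots> = 2 * W * M * C2 * (r * (real n / l\<^sup>2))" by (simp add: power2_eq_square)
    finally show ?thesis by simp
  qed
  have t3: "4 * eta * 2 ^ d \<le> 8 * (r * (real n / l\<^sup>2))"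
  proof -
    have "4 * eta * 2 ^ d \<le> 4 * eta * (2 * real n)" using eta0 by (intro mult_left_mono d2) auto
    also have "\<dots> \<le> 8 * (r * 1)" using en by simp
    also have "\<dots> \<le> 8 * (r * (real n / l\<^sup>2))" using s l0 by (intro mult_left_mono) (auto simp: le_divide_eq)
    finally show ?thesis .
  qed
  have "psi u B \<le> 2 * Gam * W\<^sup>2 * C2 * (r * (real n / l\<^sup>2)) + 2 * W * M * C2 * (r * (real n / l\<^sup>2)) + 8 * (r * (real n / l\<^sup>2))"
    using main t1 t2 t3 by linarith
  also have "\<dots> = real n / l\<^sup>2 * (r * (2 * Gam * W\<^sup>2 * C2 + 2 * W * M * C2 + 8))"
    by (simp add: algebra_simps add_divide_distrib)
  finally show ?thesis .
qed

text \<open>Two small parameters are involved: the weight \<open>\<delta>\<close> of the removed set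
  and the scale parameter \<open>r\<close>. Both \<open>\<tau>\<close> and \<open>A\<close> depend
  on \<open>\<delta>\<close> through \<open>W = U / \<delta>\<close>, so \<open>r\<close> has to
  tend to 0 first and \<open>\<delta>\<close> afterwards.\<close>

lemma psi_quadratic:
  fixes U \<delta> :: real
  assumes U: "0 < U" and \<delta>: "0 < \<delta>" "\<delta> \<le> 1 / 2"
  obtains \<tau> A where "0 < \<tau>" "0 < A"
    "\<And>n l r k s. scales n l r k \<Longrightarrow> r \<le> \<tau> \<Longrightarrow> \<bar>s\<bar> \<le> U / l \<Longrightarrow>
      \<bar>psi s {..<n} - s\<^sup>2 / 2 * V {..<n}\<bar> \<le> real n / l\<^sup>2 * (U\<^sup>2 * Cv * \<delta> + A * r)"
proof -
  define W where "W = U / \<delta>"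
  have W: "0 < W" unfolding W_def using U \<delta> by simp
  \<comment> \<open>The smallness conditions on \<open>r\<close> in \<open>outer_blocks\<close> and
    \<open>inner_bound\<close>, collected.\<close>
  define \<tau> where "\<tau> = Min {c / (U * M), 1 / (4 * U * M), 1 / (2 * W * M), c / (6 * W * M), 1 / (4 * Gap), 1 / C2}"
  define A1 where "A1 = 4 + 32 * M * Cv * U ^ 3 + 8 * M\<^sup>2 * U\<^sup>2"
  define A2 where "A2 = 2 * Gam * W\<^sup>2 * C2 + 2 * W * M * C2 + 8"
  define A where "A = 2 * A1 + 2 * A2 + 3 * U\<^sup>2 * Cv * C1"
  have A1: "0 < A1" unfolding A1_def using U M_pos Cv_pos by (simp add: add_pos_nonneg)
  have A2: "0 < A2" unfolding A2_def using W M_pos C2_pos Gam_pos by (simp add: add_nonneg_pos)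
  show ?thesis
  proof (rule that[of \<tau> A])
    show "0 < \<tau>" unfolding \<tau>_def using U W M_pos c_pos Gap_pos C2_pos by simp
    show "0 < A" unfolding A_def using A1 A2 Cv_pos C1_pos by (simp add: add_pos_nonneg)
    fix n l r k s assume sc: "scales n l r k" and r\<tau>: "r \<le> \<tau>" and su: "\<bar>s\<bar> \<le> U / l"
    have r: "r \<le> c / (U * M)" "r \<le> 1 / (4 * U * M)" "r \<le> 1 / (2 * W * M)" "r \<le> c / (6 * W * M)" "r \<le> 1 / (4 * Gap)" "r \<le> 1 / C2"
      using r\<tau> unfolding \<tau>_def by auto
    note sd = scalesD[OF sc]
    have l0: "0 < l" and k0: "1 \<le> real k" using sd by auto
    obtain K where K: "K \<subseteq> {..<n}" "real (card ({..<n} - K)) \<le> C1 * real n * r / real k"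
      "\<And>u. \<bar>u\<bar> \<le> 2 * (U / l) \<Longrightarrow> \<bar>psi u K - u\<^sup>2 / 2 * V K\<bar> \<le> real n / l\<^sup>2 * (r * A1)"
      using outer_blocks[OF U sc r(1,2)] unfolding A1_def by blast
    have B: "psi u ({..<n} - K) \<le> real n / l\<^sup>2 * (r * A2)" if "\<bar>u\<bar> \<le> U / l / \<delta>" for u
      unfolding A2_def by (rule inner_bound[OF W sc r(3-6) _ K(2)]) (use that in \<open>auto simp: W_def mult.commute\<close>)
    have "\<bar>psi s {..<n} - s\<^sup>2 / 2 * V {..<n}\<bar> \<le> 2 * (real n / l\<^sup>2 * (r * A1)) + 2 * (real n / l\<^sup>2 * (r * A2))
       + (U / l)\<^sup>2 * (\<delta> * Cv * card {..<n} + 3 * Cv * card ({..<n} - K))"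
      by (rule psi_sandwich[OF _ K(1) \<delta> su K(3) B]) auto
    also have "(U / l)\<^sup>2 * (\<delta> * Cv * card {..<n} + 3 * Cv * card ({..<n} - K))
       \<le> (U / l)\<^sup>2 * (\<delta> * Cv * real n + 3 * Cv * (C1 * real n * r))"
    proof (intro mult_left_mono add_mono)
      have "C1 * real n * r / real k \<le> C1 * real n * r / 1" using k0 C1_pos sd by (intro divide_left_mono) auto
      then show "real (card ({..<n} - K)) \<le> C1 * real n * r" using K(2) by simp
    qed (use Cv_pos \<delta> in auto)
    also have "2 * (real n / l\<^sup>2 * (r * A1)) + 2 * (real n / l\<^sup>2 * (r * A2)) + (U / l)\<^sup>2 * (\<delta> * Cv * real n + 3 * Cv * (C1 * real n * r))
       = real n / l\<^sup>2 * (U\<^sup>2 * Cv * \<delta> + A * r)"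
      unfolding A_def by (simp add: algebra_simps add_divide_distrib power_divide)
    finally show "\<bar>psi s {..<n} - s\<^sup>2 / 2 * V {..<n}\<bar> \<le> real n / l\<^sup>2 * (U\<^sup>2 * Cv * \<delta> + A * r)" by simp
  qed
qed

end

section \<open>From Gaussian limits of log-Laplace transforms to deviation bounds\<close>

lemma ereal_mult_log_prob_le:
  assumes "0 < a" "0 \<le> p" "p \<le> exp (b / a)"
  shows "ereal a * log_prob p \<le> ereal b"
proof (cases "p = 0")
  case False
  then have "ln p \<le> ln (exp (b / a))" using assms by (intro ln_mono) auto
  then show ?thesis using False assms by (simp add: log_prob_def le_divide_eq mult.commute)
qed (use assms in \<open>simp add: log_prob_def\<close>)

lemma ereal_mult_log_prob_ge:
  assumes "0 < a" "exp (b / a) \<le> p"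
  shows "ereal b \<le> ereal a * log_prob p"
proof -
  have p: "0 < p" using assms(2) exp_gt_zero[of "b / a"] by linarith
  have "ln (exp (b / a)) \<le> ln p" using assms p by (intro ln_mono) auto
  then show ?thesis using p assms by (simp add: log_prob_def divide_le_eq mult.commute)
qed

text \<open>Constant factors are invisible at speed \<open>a\<close>; this absorbs the 2 and the 4
  in the two bounds below.\<close>

lemma eventually_le_exp_over:
  fixes a :: "nat \<Rightarrow> real"
  assumes "a \<longlonglongrightarrow> 0" "eventually (\<lambda>n. 0 < a n) sequentially" "0 < g" "0 < q"
  shows "eventually (\<lambda>n. q \<le> exp (g / a n)) sequentially"
proof -
  have "(\<lambda>n. a n * ln q) \<longlonglongrightarrow> 0 * ln q" by (intro tendsto_intros assms)
  then have "eventually (\<lambda>n. a n * ln q < g) sequentially" using assms(3) by (intro order_tendstoD) auto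
  with assms(2) show ?thesis
  proof eventually_elim
    case (elim n)
    then have "ln q \<le> g / a n" by (simp add: le_divide_eq mult.commute)
    then have "exp (ln q) \<le> exp (g / a n)" by simp
    then show ?case using assms(4) by simp
  qed
qed

lemma exp_scaled_ln:
  fixes a b m :: real
  assumes "0 < a" "0 < m"
  shows "m \<le> exp (b / a) \<longleftrightarrow> a * ln m \<le> b" "exp (b / a) \<le> m \<longleftrightarrow> b \<le> a * ln m"
proof -
  have "m \<le> exp (b / a) \<longleftrightarrow> ln m \<le> b / a" using exp_le_cancel_iff[of "ln m" "b / a"] assms by simp
  then show "m \<le> exp (b / a) \<longleftrightarrow> a * ln m \<le> b" using assms by (simp add: le_divide_eq mult.commute)
  have "exp (b / a) \<le> m \<longleftrightarrow> b / a \<le> ln m" using exp_le_cancel_iff[of "b / a" "ln m"] assms by simp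
  then show "exp (b / a) \<le> m \<longleftrightarrow> b \<le> a * ln m" using assms by (simp add: divide_le_eq mult.commute)
qed

text \<open>\<open>Z n\<close> plays the role of the rescaled variable
  \<open>sqrt (a n) * T n\<close>, so the natural Laplace parameter is
  \<open>\<theta> / a n\<close>. The limit \<open>\<theta>\<^sup>2 / 2\<close> is its own Legendre
  transform, which is where the rate \<open>t\<^sup>2 / 2\<close> comes from.\<close>

locale gaussian_mgf_limit = prob_space P for P :: "'a measure" +
  fixes Z :: "nat \<Rightarrow> 'a \<Rightarrow> real" and a :: "nat \<Rightarrow> real"
  assumes Z_measurable [measurable]: "\<And>n. Z n \<in> borel_measurable P"
    and mgf_integrable: "\<And>n s. integrable P (\<lambda>x. exp (s * Z n x))"
    and a_pos: "eventually (\<lambda>n. 0 < a n) sequentially" and a_lim: "a \<longlonglongrightarrow> 0"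
    and mgf_lim: "\<And>\<theta>. (\<lambda>n. a n * ln (expectation (\<lambda>x. exp (\<theta> / a n * Z n x)))) \<longlonglongrightarrow> \<theta>\<^sup>2 / 2"
begin

definition mgf :: "real \<Rightarrow> nat \<Rightarrow> real" where
  "mgf \<theta> n = expectation (\<lambda>x. exp (\<theta> / a n * Z n x))"

lemma mgf_integrable_divide [simp]:
  "integrable P (\<lambda>x. exp (s * Z n x / q))" "integrable P (\<lambda>x. exp (- (s * Z n x / q)))"
  using mgf_integrable[of "s / q" n] mgf_integrable[of "- s / q" n] by simp_all

lemma mgf_pos: "0 < mgf \<theta> n"
proof -
  have "mgf \<theta> n \<noteq> 0"
  proof
    assume "mgf \<theta> n = 0"
    then have "AE x in P. exp (\<theta> / a n * Z n x) = 0"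
      unfolding mgf_def by (subst (asm) integral_nonneg_eq_0_iff_AE) (auto intro: mgf_integrable)
    then have "AE x in P. False" by simp
    then show False by simp
  qed
  moreover have "0 \<le> mgf \<theta> n" unfolding mgf_def by simp
  ultimately show ?thesis by simp
qed

lemma eventually_mgf_le:
  assumes "\<theta>\<^sup>2 / 2 < b"
  shows "eventually (\<lambda>n. mgf \<theta> n \<le> exp (b / a n)) sequentially"
proof -
  have "eventually (\<lambda>n. a n * ln (mgf \<theta> n) < b) sequentially"
    using mgf_lim[of \<theta>] assms unfolding mgf_def[symmetric] by (rule order_tendstoD(2))
  with a_pos show ?thesis by eventually_elim (simp add: exp_scaled_ln mgf_pos)
qed

lemma eventually_mgf_ge:
  assumes "b < \<theta>\<^sup>2 / 2"
  shows "eventually (\<lambda>n. exp (b / a n) \<le> mgf \<theta> n) sequentially"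
proof -
  have "eventually (\<lambda>n. b < a n * ln (mgf \<theta> n)) sequentially"
    using mgf_lim[of \<theta>] assms unfolding mgf_def[symmetric] by (rule order_tendstoD(1))
  with a_pos show ?thesis by eventually_elim (simp add: exp_scaled_ln mgf_pos)
qed

text \<open>The rate function is even and increasing in the modulus, so its infimum over the closure
  is attained at a point \<open>t\<close> of least modulus and \<open>A\<close> lies outside the
  open interval of radius \<open>x = |t|\<close> about 0. A two-sided exponential Markov inequality
  at \<open>x\<close> and \<open>- x\<close> is then optimal for every Borel set, and no compactness
  or covering argument is involved.\<close>

lemma upper_bound:
  assumes A: "A \<in> sets borel"
  shows "limsup (\<lambda>n. ereal (a n) * log_prob (prob {x \<in> space P. Z n x \<in> A})) \<le> - (INF t\<in>closure A. ereal (t\<^sup>2 / 2))"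
proof (cases "A = {}")
  case True
  have "eventually (\<lambda>n. ereal (a n) * log_prob (prob {x \<in> space P. Z n x \<in> A}) \<le> -\<infinity>) sequentially"
    using a_pos by eventually_elim (simp add: True log_prob_def)
  then have "limsup (\<lambda>n. ereal (a n) * log_prob (prob {x \<in> space P. Z n x \<in> A})) \<le> -\<infinity>" by (rule Limsup_bounded)
  then show ?thesis unfolding True by (simp add: top_ereal_def)
next
  case False
  have [measurable]: "A \<in> sets borel" by fact
  obtain t where t: "t \<in> closure A" "\<And>y. y \<in> closure A \<Longrightarrow> dist 0 t \<le> dist 0 y"
    using distance_attains_inf[of "closure A" 0] False by auto
  define x where "x = \<bar>t\<bar>"
  have xA: "x \<le> \<bar>z\<bar>" if "z \<in> A" for z
    using t(2)[of z] that closure_subset[of A] unfolding x_def by auto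
  have "limsup (\<lambda>n. ereal (a n) * log_prob (prob {x \<in> space P. Z n x \<in> A})) \<le> ereal (- x\<^sup>2 / 2)"
  proof (rule ereal_le_epsilon2)
    fix e :: real assume e: "0 < e"
    have "eventually (\<lambda>n. ereal (a n) * log_prob (prob {x \<in> space P. Z n x \<in> A}) \<le> ereal (- x\<^sup>2 / 2 + e)) sequentially"
      using eventually_mgf_le[of x "x\<^sup>2 / 2 + e / 2", simplified, OF e]
        eventually_mgf_le[of "- x" "x\<^sup>2 / 2 + e / 2", simplified, OF e]
        eventually_le_exp_over[OF a_lim a_pos, of "e / 2" 2, simplified, OF e] a_pos
    proof eventually_elim
      case (elim n)
      let ?a = "a n"
      let ?A = "{x \<in> space P. Z n x \<in> A}"
      have [simp]: "integrable P (indicator ?A :: _ \<Rightarrow> real)" by (rule integrable_const_bound[where B=1]) auto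
      have "prob ?A = expectation (indicator ?A)" by simp
      also have "\<dots> \<le> expectation (\<lambda>w. exp (- x\<^sup>2 / ?a) * (exp (x / ?a * Z n w) + exp (- x / ?a * Z n w)))"
      proof (rule integral_mono)
        fix w
        show "indicator ?A w \<le> exp (- x\<^sup>2 / ?a) * (exp (x / ?a * Z n w) + exp (- x / ?a * Z n w))"
        proof (cases "w \<in> ?A")
          case True
          have x0: "0 \<le> x" unfolding x_def by simp
          have "x * x \<le> x * \<bar>Z n w\<bar>" using True xA x0 by (intro mult_left_mono) auto
          then have "x\<^sup>2 / ?a \<le> x * \<bar>Z n w\<bar> / ?a" using elim by (intro divide_right_mono) (auto simp: power2_eq_square)
          then have "1 \<le> exp (- x\<^sup>2 / ?a + x * \<bar>Z n w\<bar> / ?a)" by simp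
          also have "\<dots> = exp (- x\<^sup>2 / ?a) * exp (x * \<bar>Z n w\<bar> / ?a)" by (rule exp_add)
          also have "\<dots> \<le> exp (- x\<^sup>2 / ?a) * (exp (x / ?a * Z n w) + exp (- x / ?a * Z n w))"
            by (intro mult_left_mono) (auto simp: abs_if)
          finally show ?thesis using True by simp
        qed simp
      qed (use mgf_integrable in auto)
      also have "\<dots> = exp (- x\<^sup>2 / ?a) * (mgf x n + mgf (- x) n)"
        using mgf_integrable[of "x / ?a" n] mgf_integrable[of "- x / ?a" n] unfolding mgf_def by simp
      also have "\<dots> \<le> exp (- x\<^sup>2 / ?a) * (exp ((x\<^sup>2 / 2 + e / 2) / ?a) + exp ((x\<^sup>2 / 2 + e / 2) / ?a))"
        using elim by (intro mult_left_mono add_mono) auto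
      also have "\<dots> = 2 * exp (- x\<^sup>2 / ?a + (x\<^sup>2 / 2 + e / 2) / ?a)" by (simp only: exp_add) simp
      also have "\<dots> \<le> exp (e / 2 / ?a) * exp (- x\<^sup>2 / ?a + (x\<^sup>2 / 2 + e / 2) / ?a)"
        using elim by (intro mult_right_mono) auto
      also have "\<dots> = exp ((- x\<^sup>2 / 2 + e) / ?a)"
        unfolding exp_add[symmetric] add_divide_distrib[symmetric]
        by (intro arg_cong[where f=exp] arg_cong[where f="\<lambda>y. y / ?a"]) (simp add: field_simps)
      finally show ?case using elim by (intro ereal_mult_log_prob_le) auto
    qed
    then show "limsup (\<lambda>n. ereal (a n) * log_prob (prob {x \<in> space P. Z n x \<in> A})) \<le> ereal (- x\<^sup>2 / 2) + ereal e"
      by (simp add: Limsup_bounded)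
  qed
  also have "ereal (- x\<^sup>2 / 2) = - ereal (t\<^sup>2 / 2)" unfolding x_def by simp
  also have "\<dots> \<le> - (INF t\<in>closure A. ereal (t\<^sup>2 / 2))"
    unfolding ereal_minus_le_minus by (rule INF_lower[OF t(1)])
  finally show ?thesis .
qed

text \<open>Exponential tilting: the mass of \<open>exp (t * Z / a)\<close> outside \<open>\<bar>Z - t\<bar> < d\<close> is
  negligible because the exponents at \<open>t + d\<close> and \<open>t - d\<close> control the two tails.\<close>

lemma lower_bound:
  assumes A: "A \<in> sets borel"
  shows "- (INF t\<in>interior A. ereal (t\<^sup>2 / 2)) \<le> liminf (\<lambda>n. ereal (a n) * log_prob (prob {x \<in> space P. Z n x \<in> A}))"
    (is "_ \<le> liminf ?L")
proof -
  have [measurable]: "A \<in> sets borel" by fact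
  have "ereal (- t\<^sup>2 / 2) \<le> liminf ?L" if t: "t \<in> interior A" for t
  proof (rule ereal_le_epsilon2)
    fix e :: real assume e: "0 < e"
    obtain d0 where d0: "0 < d0" "ball t d0 \<subseteq> A" using t by (auto simp: mem_interior)
    \<comment> \<open>The bound by \<open>d0\<close> keeps the interval inside \<open>A\<close>; the
      other two make the total loss \<open>3 * g + |t| * d\<close> in the exponent at most
      \<open>e\<close>.\<close>
    define d where "d = min d0 (min 1 (e / (1 + \<bar>t\<bar>)))"
    have d: "0 < d" "d \<le> d0" "d \<le> 1" "d \<le> e / (1 + \<bar>t\<bar>)" unfolding d_def using d0 e by auto
    \<comment> \<open>Shifting the parameter by \<open>d\<close> gains
      \<open>d\<^sup>2 / 2 = 4 * g\<close> in each tail. One \<open>g\<close> is spent on the upper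
      bound at the shifted parameter and one on the lower bound at \<open>t\<close>, which leaves a
      margin of \<open>2 * g\<close>.\<close>
    define g where "g = d\<^sup>2 / 8"
    have g: "0 < g" unfolding g_def using d by simp
    have "d * d \<le> 1 * d" using d by (intro mult_right_mono) auto
    then have g3: "3 * g \<le> d" unfolding g_def power2_eq_square using d by simp
    have "d * (1 + \<bar>t\<bar>) \<le> e" using d(4) by (simp add: le_divide_eq add_pos_nonneg)
    then have small: "3 * g + \<bar>t\<bar> * d \<le> e" using g3 by (simp add: algebra_simps)
    have "eventually (\<lambda>n. ereal (- t\<^sup>2 / 2 - e) \<le> ?L n) sequentially"
      using eventually_mgf_ge[of "t\<^sup>2 / 2 - g" t, simplified, OF g]
        eventually_mgf_le[of "t + d" "(t + d)\<^sup>2 / 2 + g", simplified, OF g]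
        eventually_mgf_le[of "t - d" "(t - d)\<^sup>2 / 2 + g", simplified, OF g]
        eventually_le_exp_over[OF a_lim a_pos, of "2 * g" 4, simplified, OF g] a_pos
    proof eventually_elim
      case (elim n)
      let ?a = "a n"
      let ?B = "{x \<in> space P. \<bar>Z n x - t\<bar> < d}"
      have [simp]: "integrable P (indicator ?B :: _ \<Rightarrow> real)" by (rule integrable_const_bound[where B=1]) auto
      have "mgf t n \<le> expectation (\<lambda>w. exp ((t\<^sup>2 + \<bar>t\<bar> * d) / ?a) * indicator ?B w
          + exp (- d * (t + d) / ?a) * exp ((t + d) / ?a * Z n w) + exp (d * (t - d) / ?a) * exp ((t - d) / ?a * Z n w))"
        unfolding mgf_def
      proof (rule integral_mono)
        fix w assume w: "w \<in> space P"
        let ?z = "Z n w"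
        have nonneg: "0 \<le> exp ((t\<^sup>2 + \<bar>t\<bar> * d) / ?a) * indicator ?B w"
          "0 \<le> exp (- d * (t + d) / ?a) * exp ((t + d) / ?a * ?z)" "0 \<le> exp (d * (t - d) / ?a) * exp ((t - d) / ?a * ?z)"
          by simp_all
        consider "\<bar>?z - t\<bar> < d" | "t + d \<le> ?z" | "?z \<le> t - d" by linarith
        then show "exp (t / ?a * ?z) \<le> exp ((t\<^sup>2 + \<bar>t\<bar> * d) / ?a) * indicator ?B w
          + exp (- d * (t + d) / ?a) * exp ((t + d) / ?a * ?z) + exp (d * (t - d) / ?a) * exp ((t - d) / ?a * ?z)"
        proof cases
          case 1
          have "t * (?z - t) \<le> \<bar>t\<bar> * \<bar>?z - t\<bar>" by (metis abs_ge_self abs_mult)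
          also have "\<dots> \<le> \<bar>t\<bar> * d" using 1 by (intro mult_left_mono) auto
          finally have "t * ?z \<le> t\<^sup>2 + \<bar>t\<bar> * d" by (simp add: algebra_simps power2_eq_square)
          then have "t * ?z / ?a \<le> (t\<^sup>2 + \<bar>t\<bar> * d) / ?a" using elim by (intro divide_right_mono) auto
          then have "exp (t / ?a * ?z) \<le> exp ((t\<^sup>2 + \<bar>t\<bar> * d) / ?a) * indicator ?B w" using 1 w by simp
          with nonneg show ?thesis by linarith
        next
          case 2
          have "0 \<le> d * (?z - t - d)" using 2 d by simp
          then have "t * ?z \<le> - d * (t + d) + (t + d) * ?z" by (simp add: algebra_simps)
          then have "t * ?z / ?a \<le> (- d * (t + d) + (t + d) * ?z) / ?a" using elim by (intro divide_right_mono) auto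
          then have "exp (t / ?a * ?z) \<le> exp (- d * (t + d) / ?a + (t + d) / ?a * ?z)"
            by (subst (asm) add_divide_distrib[of "- d * (t + d)"]) simp
          then have "exp (t / ?a * ?z) \<le> exp (- d * (t + d) / ?a) * exp ((t + d) / ?a * ?z)" unfolding exp_add .
          with nonneg show ?thesis by linarith
        next
          case 3
          have "0 \<le> d * (t - d - ?z)" using 3 d by simp
          then have "t * ?z \<le> d * (t - d) + (t - d) * ?z" by (simp add: algebra_simps)
          then have "t * ?z / ?a \<le> (d * (t - d) + (t - d) * ?z) / ?a" using elim by (intro divide_right_mono) auto
          then have "exp (t / ?a * ?z) \<le> exp (d * (t - d) / ?a + (t - d) / ?a * ?z)"
            by (subst (asm) add_divide_distrib[of "d * (t - d)"]) simp
          then have "exp (t / ?a * ?z) \<le> exp (d * (t - d) / ?a) * exp ((t - d) / ?a * ?z)" unfolding exp_add .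
          with nonneg show ?thesis by linarith
        qed
      qed (intro Bochner_Integration.integrable_add integrable_mult_right mgf_integrable; simp)+
      also have "\<dots> = exp ((t\<^sup>2 + \<bar>t\<bar> * d) / ?a) * prob ?B + exp (- d * (t + d) / ?a) * mgf (t + d) n
         + exp (d * (t - d) / ?a) * mgf (t - d) n"
        using mgf_integrable[of "(t + d) / ?a" n] mgf_integrable[of "(t - d) / ?a" n]
        unfolding mgf_def by (simp del: times_divide_eq_left)
      also have "\<dots> \<le> exp ((t\<^sup>2 + \<bar>t\<bar> * d) / ?a) * prob ?B + exp (- d * (t + d) / ?a) * exp (((t + d)\<^sup>2 / 2 + g) / ?a)
         + exp (d * (t - d) / ?a) * exp (((t - d)\<^sup>2 / 2 + g) / ?a)"
        using elim by (intro add_mono mult_left_mono) auto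
      also have "exp (- d * (t + d) / ?a) * exp (((t + d)\<^sup>2 / 2 + g) / ?a) = exp ((t\<^sup>2 / 2 - 3 * g) / ?a)"
        unfolding exp_add[symmetric] add_divide_distrib[symmetric] g_def
        by (intro arg_cong[where f=exp] arg_cong[where f="\<lambda>y. y / ?a"]) (simp add: power2_eq_square algebra_simps add_divide_distrib diff_divide_distrib)
      also have "exp (d * (t - d) / ?a) * exp (((t - d)\<^sup>2 / 2 + g) / ?a) = exp ((t\<^sup>2 / 2 - 3 * g) / ?a)"
        unfolding exp_add[symmetric] add_divide_distrib[symmetric] g_def
        by (intro arg_cong[where f=exp] arg_cong[where f="\<lambda>y. y / ?a"]) (simp add: power2_eq_square algebra_simps add_divide_distrib diff_divide_distrib)
      finally have m: "mgf t n \<le> exp ((t\<^sup>2 + \<bar>t\<bar> * d) / ?a) * prob ?B + 2 * exp ((t\<^sup>2 / 2 - 3 * g) / ?a)" by simp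
      \<comment> \<open>The factor 4 makes both tails together at most half of the lower bound for
        \<open>mgf t n\<close>, so the interval around \<open>t\<close> carries the other
        half.\<close>
      have "4 * exp ((t\<^sup>2 / 2 - 3 * g) / ?a) \<le> exp (2 * g / ?a) * exp ((t\<^sup>2 / 2 - 3 * g) / ?a)"
        using elim by (intro mult_right_mono) auto
      also have "\<dots> = exp ((t\<^sup>2 / 2 - g) / ?a)"
        unfolding exp_add[symmetric] add_divide_distrib[symmetric] by (simp add: algebra_simps)
      finally have "exp ((t\<^sup>2 / 2 - g) / ?a) / 2 \<le> exp ((t\<^sup>2 + \<bar>t\<bar> * d) / ?a) * prob ?B"
        using m elim(1) by linarith
      then have "exp (- (t\<^sup>2 + \<bar>t\<bar> * d) / ?a) * (exp ((t\<^sup>2 / 2 - g) / ?a) / 2) \<le> exp (- (t\<^sup>2 + \<bar>t\<bar> * d) / ?a) * (exp ((t\<^sup>2 + \<bar>t\<bar> * d) / ?a) * prob ?B)"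
        by (intro mult_left_mono) auto
      also have "\<dots> = prob ?B" by (simp add: mult.assoc[symmetric] exp_add[symmetric] add_divide_distrib[symmetric])
      also have "prob ?B \<le> prob {x \<in> space P. Z n x \<in> A}"
        using d d0 by (intro finite_measure_mono) (auto simp: dist_real_def abs_minus_commute)
      finally have P: "exp (- (t\<^sup>2 + \<bar>t\<bar> * d) / ?a) * (exp ((t\<^sup>2 / 2 - g) / ?a) / 2) \<le> prob {x \<in> space P. Z n x \<in> A}" .
      have "exp (- (2 * g) / ?a) \<le> 1 / 2"
        using elim(4) by (simp add: exp_minus inverse_eq_divide divide_le_eq)
      then have "exp ((t\<^sup>2 / 2 - g) / ?a) * exp (- (2 * g) / ?a) \<le> exp ((t\<^sup>2 / 2 - g) / ?a) * (1 / 2)"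
        by (intro mult_left_mono) auto
      then have "exp ((t\<^sup>2 / 2 - g) / ?a) * exp (- (2 * g) / ?a) \<le> exp ((t\<^sup>2 / 2 - g) / ?a) / 2" by simp
      then have "exp (- (t\<^sup>2 + \<bar>t\<bar> * d) / ?a) * (exp ((t\<^sup>2 / 2 - g) / ?a) * exp (- (2 * g) / ?a))
         \<le> exp (- (t\<^sup>2 + \<bar>t\<bar> * d) / ?a) * (exp ((t\<^sup>2 / 2 - g) / ?a) / 2)"
        by (intro mult_left_mono) auto
      moreover have "exp (- (t\<^sup>2 + \<bar>t\<bar> * d) / ?a) * (exp ((t\<^sup>2 / 2 - g) / ?a) * exp (- (2 * g) / ?a))
         = exp ((- t\<^sup>2 / 2 - (3 * g + \<bar>t\<bar> * d)) / ?a)"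
        unfolding exp_add[symmetric] add_divide_distrib[symmetric]
        by (intro arg_cong[where f=exp] arg_cong[where f="\<lambda>y. y / ?a"]) (simp add: field_simps)
      moreover have "exp ((- t\<^sup>2 / 2 - e) / ?a) \<le> exp ((- t\<^sup>2 / 2 - (3 * g + \<bar>t\<bar> * d)) / ?a)"
        using small elim unfolding exp_le_cancel_iff by (intro divide_right_mono) auto
      ultimately have "exp ((- t\<^sup>2 / 2 - e) / ?a) \<le> prob {x \<in> space P. Z n x \<in> A}" using P by linarith
      then show ?case using elim by (intro ereal_mult_log_prob_ge)
    qed
    then have "ereal (- t\<^sup>2 / 2 - e) \<le> liminf ?L" by (rule Liminf_bounded)
    then have "ereal (- t\<^sup>2 / 2 - e) + ereal e \<le> liminf ?L + ereal e" by (rule add_right_mono)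
    then show "ereal (- t\<^sup>2 / 2) \<le> liminf ?L + ereal e" by simp
  qed
  then have "- liminf ?L \<le> ereal (t\<^sup>2 / 2)" if "t \<in> interior A" for t
    using that by (subst ereal_uminus_le_reorder) simp
  then have "- liminf ?L \<le> (INF t\<in>interior A. ereal (t\<^sup>2 / 2))" by (rule INF_greatest)
  then show ?thesis by (subst ereal_uminus_le_reorder)
qed

end

section \<open>The speed condition and the scale parameters\<close>

lemma log2_le: "1 \<le> (x::real) \<Longrightarrow> log 2 x \<le> 2 * ln x"
proof -
  assume x: "1 \<le> x"
  have "(1::real) / 2 \<le> ln 2"
    by (rule half_le_ln_2)
  then have "ln x * (1 / 2) \<le> ln x * ln 2" using x by (intro mult_left_mono) auto
  then show ?thesis by (simp add: log_def divide_le_eq)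
qed

text \<open>The two terms on the right account for \<open>l \<le> L\<^sup>2\<close>, where \<open>log 2 l\<close> is of order \<open>ln L\<close>,
  and for \<open>l > L\<^sup>2\<close>, where \<open>L\<close> is below \<open>sqrt l\<close>.\<close>

lemma scale_ratio_bound:
  fixes l L :: real
  assumes l: "1 \<le> l" and L: "exp 1 \<le> L"
  shows "(log 2 l + 1) * L / l \<le> 5 / (l / (L * ln L)) + (2 * ln l + 1) / sqrt l"
proof -
  have "1 \<le> exp (1::real)" by simp
  then have L1: "1 \<le> L" using L by (rule order.trans)
  have lnL: "1 \<le> ln L" using ln_mono[OF L] L1 by simp
  have k: "log 2 l + 1 \<le> 2 * ln l + 1" using log2_le[OF l] by simp
  have lnl: "0 \<le> ln l" using l by simp
  show ?thesis
  proof (cases "l \<le> L\<^sup>2")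
    case True
    have "ln l \<le> ln (L\<^sup>2)" using True l L1 by (intro ln_mono) auto
    also have "\<dots> = 2 * ln L" using L1 by (simp add: ln_realpow)
    finally have "log 2 l + 1 \<le> 5 * ln L" using k lnL by linarith
    then have "(log 2 l + 1) * L / l \<le> 5 * ln L * L / l"
      using L1 l by (intro divide_right_mono mult_right_mono) auto
    also have "\<dots> = 5 / (l / (L * ln L))" by (simp add: mult_ac)
    moreover have "0 \<le> (2 * ln l + 1) / sqrt l" using lnl l by simp
    ultimately show ?thesis by linarith
  next
    case False
    then have "L \<le> sqrt l" using L1 by (intro real_le_rsqrt) simp
    then have "(log 2 l + 1) * L / l \<le> (2 * ln l + 1) * sqrt l / l"
      using k L1 l lnl by (intro divide_right_mono mult_mono) auto
    also have "\<dots> = (2 * ln l + 1) / sqrt l"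
      using l by (metis divide_divide_eq_right real_div_sqrt times_divide_eq_right order.trans zero_le_one mult.commute divide_divide_eq_left)
    moreover have "0 \<le> 5 / (l / (L * ln L))" using lnL L1 l by simp
    ultimately show ?thesis by linarith
  qed
qed

context
  fixes a :: "nat \<Rightarrow> real"
  assumes a_pos: "\<And>n. n \<ge> 1 \<Longrightarrow> a n > 0" and a_lim: "a \<longlonglongrightarrow> 0"
    and speed: "filterlim (\<lambda>n. real n * a n / ((ln (real n))\<^sup>2 * (ln (ln (real n)))\<^sup>2)) at_top sequentially"
begin

definition scale_k :: "nat \<Rightarrow> nat" where "scale_k n = nat \<lceil>log 2 (sqrt (real n * a n))\<rceil>"

text \<open>The solution of \<open>r\<^sup>2 * l = k * ln n\<close>; equivalently, the outer block
  length \<open>r * l\<close> is \<open>k\<close> times the inner block length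
  \<open>ln n / r\<close>.\<close>

definition scale_r :: "nat \<Rightarrow> real" where
  "scale_r n = sqrt (real (scale_k n) * ln (real n) / sqrt (real n * a n))"

lemma speed_ratio: "filterlim (\<lambda>n. sqrt (real n * a n) / (ln (real n) * ln (ln (real n)))) at_top sequentially"
proof -
  have "filterlim (\<lambda>n. sqrt (real n * a n / ((ln (real n))\<^sup>2 * (ln (ln (real n)))\<^sup>2))) at_top sequentially"
    by (rule filterlim_compose[OF sqrt_at_top speed])
  moreover have "eventually (\<lambda>n. sqrt (real n * a n / ((ln (real n))\<^sup>2 * (ln (ln (real n)))\<^sup>2))
      = sqrt (real n * a n) / (ln (real n) * ln (ln (real n)))) sequentially"
  proof -
    have "eventually (\<lambda>n. 0 < ln (real n)) sequentially" "eventually (\<lambda>n. 0 < ln (ln (real n))) sequentially"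
      by real_asymp+
    then show ?thesis by eventually_elim (simp add: real_sqrt_divide real_sqrt_mult)
  qed
  ultimately show ?thesis by (simp cong: filterlim_cong)
qed

lemma ev_ln_n: "eventually (\<lambda>n. exp 1 \<le> ln (real n)) sequentially"
  by real_asymp

lemma l_at_top: "filterlim (\<lambda>n. sqrt (real n * a n)) at_top sequentially"
proof (rule filterlim_at_top_mono[OF speed_ratio])
  show "eventually (\<lambda>n. sqrt (real n * a n) / (ln (real n) * ln (ln (real n))) \<le> sqrt (real n * a n)) sequentially"
    using ev_ln_n eventually_ge_at_top[of 1]
  proof eventually_elim
    case (elim n)
    have "1 \<le> exp (1::real)" by simp
    then have 1: "1 \<le> ln (real n)" using elim(1) by (rule order.trans)
    have 2: "1 \<le> ln (ln (real n))" using ln_mono[OF elim(1)] 1 by simp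
    have "1 * 1 \<le> ln (real n) * ln (ln (real n))" using 1 2 by (intro mult_mono) auto
    then have "sqrt (real n * a n) / (ln (real n) * ln (ln (real n))) \<le> sqrt (real n * a n) / 1"
      using a_pos[of n] elim by (intro divide_left_mono) auto
    then show ?case by simp
  qed
qed

text \<open>Convergence of \<open>r\<close> to 0 means that \<open>l / (k * ln n)\<close> tends to
  infinity, whereas the square root of the speed assumption says so for
  \<open>l / (ln n * ln (ln n))\<close>. The step from \<open>k\<close>, about
  \<open>log 2 l\<close>, to \<open>ln (ln n)\<close> is \<open>scale_ratio_bound\<close>.\<close>

lemma scale_r_lim: "scale_r \<longlonglongrightarrow> 0"
proof -
  let ?l = "\<lambda>n. sqrt (real n * a n)"
  have 1: "(\<lambda>n. 5 / (?l n / (ln (real n) * ln (ln (real n))))) \<longlonglongrightarrow> 0"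
    by (rule real_tendsto_divide_at_top[OF tendsto_const speed_ratio])
  have "((\<lambda>x::real. (2 * ln x + 1) / sqrt x) \<longlongrightarrow> 0) at_top" by real_asymp
  then have 2: "(\<lambda>n. (2 * ln (?l n) + 1) / sqrt (?l n)) \<longlonglongrightarrow> 0"
    by (rule filterlim_compose[OF _ l_at_top])
  have 3: "(\<lambda>n. 5 / (?l n / (ln (real n) * ln (ln (real n)))) + (2 * ln (?l n) + 1) / sqrt (?l n)) \<longlonglongrightarrow> 0"
    using tendsto_add[OF 1 2] by simp
  have ev1: "eventually (\<lambda>n. 1 \<le> ?l n) sequentially"
    using l_at_top unfolding filterlim_at_top by blast
  have "(\<lambda>n. real (scale_k n) * ln (real n) / ?l n) \<longlonglongrightarrow> 0"
  proof (rule tendsto_sandwich[OF _ _ tendsto_const 3])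
    show "eventually (\<lambda>n. 0 \<le> real (scale_k n) * ln (real n) / ?l n) sequentially"
      using ev1 eventually_ge_at_top[of 1] by eventually_elim simp
    show "eventually (\<lambda>n. real (scale_k n) * ln (real n) / ?l n
       \<le> 5 / (?l n / (ln (real n) * ln (ln (real n)))) + (2 * ln (?l n) + 1) / sqrt (?l n)) sequentially"
      using ev1 ev_ln_n
    proof eventually_elim
      case (elim n)
      have "0 \<le> log 2 (?l n)" using elim by simp
      then have "real (scale_k n) \<le> log 2 (?l n) + 1" unfolding scale_k_def by linarith
      moreover have "0 \<le> ln (real n)" using elim(2) exp_gt_zero[of "1::real"] by linarith
      ultimately have "real (scale_k n) * ln (real n) / ?l n \<le> (log 2 (?l n) + 1) * ln (real n) / ?l n"
        using elim by (intro divide_right_mono mult_right_mono) auto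
      then show ?case using scale_ratio_bound[OF elim] by linarith
    qed
  qed
  then have "(\<lambda>n. sqrt (real (scale_k n) * ln (real n) / ?l n)) \<longlonglongrightarrow> sqrt 0" by (rule tendsto_real_sqrt)
  then show ?thesis by (simp add: scale_r_def[abs_def])
qed

lemma eventually_scales: "eventually (\<lambda>n. scales n (sqrt (real n * a n)) (scale_r n) (scale_k n)) sequentially"
proof -
  have ev1: "eventually (\<lambda>n. 2 \<le> sqrt (real n * a n)) sequentially"
    using l_at_top unfolding filterlim_at_top by blast
  have ev2: "eventually (\<lambda>n. scale_r n < 1 / 2) sequentially" using scale_r_lim by (rule order_tendstoD) simp
  have ev3: "eventually (\<lambda>n. a n < 1) sequentially" using a_lim by (rule order_tendstoD) simp
  show ?thesis
    using ev1 ev2 ev3 ev_ln_n eventually_ge_at_top[of 1]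
  proof eventually_elim
    case (elim n)
    let ?l = "sqrt (real n * a n)"
    have "1 \<le> exp (1::real)" by simp
    then have L: "1 \<le> ln (real n)" using elim(4) by (rule order.trans)
    have l: "2 \<le> ?l" by (rule elim)
    then have l0: "0 < ?l" by linarith
    have "log 2 2 \<le> log 2 ?l" using l l0 by (intro log_mono) auto
    then have lg: "1 \<le> log 2 ?l" by simp
    then have k: "log 2 ?l \<le> real (scale_k n)" "1 \<le> scale_k n" unfolding scale_k_def by linarith+
    have "?l = 2 powr (log 2 ?l)" by (rule powr_log_cancel[symmetric, OF _ _ l0]) simp_all
    also have "\<dots> \<le> 2 powr real (scale_k n)" by (intro powr_mono k) auto
    finally have lk: "?l \<le> 2 ^ scale_k n" by (simp add: powr_realpow)
    have pos: "0 < real (scale_k n) * ln (real n) / ?l"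
      by (intro divide_pos_pos mult_pos_pos l0) (use k L in auto)
    have "(scale_r n)\<^sup>2 = real (scale_k n) * ln (real n) / ?l" unfolding scale_r_def using pos by (intro real_sqrt_pow2) simp
    then have r: "(scale_r n)\<^sup>2 * ?l = real (scale_k n) * ln (real n)" using l0 by auto
    have r0: "0 < scale_r n" unfolding scale_r_def using pos by (rule real_sqrt_gt_zero)
    have "?l\<^sup>2 = real n * a n" using a_pos[of n] elim(5) by (intro real_sqrt_pow2) simp
    also have "\<dots> \<le> real n * 1" using elim by (intro mult_left_mono) auto
    finally have "?l\<^sup>2 \<le> real n" by simp
    moreover have "1 \<le> ?l" using l by linarith
    ultimately show ?case unfolding scales_def by (intro conjI L k lk r r0) (use elim(2) in auto)
  qed
qed


end

section \<open>Asymptotics of the log-Laplace transform at the moderate deviations scale\<close>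

context bounded_mixing begin

lemma psi_asymptotics:
  fixes a :: "nat \<Rightarrow> real"
  assumes a_pos: "\<And>n. n \<ge> 1 \<Longrightarrow> a n > 0" and a_lim: "a \<longlonglongrightarrow> 0"
    and speed: "filterlim (\<lambda>n. real n * a n / ((ln (real n))\<^sup>2 * (ln (ln (real n)))\<^sup>2)) at_top sequentially"
    and U: "0 < U" and s: "eventually (\<lambda>n. \<bar>s n\<bar> \<le> U / sqrt (real n * a n)) sequentially"
  shows "(\<lambda>n. a n * (psi (s n) {..<n} - (s n)\<^sup>2 / 2 * V {..<n})) \<longlonglongrightarrow> 0"
proof (rule tendstoI)
  fix e :: real assume e: "0 < e"
  \<comment> \<open>Makes the part of the error that does not vanish with \<open>r\<close> at most
    \<open>e / 2\<close>; the remaining \<open>e / 2\<close> is reached by letting \<open>r\<close>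
    tend to 0 for this fixed weight.\<close>
  define \<delta> where "\<delta> = min (1 / 2) (e / (2 * U\<^sup>2 * Cv))"
  have \<delta>: "0 < \<delta>" "\<delta> \<le> 1 / 2" unfolding \<delta>_def using e U Cv_pos by auto
  have "\<delta> * (2 * U\<^sup>2 * Cv) \<le> e"
  proof -
    have "\<delta> \<le> e / (2 * U\<^sup>2 * Cv)" unfolding \<delta>_def by simp
    then show ?thesis using U Cv_pos by (simp add: le_divide_eq)
  qed
  then have \<delta>e: "U\<^sup>2 * Cv * \<delta> \<le> e / 2" by (simp add: mult_ac)
  obtain \<tau> A where A: "0 < \<tau>" "0 < A"
    "\<And>n l r k s. scales n l r k \<Longrightarrow> r \<le> \<tau> \<Longrightarrow> \<bar>s\<bar> \<le> U / l \<Longrightarrow>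
      \<bar>psi s {..<n} - s\<^sup>2 / 2 * V {..<n}\<bar> \<le> real n / l\<^sup>2 * (U\<^sup>2 * Cv * \<delta> + A * r)"
    using psi_quadratic[OF U \<delta>] by blast
  have lim: "scale_r a \<longlonglongrightarrow> 0" by (rule scale_r_lim) (use a_pos a_lim speed in auto)
  have ev3: "eventually (\<lambda>n. scales n (sqrt (real n * a n)) (scale_r a n) (scale_k a n)) sequentially"
    by (rule eventually_scales) (use a_pos a_lim speed in auto)
  have ev1: "eventually (\<lambda>n. scale_r a n < \<tau>) sequentially" using lim A(1) by (rule order_tendstoD)
  have "0 < e / (2 * A)" using e A(2) by (intro divide_pos_pos) auto
  with lim have ev2: "eventually (\<lambda>n. scale_r a n < e / (2 * A)) sequentially" by (rule order_tendstoD)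
  show "eventually (\<lambda>n. dist (a n * (psi (s n) {..<n} - (s n)\<^sup>2 / 2 * V {..<n})) 0 < e) sequentially"
    using ev1 ev2 s ev3 eventually_ge_at_top[of 1]
  proof eventually_elim
    case (elim n)
    have an: "0 < a n" using a_pos elim by auto
    have l2: "(sqrt (real n * a n))\<^sup>2 = real n * a n" using an by (intro real_sqrt_pow2) simp
    have "\<bar>psi (s n) {..<n} - (s n)\<^sup>2 / 2 * V {..<n}\<bar>
       \<le> real n / (sqrt (real n * a n))\<^sup>2 * (U\<^sup>2 * Cv * \<delta> + A * scale_r a n)"
      by (rule A(3)[OF elim(4) _ elim(3)]) (use elim in simp)
    then have "a n * \<bar>psi (s n) {..<n} - (s n)\<^sup>2 / 2 * V {..<n}\<bar>
       \<le> a n * (real n / (sqrt (real n * a n))\<^sup>2 * (U\<^sup>2 * Cv * \<delta> + A * scale_r a n))"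
      using an by (intro mult_left_mono) auto
    also have "\<dots> = U\<^sup>2 * Cv * \<delta> + A * scale_r a n" unfolding l2 using an elim(5) by simp
    also have "A * scale_r a n < e / 2" using elim(2) A by (simp add: less_divide_eq mult_ac)
    finally show ?case using \<delta>e an by (simp add: dist_real_def abs_mult)
  qed
qed

text \<open>The linear lower bound for the variance makes the Laplace parameter \<open>s n\<close>
  of order \<open>1 / l\<close>, as \<open>psi_asymptotics\<close> requires. Normalization by
  \<open>sqrt (V {..<n})\<close> makes \<open>a n\<close> times the quadratic term exactly
  \<open>\<theta>\<^sup>2 / 2\<close> for large \<open>n\<close>, so convergence of
  \<open>V {..<n} / n\<close> does not have to be known.\<close>

lemma moderate_deviations:
  fixes a :: "nat \<Rightarrow> real"
  assumes a_pos: "\<And>n. n \<ge> 1 \<Longrightarrow> a n > 0" and a_lim: "a \<longlonglongrightarrow> 0"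
    and speed: "filterlim (\<lambda>n. real n * a n / ((ln (real n))\<^sup>2 * (ln (ln (real n)))\<^sup>2)) at_top sequentially"
    and v: "0 < v" "eventually (\<lambda>n. v * real n \<le> V {..<n}) sequentially"
  shows "gaussian_mgf_limit P (\<lambda>n x. sqrt (a n) * (blocksum {..<n} x / sqrt (V {..<n}))) a"
proof unfold_locales
  show "(\<lambda>x. sqrt (a n) * (blocksum {..<n} x / sqrt (V {..<n}))) \<in> borel_measurable P" for n by measurable
  show "integrable P (\<lambda>x. exp (s * (sqrt (a n) * (blocksum {..<n} x / sqrt (V {..<n})))))" for n s
    using integrable_exp_blocksum[of "s * sqrt (a n) / sqrt (V {..<n})" "{..<n}"] by (simp add: mult_ac)
  show ev_a: "eventually (\<lambda>n. 0 < a n) sequentially"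
    using eventually_ge_at_top[of 1] by eventually_elim (rule a_pos)
  show "a \<longlonglongrightarrow> 0" by fact
  fix \<theta> :: real
  define s where "s n = \<theta> / (sqrt (a n) * sqrt (V {..<n}))" for n
  define U where "U = (\<bar>\<theta>\<bar> + 1) / sqrt v"
  have U: "0 < U" unfolding U_def using v by (simp add: add_nonneg_pos)
  have "eventually (\<lambda>n. \<bar>s n\<bar> \<le> U / sqrt (real n * a n)) sequentially"
    using v(2) ev_a eventually_ge_at_top[of 1]
  proof eventually_elim
    case (elim n)
    have "sqrt (v * real n) \<le> sqrt (V {..<n})" using elim by simp
    then have "sqrt (a n) * sqrt (v * real n) \<le> sqrt (a n) * sqrt (V {..<n})" using elim by (intro mult_left_mono) auto
    moreover have "sqrt (a n) * sqrt (v * real n) = sqrt v * sqrt (real n * a n)" by (simp add: real_sqrt_mult mult_ac)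
    ultimately have le: "sqrt v * sqrt (real n * a n) \<le> sqrt (a n) * sqrt (V {..<n})" by simp
    have pos: "0 < sqrt v * sqrt (real n * a n)" using v elim by simp
    have "\<bar>s n\<bar> = \<bar>\<theta>\<bar> / (sqrt (a n) * sqrt (V {..<n}))" unfolding s_def using V_nonneg elim by (simp add: abs_mult)
    also have "\<dots> \<le> (\<bar>\<theta>\<bar> + 1) / (sqrt v * sqrt (real n * a n))"
      using pos by (intro frac_le le) auto
    finally show ?case unfolding U_def by simp
  qed
  then have "(\<lambda>n. a n * (psi (s n) {..<n} - (s n)\<^sup>2 / 2 * V {..<n})) \<longlonglongrightarrow> 0"
    by (rule psi_asymptotics[rotated 4]) (use a_pos a_lim speed U in auto)
  then have lim: "(\<lambda>n. a n * (psi (s n) {..<n} - (s n)\<^sup>2 / 2 * V {..<n}) + \<theta>\<^sup>2 / 2) \<longlonglongrightarrow> 0 + \<theta>\<^sup>2 / 2"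
    by (intro tendsto_add tendsto_const)
  \<comment> \<open>Only large \<open>n\<close> have a positive variance guaranteed; where it
    vanishes, division by 0 gives 0, which does not affect the limit.\<close>
  have "eventually (\<lambda>n. a n * (psi (s n) {..<n} - (s n)\<^sup>2 / 2 * V {..<n}) + \<theta>\<^sup>2 / 2
     = a n * ln (expectation (\<lambda>x. exp (\<theta> / a n * (sqrt (a n) * (blocksum {..<n} x / sqrt (V {..<n}))))))) sequentially"
    using v(2) ev_a eventually_ge_at_top[of 1]
  proof eventually_elim
    case (elim n)
    have "0 < v * real n" using v elim by simp
    then have Vn: "0 < V {..<n}" using elim(1) by linarith
    have "\<theta> / a n * (sqrt (a n) * (y / sqrt (V {..<n}))) = s n * y" for y
    proof -
      have "a n = sqrt (a n) * sqrt (a n)" using elim(2) by simp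
      then have "\<theta> / a n * sqrt (a n) = \<theta> / sqrt (a n)" using elim(2) by (simp add: field_simps)
      then show ?thesis unfolding s_def by (simp add: mult.assoc[symmetric])
    qed
    then have "psi (s n) {..<n} = ln (expectation (\<lambda>x. exp (\<theta> / a n * (sqrt (a n) * (blocksum {..<n} x / sqrt (V {..<n}))))))"
      unfolding psi_def by simp
    moreover have "a n * ((s n)\<^sup>2 / 2 * V {..<n}) = \<theta>\<^sup>2 / 2"
      unfolding s_def using Vn elim(2) by (simp add: power_divide power_mult_distrib)
    ultimately show ?case by (simp add: right_diff_distrib)
  qed
  with lim show "(\<lambda>n. a n * ln (expectation (\<lambda>x. exp (\<theta> / a n * (sqrt (a n) * (blocksum {..<n} x / sqrt (V {..<n}))))))) \<longlonglongrightarrow> \<theta>\<^sup>2 / 2"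
    using tendsto_cong by fastforce
qed

end

section \<open>Reduction of the given sequence to a bounded mixing sequence\<close>

text \<open>Suprema of reals are upper bounds only for sets bounded above. The bound 1 serves here
  for the supremum over events, and in the next lemma but one for the supremum over
  \<open>k\<close>.\<close>

lemma alpha_coeff_le_1:
  assumes "prob_space P" "{} \<in> \<A>" "{} \<in> \<B>"
  shows "alpha_coeff P \<A> \<B> \<le> 1"
    and "A \<in> \<A> \<Longrightarrow> B \<in> \<B> \<Longrightarrow> \<bar>measure P (A \<inter> B) - measure P A * measure P B\<bar> \<le> alpha_coeff P \<A> \<B>"
proof -
  interpret prob_space P by fact
  have le1: "\<bar>measure P (A \<inter> B) - measure P A * measure P B\<bar> \<le> 1" for A B
  proof -
    have "0 \<le> measure P A * measure P B" "measure P A * measure P B \<le> 1" by (auto intro: mult_le_one)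
    then show ?thesis using prob_le_1[of "A \<inter> B"] measure_nonneg[of P "A \<inter> B"] by (simp only: abs_le_iff) linarith
  qed
  show "alpha_coeff P \<A> \<B> \<le> 1"
    unfolding alpha_coeff_def by (rule cSUP_least) (use assms le1 in auto)
  have "bdd_above ((\<lambda>(A, B). \<bar>measure P (A \<inter> B) - measure P A * measure P B\<bar>) ` (\<A> \<times> \<B>))"
    by (rule bdd_aboveI[where M=1]) (use le1 in auto)
  from cSUP_upper[OF _ this, of "(A, B)"]
  show "A \<in> \<A> \<Longrightarrow> B \<in> \<B> \<Longrightarrow> \<bar>measure P (A \<inter> B) - measure P A * measure P B\<bar> \<le> alpha_coeff P \<A> \<B>"
    unfolding alpha_coeff_def by auto
qed

lemma empty_in_gen_sigma: "{} \<in> gen_sigma P X J"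
  unfolding gen_sigma_def by (rule sigma_sets.Empty)

lemma strong_mixing_bound:
  assumes "prob_space P" "1 \<le> k" "A \<in> gen_sigma P X {1..k}" "B \<in> gen_sigma P X {k + n..}"
  shows "\<bar>measure P (A \<inter> B) - measure P A * measure P B\<bar> \<le> strong_mixing P X n"
proof -
  have "bdd_above ((\<lambda>k. alpha_coeff P (gen_sigma P X {1..k}) (gen_sigma P X {k + n..})) ` {1..})"
    by (rule bdd_aboveI[where M=1]) (auto intro!: alpha_coeff_le_1 assms empty_in_gen_sigma)
  then have "alpha_coeff P (gen_sigma P X {1..k}) (gen_sigma P X {k + n..}) \<le> strong_mixing P X n"
    unfolding strong_mixing_def by (rule cSUP_upper[rotated]) (use assms in auto)
  then show ?thesis using alpha_coeff_le_1(2)[OF assms(1) empty_in_gen_sigma empty_in_gen_sigma assms(3,4)] by linarith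
qed

text \<open>Measurable transformations and reindexing can only shrink the generated sigma-algebras,
  so mixing survives truncation and the index shift.\<close>

lemma gen_sigma_compose_subset:
  assumes f: "f \<in> borel_measurable borel" and J: "\<And>j. j \<in> J \<Longrightarrow> \<pi> j \<in> I"
  shows "gen_sigma P (\<lambda>j x. f (X (\<pi> j) x)) J \<subseteq> gen_sigma P X I"
  unfolding gen_sigma_def
proof (rule sigma_sets_mono')
  show "(\<Union>j\<in>J. {(\<lambda>x. f (X (\<pi> j) x)) -` B \<inter> space P |B. B \<in> sets borel}) \<subseteq> (\<Union>i\<in>I. {X i -` B \<inter> space P |B. B \<in> sets borel})"
  proof safe
    fix j and B :: "real set" assume "j \<in> J" "B \<in> sets borel"
    moreover have "(\<lambda>x. f (X (\<pi> j) x)) -` B \<inter> space P = X (\<pi> j) -` (f -` B) \<inter> space P" by auto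
    moreover have "f -` B \<in> sets borel" using measurable_sets[OF f \<open>B \<in> sets borel\<close>] by simp
    ultimately show "(\<lambda>x. f (X (\<pi> j) x)) -` B \<inter> space P \<in> (\<Union>i\<in>I. {X i -` B \<inter> space P |B. B \<in> sets borel})"
      using J by blast
  qed
qed

lemma good_rate_function_gaussian: "good_rate_function (\<lambda>t. ereal (t\<^sup>2 / 2))"
  unfolding good_rate_function_def
proof (intro conjI allI)
  fix r :: real
  have "closed {t::real. t\<^sup>2 / 2 \<le> r}" by (intro closed_Collect_le continuous_intros) auto
  moreover have "bounded {t::real. t\<^sup>2 / 2 \<le> r}"
  proof (rule boundedI)
    fix t :: real assume "t \<in> {t. t\<^sup>2 / 2 \<le> r}"
    then have "\<bar>t\<bar>\<^sup>2 \<le> 2 * r" by simp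
    then show "norm t \<le> sqrt (2 * r)" by (simp add: real_le_rsqrt)
  qed
  ultimately show "compact {t. ereal (t\<^sup>2 / 2) \<le> ereal r}" by (simp add: compact_eq_bounded_closed)
qed simp

theorem theorem4:
  fixes P :: "'a measure"
    and X :: "nat \<Rightarrow> 'a \<Rightarrow> real"
    and M c :: real
    and a :: "nat \<Rightarrow> real"
  assumes "prob_space P"
    and "\<And>i. i \<ge> 1 \<Longrightarrow> X i \<in> borel_measurable P"
    and "\<And>i. i \<ge> 1 \<Longrightarrow> prob_space.expectation P (X i) = 0"
    and "M > 0"
    and "(SUP i\<in>{1..}. Linf_norm P (X i)) \<le> ereal M"
    and "c > 0"
    and "\<And>n. n \<ge> 1 \<Longrightarrow> strong_mixing P X n \<le> exp (- 2 * c * real n)"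
    and "liminf (\<lambda>n. ereal (prob_space.variance P (partial_sum X n) / real n)) > 0"
    and "\<And>n. n \<ge> 1 \<Longrightarrow> a n > 0"
    and "a \<longlonglongrightarrow> 0"
    and "filterlim (\<lambda>n. real n * a n / ((ln (real n))\<^sup>2 * (ln (ln (real n)))\<^sup>2)) at_top sequentially"
  shows "good_rate_function (\<lambda>t. ereal (t\<^sup>2 / 2)) \<and>
    moderate_deviations_principle P
      (\<lambda>n \<omega>. partial_sum X n \<omega> / sqrt (prob_space.variance P (partial_sum X n)))
      a (\<lambda>t. ereal (t\<^sup>2 / 2))"
proof
  show "good_rate_function (\<lambda>t. ereal (t\<^sup>2 / 2))" by (rule good_rate_function_gaussian)
  interpret prob_space P by fact
  have X_meas [measurable]: "X (Suc i) \<in> borel_measurable P" for i using assms(2) by simp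
  have X_bound: "AE x in P. \<bar>X (Suc i) x\<bar> \<le> M" for i
  proof -
    have "Linf_norm P (X (Suc i)) \<le> (SUP i\<in>{1..}. Linf_norm P (X i))" by (rule SUP_upper) simp
    then have le: "esssup P (\<lambda>x. ereal \<bar>X (Suc i) x\<bar>) \<le> ereal M"
      using assms(5) unfolding Linf_norm_def by (rule order.trans)
    show ?thesis using esssup_AE[of "\<lambda>x. ereal \<bar>X (Suc i) x\<bar>" P]
    proof eventually_elim
      case (elim x)
      from order.trans[OF elim le] show ?case by simp
    qed
  qed
  \<comment> \<open>Truncation at level \<open>M\<close> turns the essential bound into a pointwise
    one and changes each variable only on a null set, so means, variances and probabilities are
    preserved.\<close>
  define clip where "clip y = max (- M) (min M y)" for y :: real
  have clip [measurable]: "clip \<in> borel_measurable borel" unfolding clip_def[abs_def] by measurable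
  define Y where "Y = (\<lambda>i x. clip (X (Suc i) x))"
  have Y_eq: "AE x in P. Y i x = X (Suc i) x" for i
    using X_bound[of i] by eventually_elim (auto simp: Y_def clip_def abs_le_iff)
  have Y_meas [measurable]: "Y i \<in> borel_measurable P" for i unfolding Y_def by measurable
  interpret mix: bounded_mixing P Y M c
  proof unfold_locales
    show "Y i \<in> borel_measurable P" for i by (rule Y_meas)
    show "\<bar>Y i x\<bar> \<le> M" for i x using assms(4) by (auto simp: Y_def clip_def)
    show "expectation (Y i) = 0" for i
    proof -
      have "expectation (Y i) = expectation (X (Suc i))" by (rule integral_cong_AE) (use Y_eq in auto)
      then show ?thesis using assms(3)[of "Suc i"] by simp
    qed
    show "0 < M" "0 < c" by fact+
    fix k g A B assume g: "1 \<le> g" and A: "A \<in> gen_sigma P Y {..k}" and B: "B \<in> gen_sigma P Y {k + g..}"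
    \<comment> \<open>The shift maps \<open>{..k}\<close> into \<open>{1..Suc k}\<close>, whose
      endpoint is at least 1 as the supremum in \<open>strong_mixing\<close> requires; the gap
      \<open>g\<close> is unchanged.\<close>
    have "A \<in> gen_sigma P X {1..Suc k}"
      using A gen_sigma_compose_subset[OF clip, of "{..k}" Suc "{1..Suc k}" P X] unfolding Y_def by auto
    moreover have "B \<in> gen_sigma P X {Suc k + g..}"
      using B gen_sigma_compose_subset[OF clip, of "{k + g..}" Suc "{Suc k + g..}" P X] unfolding Y_def by auto
    ultimately have "\<bar>prob (A \<inter> B) - prob A * prob B\<bar> \<le> strong_mixing P X g"
      by (intro strong_mixing_bound) (use assms(1) in auto)
    also have "\<dots> \<le> exp (- 2 * c * real g)" by (rule assms(7)[OF g])
    finally show "\<bar>prob (A \<inter> B) - prob A * prob B\<bar> \<le> exp (- 2 * c * real g)" .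
  qed
  have S_meas [measurable]: "partial_sum X n \<in> borel_measurable P" for n
    unfolding partial_sum_def[abs_def] by (intro borel_measurable_sum) (use assms(2) in auto)
  have S_eq: "AE x in P. partial_sum X n x = mix.blocksum {..<n} x" for n
  proof -
    have "AE x in P. \<forall>i\<in>{..<n}. Y i x = X (Suc i) x" by (rule AE_finite_allI) (use Y_eq in auto)
    then show ?thesis
    proof eventually_elim
      case (elim x)
      have "partial_sum X n x = (\<Sum>i<n. X (Suc i) x)"
        unfolding partial_sum_def by (rule sum.reindex_bij_witness[of _ Suc "\<lambda>i. i - 1"]) auto
      then show ?case unfolding mix.blocksum_def using elim by simp
    qed
  qed
  have var: "variance (partial_sum X n) = mix.V {..<n}" for n
  proof -
    have "expectation (partial_sum X n) = expectation (mix.blocksum {..<n})"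
      by (rule integral_cong_AE) (use S_eq in auto)
    then have 0: "expectation (partial_sum X n) = 0" by (simp add: mix.expectation_blocksum)
    show ?thesis unfolding 0 mix.V_def
    proof (rule integral_cong_AE)
      show "AE x in P. (partial_sum X n x - 0)\<^sup>2 = (mix.blocksum {..<n} x)\<^sup>2"
        using S_eq[of n] by eventually_elim simp
    qed simp_all
  qed
  obtain v :: real where v: "0 < v" "eventually (\<lambda>n. v * real n \<le> mix.V {..<n}) sequentially"
  proof -
    obtain v where v: "0 < ereal v" "ereal v < liminf (\<lambda>n. ereal (variance (partial_sum X n) / real n))"
      using ereal_dense2[OF assms(8)] by blast
    have "eventually (\<lambda>n. ereal v < ereal (variance (partial_sum X n) / real n)) sequentially"
      using v(2) by (rule less_LiminfD)
    then have "eventually (\<lambda>n. v * real n \<le> mix.V {..<n}) sequentially"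
      using eventually_ge_at_top[of 1]
      by eventually_elim (simp add: var less_divide_eq)
    then show ?thesis using that v by simp
  qed
  interpret ldp: gaussian_mgf_limit P "\<lambda>n x. sqrt (a n) * (mix.blocksum {..<n} x / sqrt (mix.V {..<n}))" a
    by (rule mix.moderate_deviations[OF _ _ _ v]) (use assms(9,10,11) in auto)
  have prob_eq: "prob {x \<in> space P. sqrt (a n) * (partial_sum X n x / sqrt (mix.V {..<n})) \<in> A}
      = prob {x \<in> space P. sqrt (a n) * (mix.blocksum {..<n} x / sqrt (mix.V {..<n})) \<in> A}"
    if [measurable]: "A \<in> sets borel" for n A
  proof (rule finite_measure_eq_AE)
    show "AE x in P. x \<in> {x \<in> space P. sqrt (a n) * (partial_sum X n x / sqrt (mix.V {..<n})) \<in> A} \<longleftrightarrow>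
        x \<in> {x \<in> space P. sqrt (a n) * (mix.blocksum {..<n} x / sqrt (mix.V {..<n})) \<in> A}"
      using S_eq[of n] by eventually_elim simp
  qed measurable
  show "moderate_deviations_principle P
      (\<lambda>n \<omega>. partial_sum X n \<omega> / sqrt (variance (partial_sum X n))) a (\<lambda>t. ereal (t\<^sup>2 / 2))"
    unfolding moderate_deviations_principle_def Let_def var
  proof (intro conjI ballI)
    fix A :: "real set" assume A: "A \<in> sets borel"
    show "- (INF t\<in>interior A. ereal (t\<^sup>2 / 2)) \<le> liminf (\<lambda>n. ereal (a n) *
        log_prob (prob {\<omega> \<in> space P. sqrt (a n) * (partial_sum X n \<omega> / sqrt (mix.V {..<n})) \<in> A}))"
      unfolding prob_eq[OF A] by (rule ldp.lower_bound[OF A])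
    show "limsup (\<lambda>n. ereal (a n) *
        log_prob (prob {\<omega> \<in> space P. sqrt (a n) * (partial_sum X n \<omega> / sqrt (mix.V {..<n})) \<in> A}))
        \<le> - (INF t\<in>closure A. ereal (t\<^sup>2 / 2))"
      unfolding prob_eq[OF A] by (rule ldp.upper_bound[OF A])
  qed (simp_all add: assms(10) Liminf_le_Limsup)
qed

end
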